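(* Let $n\ge2$, and let $\mathcal K_n$ be either the planar partition monoid $\mathscr P\mathcal P_n$ or the Motzkin monoid $\mathcal M_n$ of degree $n$. (i) The ideals of $\mathcal K_n$ are exactly the sets $I_q=\{\alpha\in\mathcal K_n:\operatorname{rank}(\alpha)\le q\}$ for $q=0,\dots,n$, yielding the Rees congruences $R_q=R_{I_q}$. (ii) The retractable IN-pairs $(I,M)$ of $\mathcal K_n$ with $M=\{\overline{\mathrm{id}}_q\}$ for some $q$ are exactly $\mathscr C_0=(I_0,\{\overline{\mathrm{id}}_1\})$ and $\mathscr C_1=(I_1,\{\overline{\mathrm{id}}_2\})$, yielding the congruences $\lambda_0,\rho_0,\mu_0$ (from $\mathscr C_0$) and $\lambda_1,\rho_1,\mu_1$ (from $\mathscr C_1$). (iii) The congruences $R_0,\dots,R_n,\lambda_0,\rho_0,\mu_0,\lambda_1,\rho_1,\mu_1$ are pairwise distinct, and they are all the congruences of $\mathcal K_n$. (iv) The $*$-congruences of $\mathcal K_n$ are precisely these congruences other than $\lambda_0,\lambda_1,\rho_0,\rho_1$. (v) The order (inclusion) on $\operatorname{Cong}(\mathcal K_n)$ is as follows. The eight congruences $\xi_i$ with $\xi\in\{\mu,\lambda,\rho,R\}$ and $i\in\{0,1\}$ form the direct product of the four-element diamond $\mu<\lambda,\rho<R$ (with $\lambda,\rho$ incomparable) and the chain $0<1$ (that is, $\xi_i\subseteq\zeta_j$ iff $\xi\le\zeta$ in the diamond and $i\le j$), with bottom element $\mu_0=\Delta$ and top element $R_1$; above these there is the chain $R_1\subsetneq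 R_2\subsetneq\cdots\subsetneq R_n=\nabla$. The lattice $\operatorname{Cong}^*(\mathcal K_n)$ of $*$-congruences consists of the four-element diamond $\mu_0=\Delta<\mu_1,R_0<R_1$ (with $\mu_1,R_0$ incomparable) followed by the chain $R_1\subsetneq R_2\subsetneq\cdots\subsetneq R_n=\nabla$.
   Context: **Monoids.** Let $\mathbf n=\{1,\dots,n\}$, $\mathbf n'=\{1',\dots,n'\}$. The partition monoid $\mathcal P_n$ is the set of all set partitions of $\mathbf n\cup\mathbf n'$. To form $\alpha\beta$: rename each lower point $i'$ of $\alpha$ to $i''$ and each upper point $i$ of $\beta$ to $i''$, and consider the graph on $\mathbf n\cup\mathbf n''\cup\mathbf n'$ whose edges join points lying in a common block of (renamed) $\alpha$ or of (renamed) $\beta$; two points of $\mathbf n\cup\mathbf n'$ lie in the same block of $\alpha\beta$ iff they are connected by a path in this graph. Draw the points $1,\dots,n$ in order on an upper row and $1',\dots,n'$ directly below on a lower row. A partition is planar if it is the partition into connected components of some graph on $\mathbf n\cup\mathbf n'$ that can be drawn with all edges inside the rectangle spanned by the vertices and without edge crossings. $\mathscr P\mathcal P_n$ is the submonoid of $\mathcal P_n$ of all planar partitions, and $\mathcal M_n$ is the submonoid of all planar partitions all of whose blocks have size at most $2$. A block is a transversal if it meets both $\mathbf n$ and $\mathbf n'$; $\operatorname{rank}(\alpha)$ is the number of transversals of $\alpha$. The involution $\alpha\mapsto\alpha^*$ interchanges $i$ and $i'$ for every $i$; a $*$-congruence is a congruence $\xi$ such that $(\alpha,\beta)\in\xi$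 implies $(\alpha^*,\beta^* )\in\xi$. The $\mathscr J$-classes of $\mathcal K_n$ are $J_q=\{\alpha\in\mathcal K_n:\operatorname{rank}(\alpha)=q\}$, $0\le q\le n$, and all maximal subgroups are trivial. $\overline{\mathrm{id}}_q\in J_q$ is the idempotent with transversals $\{i,i'\}$ ($1\le i\le q$) and all other blocks singletons. **General constructions**, for a finite semigroup $S$ with minimal ideal $M$. $S^1$ is $S$ with an identity adjoined if necessary; $\mathscr R,\mathscr L,\mathscr H,\mathscr J$ are Green's relations; the $\mathscr J$-classes are ordered by $J_a\le J_b$ iff $a\in S^1bS^1$. $\Delta=\{(a,a):a\in S\}$, $\nabla=S\times S$. Ideals are non-empty. The Rees congruence of an ideal $I$ is $R_I=\Delta\cup(I\times I)$. An ideal $I$ is retractable if there is a homomorphism $f:I\to M$ (a retraction) with $xf=x$ for all $x\in M$; such $f$ is then unique. An IN-pair is a pair $(I,N)$ where $I$ is an ideal and $N$ is a normal subgroup of a maximal subgroup of $S$ contained in some regular $\mathscr J$-class $J$ that is minimal among the $\mathscr J$-classes contained in $S\setminus I$. Put $\nu_N=\{(sxt,syt)\in J\times J: x,y\in N,\ s,t\in S^1\}$ (which is the equality relation on $J$ if $|N|=1$). The IN-pair is retractable if $I$ is retractable and $|xN|=|Nx|=1$ for all $x\in M$; then, with $f:I\to M$ the retraction, $\lambda_{I,N}=\Delta\cup\nu_N\cup\{(x,y)\in I\times I:xf\mathrel{\mathscr L}yf\}$, $\rho_{I,N}=\Delta\cup\nu_N\cup\{(x,y)\in I\times I:xf\mathrel{\mathscr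 R}yf\}$, $\mu_{I,N}=\Delta\cup\nu_N\cup\{(x,y)\in I\times I:xf\mathrel{\mathscr H}yf\}$. **Abbreviations.** $\lambda_0=\lambda_{\mathscr C_0}$, $\lambda_1=\lambda_{\mathscr C_1}$, and similarly for $\rho,\mu$. *)

theory Defs
  imports "HOL-Analysis.Analysis" "HOL-Algebra.Coset" "HOL-Library.Disjoint_Sets"
begin

section \<open>Partition monoids\<close>

text \<open>\<open>Upper i\<close> is the point \<open>i\<close>, and \<open>Lower i\<close> is the point \<open>i'\<close>.\<close>

datatype point = Upper nat | Lower nat

definition points :: "nat \<Rightarrow> point set" where
  "points n = Upper ` {1..n} \<union> Lower ` {1..n}"

definition partitions :: "nat \<Rightarrow> point set set set" where
  "partitions n = {\<alpha>. partition_on (points n) \<alpha>}"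

text \<open>The product graph has vertices in \<^typ>\<open>point + nat\<close>: \<open>Inl\<close> marks the points of the
  outer two rows, and \<open>Inr i\<close> is the middle point \<open>i''\<close>.\<close>

fun lower_to_middle :: "point \<Rightarrow> point + nat" where
  "lower_to_middle (Upper i) = Inl (Upper i)"
| "lower_to_middle (Lower i) = Inr i"

fun upper_to_middle :: "point \<Rightarrow> point + nat" where
  "upper_to_middle (Upper i) = Inr i"
| "upper_to_middle (Lower i) = Inl (Lower i)"

definition product_graph :: "point set set \<Rightarrow> point set set \<Rightarrow> (point + nat) rel" where
  "product_graph \<alpha> \<beta> =
     {(x, y). \<exists>A \<in> image lower_to_middle ` \<alpha> \<union> image upper_to_middle ` \<beta>. x \<in> A \<and> y \<in> A}"

definition pprod :: "nat \<Rightarrow> point set set \<Rightarrow> point set set \<Rightarrow> point set set" where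
  "pprod n \<alpha> \<beta> =
     points n // {(x, y) \<in> points n \<times> points n. (Inl x, Inl y) \<in> (product_graph \<alpha> \<beta>)\<^sup>*}"

definition transversal :: "point set \<Rightarrow> bool" where
  "transversal A \<longleftrightarrow> (\<exists>i. Upper i \<in> A) \<and> (\<exists>i. Lower i \<in> A)"

definition prank :: "point set set \<Rightarrow> nat" where
  "prank \<alpha> = card {A \<in> \<alpha>. transversal A}"

fun flip :: "point \<Rightarrow> point" where
  "flip (Upper i) = Lower i"
| "flip (Lower i) = Upper i"

definition pstar :: "point set set \<Rightarrow> point set set" where
  "pstar \<alpha> = image flip ` \<alpha>"

definition id_bar :: "nat \<Rightarrow> nat \<Rightarrow> point set set" where
  "id_bar n q =
     {{Upper i, Lower i} | i. i \<in> {1..q}} \<union> {{Upper i} | i. i \<in> {q<..n}} \<union> {{Lower i} | i. i \<in> {q<..n}}"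


section \<open>Planarity\<close>

fun pos :: "point \<Rightarrow> real \<times> real" where
  "pos (Upper i) = (real i, 1)"
| "pos (Lower i) = (real i, 0)"

text \<open>A graph is given by its set \<open>E\<close> of edges, an edge being the set of its two end points;
  loops and multiple edges do not affect connected components. In a drawing \<open>\<gamma>\<close>, edges are arcs
  that avoid all vertices other than their end points, and two different edges meet at most in
  common end points.\<close>

definition graph_on :: "nat \<Rightarrow> point set set \<Rightarrow> bool" where
  "graph_on n E \<longleftrightarrow> (\<forall>e \<in> E. e \<subseteq> points n \<and> card e = 2)"

definition planar_drawing :: "nat \<Rightarrow> point set set \<Rightarrow> (point set \<Rightarrow> real \<Rightarrow> real \<times> real) \<Rightarrow> bool" where
  "planar_drawing n E \<gamma> \<longleftrightarrow>
     (\<forall>e \<in> E. arc (\<gamma> e) \<and>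
        {pathstart (\<gamma> e), pathfinish (\<gamma> e)} = pos ` e \<and>
        path_image (\<gamma> e) \<subseteq> {1..real n} \<times> {0..1} \<and>
        path_image (\<gamma> e) \<inter> pos ` points n = pos ` e) \<and>
     (\<forall>e \<in> E. \<forall>e' \<in> E. e \<noteq> e' \<longrightarrow>
        path_image (\<gamma> e) \<inter> path_image (\<gamma> e') \<subseteq> pos ` (e \<inter> e'))"

definition graph_components :: "nat \<Rightarrow> point set set \<Rightarrow> point set set" where
  "graph_components n E =
     points n // {(x, y) \<in> points n \<times> points n. (x, y) \<in> {(u, v). {u, v} \<in> E}\<^sup>*}"

definition planar_partition :: "nat \<Rightarrow> point set set \<Rightarrow> bool" where
  "planar_partition n \<alpha> \<longleftrightarrow>
     (\<exists>E \<gamma>. graph_on n E \<and> planar_drawing n E \<gamma> \<and> \<alpha> = graph_components n E)"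

definition planar_partition_monoid :: "nat \<Rightarrow> point set set monoid" where
  "planar_partition_monoid n =
     \<lparr>carrier = {\<alpha> \<in> partitions n. planar_partition n \<alpha>}, mult = pprod n, one = id_bar n n\<rparr>"

definition motzkin_monoid :: "nat \<Rightarrow> point set set monoid" where
  "motzkin_monoid n =
     \<lparr>carrier = {\<alpha> \<in> partitions n. planar_partition n \<alpha> \<and> (\<forall>A \<in> \<alpha>. card A \<le> 2)},
      mult = pprod n, one = id_bar n n\<rparr>"


section \<open>Ideals, congruences and Green's relations\<close>

text \<open>The structures \<open>S\<close> below are meant to be (finite) monoids, so that \<open>S\<^sup>1 = S\<close>.\<close>

definition sg_ideal :: "('a, 'b) monoid_scheme \<Rightarrow> 'a set \<Rightarrow> bool" where
  "sg_ideal S I \<longleftrightarrow> I \<noteq> {} \<and> I \<subseteq> carrier S \<and>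
     (\<forall>x \<in> I. \<forall>s \<in> carrier S. s \<otimes>\<^bsub>S\<^esub> x \<in> I \<and> x \<otimes>\<^bsub>S\<^esub> s \<in> I)"

definition min_ideal :: "('a, 'b) monoid_scheme \<Rightarrow> 'a set" where
  "min_ideal S = (THE M. sg_ideal S M \<and> (\<forall>I. sg_ideal S I \<and> I \<subseteq> M \<longrightarrow> I = M))"

definition sg_congruence :: "('a, 'b) monoid_scheme \<Rightarrow> 'a rel \<Rightarrow> bool" where
  "sg_congruence S \<xi> \<longleftrightarrow> equiv (carrier S) \<xi> \<and>
     (\<forall>(x, y) \<in> \<xi>. \<forall>s \<in> carrier S.
        (s \<otimes>\<^bsub>S\<^esub> x, s \<otimes>\<^bsub>S\<^esub> y) \<in> \<xi> \<and> (x \<otimes>\<^bsub>S\<^esub> s, y \<otimes>\<^bsub>S\<^esub> s) \<in> \<xi>)"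

definition star_congruence :: "('a, 'b) monoid_scheme \<Rightarrow> ('a \<Rightarrow> 'a) \<Rightarrow> 'a rel \<Rightarrow> bool" where
  "star_congruence S star \<xi> \<longleftrightarrow> sg_congruence S \<xi> \<and> (\<forall>(x, y) \<in> \<xi>. (star x, star y) \<in> \<xi>)"

definition rees_cong :: "('a, 'b) monoid_scheme \<Rightarrow> 'a set \<Rightarrow> 'a rel" where
  "rees_cong S I = Id_on (carrier S) \<union> I \<times> I"

definition right_principal :: "('a, 'b) monoid_scheme \<Rightarrow> 'a \<Rightarrow> 'a set" where
  "right_principal S a = {a \<otimes>\<^bsub>S\<^esub> s | s. s \<in> carrier S}"

definition left_principal :: "('a, 'b) monoid_scheme \<Rightarrow> 'a \<Rightarrow> 'a set" where
  "left_principal S a = {s \<otimes>\<^bsub>S\<^esub> a | s. s \<in> carrier S}"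

definition principal :: "('a, 'b) monoid_scheme \<Rightarrow> 'a \<Rightarrow> 'a set" where
  "principal S a = {s \<otimes>\<^bsub>S\<^esub> a \<otimes>\<^bsub>S\<^esub> t | s t. s \<in> carrier S \<and> t \<in> carrier S}"

definition green_R :: "('a, 'b) monoid_scheme \<Rightarrow> 'a rel" where
  "green_R S = {(a, b) \<in> carrier S \<times> carrier S. right_principal S a = right_principal S b}"

definition green_L :: "('a, 'b) monoid_scheme \<Rightarrow> 'a rel" where
  "green_L S = {(a, b) \<in> carrier S \<times> carrier S. left_principal S a = left_principal S b}"

definition green_H :: "('a, 'b) monoid_scheme \<Rightarrow> 'a rel" where
  "green_H S = green_L S \<inter> green_R S"

definition green_J :: "('a, 'b) monoid_scheme \<Rightarrow> 'a rel" where
  "green_J S = {(a, b) \<in> carrier S \<times> carrier S. principal S a = principal S b}"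

definition J_classes :: "('a, 'b) monoid_scheme \<Rightarrow> 'a set set" where
  "J_classes S = carrier S // green_J S"

definition J_class_le :: "('a, 'b) monoid_scheme \<Rightarrow> 'a set \<Rightarrow> 'a set \<Rightarrow> bool" where
  "J_class_le S A B \<longleftrightarrow> (\<exists>a \<in> A. \<exists>b \<in> B. a \<in> principal S b)"

definition regular_element :: "('a, 'b) monoid_scheme \<Rightarrow> 'a \<Rightarrow> bool" where
  "regular_element S x \<longleftrightarrow> (\<exists>y \<in> carrier S. x \<otimes>\<^bsub>S\<^esub> y \<otimes>\<^bsub>S\<^esub> x = x)"


section \<open>Retractable IN-pairs\<close>

text \<open>A subgroup \<open>G\<close> of \<open>S\<close> in the sense of semigroup theory: its identity \<open>e\<close> is an idempotent
  of \<open>S\<close>, in general not the identity of \<open>S\<close>.\<close>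

definition sg_subgroup :: "('a, 'b) monoid_scheme \<Rightarrow> 'a set \<Rightarrow> 'a \<Rightarrow> bool" where
  "sg_subgroup S G e \<longleftrightarrow> G \<subseteq> carrier S \<and> group (S\<lparr>carrier := G, one := e\<rparr>)"

definition maximal_subgroup :: "('a, 'b) monoid_scheme \<Rightarrow> 'a set \<Rightarrow> 'a \<Rightarrow> bool" where
  "maximal_subgroup S G e \<longleftrightarrow> sg_subgroup S G e \<and>
     (\<forall>G' e'. sg_subgroup S G' e' \<and> G \<subseteq> G' \<longrightarrow> G' = G)"

definition IN_pair :: "('a, 'b) monoid_scheme \<Rightarrow> 'a set \<Rightarrow> 'a set \<Rightarrow> bool" where
  "IN_pair S I N \<longleftrightarrow> sg_ideal S I \<and>
     (\<exists>J G e. J \<in> J_classes S \<and> (\<forall>x \<in> J. regular_element S x) \<and>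
        J \<subseteq> carrier S - I \<and>
        (\<forall>J' \<in> J_classes S. J' \<subseteq> carrier S - I \<and> J_class_le S J' J \<longrightarrow> J' = J) \<and>
        maximal_subgroup S G e \<and> G \<subseteq> J \<and> N \<lhd> S\<lparr>carrier := G, one := e\<rparr>)"

definition is_retraction :: "('a, 'b) monoid_scheme \<Rightarrow> 'a set \<Rightarrow> ('a \<Rightarrow> 'a) \<Rightarrow> bool" where
  "is_retraction S I f \<longleftrightarrow>
     f \<in> hom (S\<lparr>carrier := I\<rparr>) (S\<lparr>carrier := min_ideal S\<rparr>) \<and> (\<forall>x \<in> min_ideal S. f x = x)"

definition retractable :: "('a, 'b) monoid_scheme \<Rightarrow> 'a set \<Rightarrow> bool" where
  "retractable S I \<longleftrightarrow> sg_ideal S I \<and> (\<exists>f. is_retraction S I f)"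

text \<open>The values of a retraction on \<open>I\<close> are unique, so the choice only affects values outside
  \<open>I\<close>.\<close>

definition the_retraction :: "('a, 'b) monoid_scheme \<Rightarrow> 'a set \<Rightarrow> 'a \<Rightarrow> 'a" where
  "the_retraction S I = (SOME f. is_retraction S I f)"

definition retractable_IN_pair :: "('a, 'b) monoid_scheme \<Rightarrow> 'a set \<Rightarrow> 'a set \<Rightarrow> bool" where
  "retractable_IN_pair S I N \<longleftrightarrow> IN_pair S I N \<and> retractable S I \<and>
     (\<forall>x \<in> min_ideal S. card (x <#\<^bsub>S\<^esub> N) = 1 \<and> card (N #>\<^bsub>S\<^esub> x) = 1)"

text \<open>The class \<open>J\<close> is determined by the nonempty set \<open>N\<close>.\<close>

definition nu :: "('a, 'b) monoid_scheme \<Rightarrow> 'a set \<Rightarrow> 'a rel" where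
  "nu S N = {(s \<otimes>\<^bsub>S\<^esub> x \<otimes>\<^bsub>S\<^esub> t, s \<otimes>\<^bsub>S\<^esub> y \<otimes>\<^bsub>S\<^esub> t) | s x y t.
     x \<in> N \<and> y \<in> N \<and> s \<in> carrier S \<and> t \<in> carrier S \<and>
     (\<exists>J \<in> J_classes S. N \<subseteq> J \<and> s \<otimes>\<^bsub>S\<^esub> x \<otimes>\<^bsub>S\<^esub> t \<in> J \<and> s \<otimes>\<^bsub>S\<^esub> y \<otimes>\<^bsub>S\<^esub> t \<in> J)}"

definition lambda_cong :: "('a, 'b) monoid_scheme \<Rightarrow> 'a set \<Rightarrow> 'a set \<Rightarrow> 'a rel" where
  "lambda_cong S I N = Id_on (carrier S) \<union> nu S N \<union>
     {(x, y) \<in> I \<times> I. (the_retraction S I x, the_retraction S I y) \<in> green_L S}"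

definition rho_cong :: "('a, 'b) monoid_scheme \<Rightarrow> 'a set \<Rightarrow> 'a set \<Rightarrow> 'a rel" where
  "rho_cong S I N = Id_on (carrier S) \<union> nu S N \<union>
     {(x, y) \<in> I \<times> I. (the_retraction S I x, the_retraction S I y) \<in> green_R S}"

definition mu_cong :: "('a, 'b) monoid_scheme \<Rightarrow> 'a set \<Rightarrow> 'a set \<Rightarrow> 'a rel" where
  "mu_cong S I N = Id_on (carrier S) \<union> nu S N \<union>
     {(x, y) \<in> I \<times> I. (the_retraction S I x, the_retraction S I y) \<in> green_H S}"


section \<open>The congruences of planar monoids\<close>

definition rank_ideal :: "point set set monoid \<Rightarrow> nat \<Rightarrow> point set set set" where
  "rank_ideal K q = {\<alpha> \<in> carrier K. prank \<alpha> \<le> q}"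

datatype diamond = Mu | Lambda | Rho | Rees

definition diamond_le :: "diamond \<Rightarrow> diamond \<Rightarrow> bool" where
  "diamond_le x y \<longleftrightarrow> x = y \<or> x = Mu \<or> y = Rees"

text \<open>\<open>xi n K \<xi> i\<close> is the congruence \<open>\<xi>\<^sub>i\<close>, for \<open>i \<in> {0, 1}\<close> and \<open>\<xi>\<close> one of \<open>\<mu>, \<lambda>, \<rho>, R\<close>
  (and for all \<open>i \<le> n\<close> in the case of \<open>R\<close>).\<close>

fun xi :: "nat \<Rightarrow> point set set monoid \<Rightarrow> diamond \<Rightarrow> nat \<Rightarrow> point set set rel" where
  "xi n K Mu i = mu_cong K (rank_ideal K i) {id_bar n (i + 1)}"
| "xi n K Lambda i = lambda_cong K (rank_ideal K i) {id_bar n (i + 1)}"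
| "xi n K Rho i = rho_cong K (rank_ideal K i) {id_bar n (i + 1)}"
| "xi n K Rees i = rees_cong K (rank_ideal K i)"

end

theory Submission
  imports Defs
begin

text \<open>Planarity is translated into the combinatorial condition that no two blocks cross in the
  clockwise order of the points; only this condition is used afterwards.

  Given a congruence \<open>\<xi>\<close>, suppose that it relates two different elements, the larger of their ranks
  being \<open>q\<close>. If \<open>q \<ge> 1\<close>, multiplication by suitable elements separates their ranks, so every
  element of rank \<open>q\<close> is \<open>\<xi>\<close>-related to one of smaller rank. If \<open>q \<ge> 2\<close>, multiplying by partial
  identities pushes the rank further down to 0, and then \<open>\<xi>\<close> identifies all of \<open>I\<^sub>q\<close>. If \<open>q \<le> 1\<close>,
  an element \<open>\<alpha>\<close> of \<open>I\<^sub>1\<close> is related to its retract (obtained by cutting the transversal) as soon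
  as \<open>q = 1\<close>, and elements of rank 0 form a rectangular band indexed by upper and lower patterns:
  one pair with different upper (lower) patterns generates all such pairs, by splitting
  off points from the blocks one at a time. Hence \<open>\<xi>\<close> is determined by \<open>q\<close> and by which of the two
  patterns it preserves.\<close>

subsection \<open>Partitions as equivalence relations\<close>

text \<open>Rank 1 is the threshold of the classification. A right factor changes the upper pattern
  of a diagram only by joining upper blocks, which takes two transversals; so up to rank 1 a product
  takes its upper pattern from the left factor and its lower pattern from the right one, and cutting
  the transversal is a homomorphism. At rank 2 this fails: a factor with upper block
  \<open>{1, 2}\<close> merges two transversals. The main obstacle is to separate two different
  diagrams of equal positive rank by the ranks of their multiples alone. Transversals are detected
  by cutting both diagrams down to point sets between which only one diagram of full rank exists,
  because an order-preserving bijection is unique. Non-transversal blocks are detected by rerouting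
  a transversal through them, which needs at least one transversal and explains why rank 0 behaves
  differently. Every diagram built on the way has small blocks whenever the diagram that it is built
  from does, so both monoids share one proof.\<close>

definition linked :: "point set set \<Rightarrow> point \<Rightarrow> point \<Rightarrow> bool" where
  "linked \<alpha> x y \<longleftrightarrow> (\<exists>A\<in>\<alpha>. x \<in> A \<and> y \<in> A)"

text \<open>The quotient form common to \<open>pprod\<close> and \<open>graph_components\<close>, so
  that \<open>linked_partition_of\<close> describes the blocks of both.\<close>

definition partition_of :: "nat \<Rightarrow> (point \<Rightarrow> point \<Rightarrow> bool) \<Rightarrow> point set set" where
  "partition_of n R = points n // {(x, y) \<in> points n \<times> points n. R x y}"

lemma Upper_in_points [simp]: "Upper i \<in> points n \<longleftrightarrow> 1 \<le> i \<and> i \<le> n"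
  and Lower_in_points [simp]: "Lower i \<in> points n \<longleftrightarrow> 1 \<le> i \<and> i \<le> n"
  by (auto simp: points_def)

lemma finite_points [simp]: "finite (points n)"
  by (simp add: points_def)

lemma linked_sym: "linked \<alpha> x y \<longleftrightarrow> linked \<alpha> y x"
  unfolding linked_def by auto

lemma linked_in_points:
  assumes "\<alpha> \<in> partitions n" "linked \<alpha> x y"
  shows "x \<in> points n" "y \<in> points n"
  using assms unfolding partitions_def linked_def partition_on_def by auto

lemma linked_refl: "\<alpha> \<in> partitions n \<Longrightarrow> linked \<alpha> x x \<longleftrightarrow> x \<in> points n"
  unfolding partitions_def linked_def partition_on_def by auto

lemma linked_block:
  assumes "\<alpha> \<in> partitions n" "A \<in> \<alpha>" "x \<in> A"
  shows "A = {y. linked \<alpha> x y}"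
  using assms unfolding partitions_def linked_def partition_on_def disjoint_def by auto

lemma linked_trans:
  assumes "\<alpha> \<in> partitions n" "linked \<alpha> x y" "linked \<alpha> y z"
  shows "linked \<alpha> x z"
proof -
  obtain A where "A \<in> \<alpha>" "x \<in> A" "y \<in> A" using assms(2) unfolding linked_def by blast
  moreover have "z \<in> A" using linked_block[OF assms(1) \<open>A \<in> \<alpha>\<close> \<open>y \<in> A\<close>] assms(3) by blast
  ultimately show ?thesis unfolding linked_def by blast
qed

lemma mem_partition_iff:
  assumes "\<alpha> \<in> partitions n"
  shows "A \<in> \<alpha> \<longleftrightarrow> (\<exists>x\<in>points n. A = {y. linked \<alpha> x y})"
proof
  assume "A \<in> \<alpha>"
  moreover obtain x where "x \<in> A"
    using \<open>A \<in> \<alpha>\<close> assms unfolding partitions_def partition_on_def by fastforce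
  ultimately show "\<exists>x\<in>points n. A = {y. linked \<alpha> x y}"
    using linked_block[OF assms] assms unfolding partitions_def partition_on_def by blast
next
  assume "\<exists>x\<in>points n. A = {y. linked \<alpha> x y}"
  then obtain x where x: "x \<in> points n" "A = {y. linked \<alpha> x y}" by blast
  then obtain B where "B \<in> \<alpha>" "x \<in> B" using linked_refl[OF assms] unfolding linked_def by blast
  then show "A \<in> \<alpha>" using x linked_block[OF assms] by auto
qed

lemma partition_eqI:
  assumes "\<alpha> \<in> partitions n" "\<beta> \<in> partitions n" "\<And>x y. linked \<alpha> x y \<longleftrightarrow> linked \<beta> x y"
  shows "\<alpha> = \<beta>"
  using mem_partition_iff[OF assms(1)] mem_partition_iff[OF assms(2)] assms(3) by auto

lemma common_class_iff:
  assumes "equiv A r"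
  shows "(\<exists>B\<in>A // r. x \<in> B \<and> y \<in> B) \<longleftrightarrow> (x, y) \<in> r"
proof
  show "(x, y) \<in> r" if "\<exists>B\<in>A // r. x \<in> B \<and> y \<in> B"
    using that in_quotient_imp_in_rel[OF assms] by blast
next
  assume r: "(x, y) \<in> r"
  then have "x \<in> A" using equiv_type[OF assms] by blast
  then show "\<exists>B\<in>A // r. x \<in> B \<and> y \<in> B"
    using r equiv_class_self[OF assms, of x] quotientI[of x A r] by blast
qed

lemma
  assumes "equiv (points n) {(x, y) \<in> points n \<times> points n. R x y}"
  shows partition_of_partitions: "partition_of n R \<in> partitions n"
    and linked_partition_of: "linked (partition_of n R) x y \<longleftrightarrow> x \<in> points n \<and> y \<in> points n \<and> R x y"
  using partition_on_quotient[OF assms] common_class_iff[OF assms]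
  by (auto simp: partitions_def partition_of_def linked_def)

subsection \<open>Products of partitions\<close>

abbreviation joined :: "point set set \<Rightarrow> point set set \<Rightarrow> point + nat \<Rightarrow> point + nat \<Rightarrow> bool" where
  "joined \<alpha> \<beta> u v \<equiv> (u, v) \<in> (product_graph \<alpha> \<beta>)\<^sup>*"

lemma product_graph_iff:
  "(u, v) \<in> product_graph \<alpha> \<beta> \<longleftrightarrow>
     (\<exists>x y. linked \<alpha> x y \<and> u = lower_to_middle x \<and> v = lower_to_middle y) \<or>
     (\<exists>x y. linked \<beta> x y \<and> u = upper_to_middle x \<and> v = upper_to_middle y)"
  by (simp add: product_graph_def linked_def bex_Un image_iff Bex_def) blast

lemma joined_sym: "joined \<alpha> \<beta> u v \<Longrightarrow> joined \<alpha> \<beta> v u"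
proof -
  have "sym (product_graph \<alpha> \<beta>)"
    unfolding sym_def product_graph_def by blast
  then show "joined \<alpha> \<beta> u v \<Longrightarrow> joined \<alpha> \<beta> v u"
    by (meson sym_def sym_rtrancl)
qed

lemma joined_leftI: "linked \<alpha> x y \<Longrightarrow> joined \<alpha> \<beta> (lower_to_middle x) (lower_to_middle y)"
  and joined_rightI: "linked \<beta> x y \<Longrightarrow> joined \<alpha> \<beta> (upper_to_middle x) (upper_to_middle y)"
  by (rule r_into_rtrancl, unfold product_graph_iff, blast)+

lemma pprod_eq: "pprod n \<alpha> \<beta> = partition_of n (\<lambda>x y. joined \<alpha> \<beta> (Inl x) (Inl y))"
  by (simp add: pprod_def partition_of_def)

lemma equiv_joined: "equiv (points n) {(x, y) \<in> points n \<times> points n. joined \<alpha> \<beta> (Inl x) (Inl y)}"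
  by (intro equivI refl_onI symI transI) (auto intro: joined_sym rtrancl_trans)

lemma pprod_partitions [simp]: "pprod n \<alpha> \<beta> \<in> partitions n"
  and linked_pprod:
    "linked (pprod n \<alpha> \<beta>) x y \<longleftrightarrow> x \<in> points n \<and> y \<in> points n \<and> joined \<alpha> \<beta> (Inl x) (Inl y)"
  unfolding pprod_eq
  using partition_of_partitions[OF equiv_joined] linked_partition_of[OF equiv_joined] by auto

text \<open>A labelling of the three rows that is constant on the blocks of both factors is constant on
  the blocks of the product; this replaces inductions over paths in the product graph.\<close>

lemma joined_label:
  fixes l :: "point + nat \<Rightarrow> 'b"
  assumes "joined \<alpha> \<beta> u v"
    and "\<And>x y. linked \<alpha> x y \<Longrightarrow> l (lower_to_middle x) = l (lower_to_middle y)"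
    and "\<And>x y. linked \<beta> x y \<Longrightarrow> l (upper_to_middle x) = l (upper_to_middle y)"
  shows "l u = l v"
  using assms(1)
proof induction
  case (step v w)
  then have "l v = l w"
    unfolding product_graph_iff using assms(2,3) by blast
  then show ?case using step.IH by simp
qed simp

lemma linked_pprod_label:
  fixes l :: "point + nat \<Rightarrow> 'b"
  assumes "linked (pprod n \<alpha> \<beta>) x y"
    and "\<And>x y. linked \<alpha> x y \<Longrightarrow> l (lower_to_middle x) = l (lower_to_middle y)"
    and "\<And>x y. linked \<beta> x y \<Longrightarrow> l (upper_to_middle x) = l (upper_to_middle y)"
  shows "l (Inl x) = l (Inl y)"
  by (rule joined_label[where l = l, OF _ assms(2,3)]) (use assms(1) in \<open>simp_all add: linked_pprod\<close>)

text \<open>The labels used for the involution and for associativity are components of a product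
  graph; this lemma and \<open>joined_classD\<close> translate between equal components and joined
  nodes.\<close>

lemma joined_cong: "joined \<alpha> \<beta> u v \<Longrightarrow> {w. joined \<alpha> \<beta> u w} = {w. joined \<alpha> \<beta> v w}"
  by (intro Collect_cong) (meson joined_sym rtrancl_trans)

lemma joined_classD: "{w. joined \<alpha> \<beta> u w} = {w. joined \<alpha> \<beta> v w} \<Longrightarrow> joined \<alpha> \<beta> u v"
  by auto

section \<open>The involution\<close>

lemma flip_flip [simp]: "flip (flip x) = x"
  by (cases x) auto

lemma flip_in_points [simp]: "flip x \<in> points n \<longleftrightarrow> x \<in> points n"
  by (cases x) auto

lemma mem_flip_image [simp]: "x \<in> flip ` A \<longleftrightarrow> flip x \<in> A"
proof
  show "x \<in> flip ` A" if "flip x \<in> A"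
    using imageI[OF that, of flip] by simp
qed auto

lemma flip_image [simp]: "flip ` points n = points n"
  by (auto simp: set_eq_iff)

lemma inj_flip: "inj flip"
  by (rule inj_on_inverseI[of _ flip]) simp

lemma pstar_pstar [simp]: "pstar (pstar \<alpha>) = \<alpha>"
  unfolding pstar_def by (simp add: image_image)

lemma linked_pstar: "linked (pstar \<alpha>) x y \<longleftrightarrow> linked \<alpha> (flip x) (flip y)"
  unfolding linked_def pstar_def by simp

lemma pstar_partitions [simp]: "pstar \<alpha> \<in> partitions n \<longleftrightarrow> \<alpha> \<in> partitions n"
proof -
  have "pstar \<alpha> \<in> partitions n" if "\<alpha> \<in> partitions n" for \<alpha>
  proof -
    have "partition_on (points n) ((`) flip ` \<alpha> - {{}})"
      using partition_on_inj_image[of "points n" \<alpha> flip] that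
      by (simp add: partitions_def inj_on_subset[OF inj_flip])
    moreover have "{} \<notin> (`) flip ` \<alpha>"
      using that by (auto simp: partitions_def partition_on_def)
    ultimately show ?thesis by (simp add: partitions_def pstar_def)
  qed
  then show ?thesis using pstar_pstar by metis
qed

text \<open>Reflecting the product graph of the two flipped factors in its middle row gives the
  product graph of \<alpha> and \<beta>. The label \<open>l\<close> of a node is the component of
  its reflection.\<close>

lemma linked_pprod_pstar:
  assumes "linked (pprod n (pstar \<beta>) (pstar \<alpha>)) x y"
  shows "linked (pprod n \<alpha> \<beta>) (flip x) (flip y)"
proof -
  define l where "l = (\<lambda>u. {w. joined \<alpha> \<beta> (case u of Inl p \<Rightarrow> Inl (flip p) | Inr i \<Rightarrow> Inr i) w})"
  have flip_middle:
    "(case lower_to_middle p of Inl p \<Rightarrow> Inl (flip p) | Inr i \<Rightarrow> Inr i) = upper_to_middle (flip p)"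
    "(case upper_to_middle p of Inl p \<Rightarrow> Inl (flip p) | Inr i \<Rightarrow> Inr i) = lower_to_middle (flip p)" for p
    by (cases p; simp)+
  have "l (Inl x) = l (Inl y)"
  proof (rule linked_pprod_label[OF assms])
    show "l (lower_to_middle x) = l (lower_to_middle y)" if "linked (pstar \<beta>) x y" for x y
      unfolding l_def flip_middle using that by (intro joined_cong joined_rightI) (simp add: linked_pstar)
    show "l (upper_to_middle x) = l (upper_to_middle y)" if "linked (pstar \<alpha>) x y" for x y
      unfolding l_def flip_middle using that by (intro joined_cong joined_leftI) (simp add: linked_pstar)
  qed
  then show ?thesis using assms by (auto simp: l_def linked_pprod dest: joined_classD)
qed

lemma pstar_pprod: "pstar (pprod n \<alpha> \<beta>) = pprod n (pstar \<beta>) (pstar \<alpha>)"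
proof (rule partition_eqI[of _ n])
  show "linked (pstar (pprod n \<alpha> \<beta>)) x y \<longleftrightarrow> linked (pprod n (pstar \<beta>) (pstar \<alpha>)) x y" for x y
    using linked_pprod_pstar[of n \<beta> \<alpha> x y] linked_pprod_pstar[of n "pstar \<alpha>" "pstar \<beta>" "flip x" "flip y"]
    by (auto simp: linked_pstar)
qed auto

section \<open>Associativity\<close>

lemma linked_pprod_assoc:
  assumes p: "\<alpha> \<in> partitions n" "\<beta> \<in> partitions n" "\<gamma> \<in> partitions n"
    and "linked (pprod n (pprod n \<alpha> \<beta>) \<gamma>) x y"
  shows "linked (pprod n \<alpha> (pprod n \<beta> \<gamma>)) x y"
proof -
  define C where "C = (\<lambda>u. {w. joined \<alpha> (pprod n \<beta> \<gamma>) u w})"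
  \<comment> \<open>The row between \<beta> and \<gamma> is absent from the product graph of
    \<alpha> with \<beta>\<gamma>. Its node \<open>i\<close> therefore borrows the component of any
    outer point of \<beta>\<gamma> joined to it; by \<open>CD\<close> all of these agree. If there
    is none, the value is the empty set.\<close>
  define D where "D = (\<lambda>i. \<Union>(C ` upper_to_middle ` {q \<in> points n. joined \<beta> \<gamma> (Inl q) (Inr i)}))"
  define E where "E = (\<lambda>v. case v of Inl q \<Rightarrow> C (upper_to_middle q) | Inr i \<Rightarrow> D i)"
  have CC: "C (upper_to_middle q) = C (upper_to_middle q')"
    if "q \<in> points n" "q' \<in> points n" "joined \<beta> \<gamma> (Inl q) (Inl q')" for q q'
    using that unfolding C_def by (intro joined_cong joined_rightI) (simp add: linked_pprod)
  have CD: "C (upper_to_middle q) = D i" if "q \<in> points n" "joined \<beta> \<gamma> (Inl q) (Inr i)" for q i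
  proof -
    have "C (upper_to_middle q') = C (upper_to_middle q)"
      if "q' \<in> points n" "joined \<beta> \<gamma> (Inl q') (Inr i)" for q'
      using CC[of q' q] that \<open>q \<in> points n\<close> \<open>joined \<beta> \<gamma> (Inl q) (Inr i)\<close>
      by (meson joined_sym rtrancl_trans)
    then show ?thesis unfolding D_def using that by blast
  qed
  have DD: "D i = D j" if "joined \<beta> \<gamma> (Inr i) (Inr j)" for i j
  proof -
    have "joined \<beta> \<gamma> (Inl q) (Inr i) \<longleftrightarrow> joined \<beta> \<gamma> (Inl q) (Inr j)" for q
      using that by (meson joined_sym rtrancl_trans)
    then show ?thesis by (simp add: D_def)
  qed
  have E: "E u = E v" if "joined \<beta> \<gamma> u v" "u \<in> Inl ` points n \<union> range Inr" "v \<in> Inl ` points n \<union> range Inr" for u v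
  proof (cases u)
    case u: (Inl q)
    show ?thesis
    proof (cases v)
      case v: (Inl q')
      show ?thesis using CC[of q q'] that by (auto simp: E_def u v)
    next
      case v: (Inr i)
      show ?thesis using CD[of q i] that by (auto simp: E_def u v)
    qed
  next
    case u: (Inr i)
    show ?thesis
    proof (cases v)
      case v: (Inl q)
      show ?thesis using CD[of q i] joined_sym[OF that(1)] that by (auto simp: E_def u v)
    next
      case v: (Inr j)
      show ?thesis using DD[of i j] that by (auto simp: E_def u v)
    qed
  qed
  have m: "lower_to_middle z \<in> Inl ` points n \<union> range Inr"
    "upper_to_middle z \<in> Inl ` points n \<union> range Inr" if "z \<in> points n" for z
    using that by (cases z; auto)+
  \<comment> \<open>\<open>l1\<close> labels the three rows of the product \<alpha>\<beta>, and
    \<open>l2\<close> those of the product with \<gamma>. They agree on the top row, and the bottom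
    row of \<open>l1\<close> is the middle row of \<open>l2\<close>, so what is proved for
    \<open>l1\<close> feeds the labelling argument for \<open>l2\<close>.\<close>
  define l1 where "l1 = (\<lambda>u. case u of Inl (Upper i) \<Rightarrow> C (Inl (Upper i)) | Inr i \<Rightarrow> C (Inr i) | Inl (Lower i) \<Rightarrow> D i)"
  define l2 where "l2 = (\<lambda>u. case u of Inl (Upper i) \<Rightarrow> C (Inl (Upper i)) | Inr i \<Rightarrow> D i | Inl (Lower i) \<Rightarrow> C (Inl (Lower i)))"
  have eqC: "C (lower_to_middle x) = C (lower_to_middle y)" if "linked \<alpha> x y" for x y
    using that unfolding C_def by (intro joined_cong joined_leftI)
  have beta: "l1 (upper_to_middle x) = l1 (upper_to_middle y)" if "linked \<beta> x y" for x y
  proof -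
    have "l1 (upper_to_middle z) = E (lower_to_middle z)" for z
      by (cases z) (auto simp: l1_def E_def)
    moreover have "E (lower_to_middle x) = E (lower_to_middle y)"
      using E[OF joined_leftI[OF that]] m linked_in_points[OF p(2) that] by blast
    ultimately show ?thesis by simp
  qed
  have l1: "l1 (Inl x) = l1 (Inl y)" if "linked (pprod n \<alpha> \<beta>) x y" for x y
  proof (rule linked_pprod_label[OF that])
    show "l1 (lower_to_middle x) = l1 (lower_to_middle y)" if "linked \<alpha> x y" for x y
      using eqC[OF that] by (cases x; cases y) (auto simp: l1_def)
  qed (fact beta)
  have "l2 (Inl x) = l2 (Inl y)"
  proof (rule linked_pprod_label[OF assms(4)])
    show "l2 (lower_to_middle x) = l2 (lower_to_middle y)" if "linked (pprod n \<alpha> \<beta>) x y" for x y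
      using l1[OF that] by (cases x; cases y) (auto simp: l1_def l2_def)
    show "l2 (upper_to_middle x) = l2 (upper_to_middle y)" if "linked \<gamma> x y" for x y
    proof -
      have "l2 (upper_to_middle z) = E (upper_to_middle z)" for z
        by (cases z) (auto simp: l2_def E_def)
      moreover have "E (upper_to_middle x) = E (upper_to_middle y)"
        using E[OF joined_rightI[OF that]] m linked_in_points[OF p(3) that] by blast
      ultimately show ?thesis by simp
    qed
  qed
  moreover have "l2 (Inl z) = C (Inl z)" for z
    by (cases z) (auto simp: l2_def)
  ultimately show ?thesis
    using assms(4) by (auto simp: linked_pprod C_def dest: joined_classD)
qed

text \<open>Only one direction needs labellings; the other is its mirror image, as
  \<open>pstar\<close> reverses products.\<close>

lemma pprod_assoc:
  assumes "\<alpha> \<in> partitions n" "\<beta> \<in> partitions n" "\<gamma> \<in> partitions n"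
  shows "pprod n (pprod n \<alpha> \<beta>) \<gamma> = pprod n \<alpha> (pprod n \<beta> \<gamma>)"
proof (rule partition_eqI[of _ n])
  fix x y
  have "linked (pprod n \<alpha> (pprod n \<beta> \<gamma>)) x y \<Longrightarrow> linked (pprod n (pprod n \<alpha> \<beta>) \<gamma>) x y"
    using linked_pprod_assoc[of "pstar \<gamma>" n "pstar \<beta>" "pstar \<alpha>" "flip x" "flip y"] assms
    by (simp add: pstar_pprod[symmetric] linked_pstar)
  then show "linked (pprod n (pprod n \<alpha> \<beta>) \<gamma>) x y \<longleftrightarrow> linked (pprod n \<alpha> (pprod n \<beta> \<gamma>)) x y"
    using linked_pprod_assoc[OF assms] by blast
qed auto

subsection \<open>Noncrossing partitions\<close>

text \<open>The points in clockwise order along the boundary of the rectangle, starting at 1.\<close>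

fun pless :: "point \<Rightarrow> point \<Rightarrow> bool" where
  "pless (Upper i) (Upper j) \<longleftrightarrow> i < j"
| "pless (Upper i) (Lower j) \<longleftrightarrow> True"
| "pless (Lower i) (Upper j) \<longleftrightarrow> False"
| "pless (Lower i) (Lower j) \<longleftrightarrow> j < i"

text \<open>In a partition, linking \<open>a\<close> to \<open>b\<close> already puts all four
  points into one block.\<close>

definition noncrossing :: "point set set \<Rightarrow> bool" where
  "noncrossing \<alpha> \<longleftrightarrow> (\<forall>a b c d. pless a b \<longrightarrow> pless b c \<longrightarrow> pless c d \<longrightarrow>
     linked \<alpha> a c \<longrightarrow> linked \<alpha> b d \<longrightarrow> linked \<alpha> a b)"

definition small_blocks :: "point set set \<Rightarrow> bool" where
  "small_blocks \<alpha> \<longleftrightarrow> (\<forall>x y z. linked \<alpha> x y \<longrightarrow> linked \<alpha> x z \<longrightarrow> x = y \<or> x = z \<or> y = z)"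

lemma noncrossingD:
  assumes "noncrossing \<alpha>" "linked \<alpha> a c" "linked \<alpha> b d" "pless a b" "pless b c" "pless c d"
  shows "linked \<alpha> a b"
  using assms unfolding noncrossing_def by blast

lemma small_blocksD: "small_blocks \<alpha> \<Longrightarrow> linked \<alpha> x y \<Longrightarrow> linked \<alpha> x z \<Longrightarrow> x = y \<or> x = z \<or> y = z"
  unfolding small_blocks_def by blast

lemma pless_flip [simp]: "pless (flip x) (flip y) \<longleftrightarrow> pless y x"
  by (cases x; cases y) auto

text \<open>The flip reverses the clockwise order, so the quadruple is read backwards, from
  \<open>d\<close> to \<open>a\<close>.\<close>

lemma noncrossing_pstar:
  assumes "\<alpha> \<in> partitions n" "noncrossing \<alpha>"
  shows "noncrossing (pstar \<alpha>)"
  unfolding noncrossing_def linked_pstar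
proof (intro allI impI)
  fix a b c d
  assume o: "pless a b" "pless b c" "pless c d"
    and l: "linked \<alpha> (flip a) (flip c)" "linked \<alpha> (flip b) (flip d)"
  have "linked \<alpha> (flip d) (flip c)"
    by (rule noncrossingD[OF assms(2), where c = "flip b" and d = "flip a"])
       (use o l linked_sym[of \<alpha>] in auto)
  then show "linked \<alpha> (flip a) (flip b)"
    using l linked_sym[of \<alpha>] linked_trans[OF assms(1)] by blast
qed

lemma small_blocks_pstar: "small_blocks \<alpha> \<Longrightarrow> small_blocks (pstar \<alpha>)"
  unfolding small_blocks_def linked_pstar using inj_flip[THEN injD] by blast

text \<open>The product is computed by writing the points of both factors on a line, with the two copies
  of the middle point \<open>i''\<close> at \<open>-i\<close> and \<open>i\<close>, and then, for \<open>i = 1, 2, \<dots>\<close>, merging the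
  blocks of \<open>-i\<close> and \<open>i\<close> and dropping these two points. At each step the two points are adjacent
  among the remaining ones, so no crossing arises.\<close>

definition merge :: "('a \<Rightarrow> 'a \<Rightarrow> bool) \<Rightarrow> 'a \<Rightarrow> 'a \<Rightarrow> 'a \<Rightarrow> 'a \<Rightarrow> bool" where
  "merge E p q x y \<longleftrightarrow> E x y \<or> E x p \<and> E q y \<or> E x q \<and> E p y"

definition nc_on :: "'a::linorder set \<Rightarrow> ('a \<Rightarrow> 'a \<Rightarrow> bool) \<Rightarrow> bool" where
  "nc_on V E \<longleftrightarrow> (\<forall>a\<in>V. \<forall>b\<in>V. \<forall>c\<in>V. \<forall>d\<in>V. a < b \<longrightarrow> b < c \<longrightarrow> c < d \<longrightarrow> E a c \<longrightarrow> E b d \<longrightarrow> E a b)"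

definition small_on :: "'a set \<Rightarrow> ('a \<Rightarrow> 'a \<Rightarrow> bool) \<Rightarrow> bool" where
  "small_on V E \<longleftrightarrow> (\<forall>x\<in>V. \<forall>y\<in>V. \<forall>z\<in>V. E x y \<longrightarrow> E x z \<longrightarrow> x = y \<or> x = z \<or> y = z)"

lemma nc_onD:
  assumes "nc_on V E" "E a c" "E b d" "a < b" "b < c" "c < d" "a \<in> V" "b \<in> V" "c \<in> V" "d \<in> V"
  shows "E a b"
  using assms unfolding nc_on_def by blast

lemma nc_on_subset: "nc_on V E \<Longrightarrow> W \<subseteq> V \<Longrightarrow> nc_on W E"
  unfolding nc_on_def by (meson subsetD)

lemma small_on_subset: "small_on V E \<Longrightarrow> W \<subseteq> V \<Longrightarrow> small_on W E"
  unfolding small_on_def by (meson subsetD)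

lemma symp_merge: "symp E \<Longrightarrow> symp (merge E p q)"
  unfolding symp_def merge_def by blast

lemma transp_merge:
  assumes "symp E" "transp E"
  shows "transp (merge E p q)"
proof (rule transpI)
  fix x y z assume "merge E p q x y" "merge E p q y z"
  moreover have s: "E u v \<Longrightarrow> E v u" for u v using assms(1) by (auto dest: sympD)
  moreover have t: "E u v \<Longrightarrow> E v w \<Longrightarrow> E u w" for u v w using assms(2) by (auto dest: transpD)
  ultimately show "merge E p q x z" unfolding merge_def by meson
qed

text \<open>The noncrossing condition for a chord that leaves the interval from \<open>s\<close> to
  \<open>t\<close> on either side; when it leaves to the left, \<open>y\<close> is the first of the
  four points and its class takes in \<open>s\<close>.\<close>

lemma nc_on_cross:
  fixes E :: "'a::linorder \<Rightarrow> 'a \<Rightarrow> bool"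
  assumes "symp E" "transp E" "nc_on V E"
    and "s \<in> V" "t \<in> V" "x \<in> V" "y \<in> V" "E s t" "E x y" "s < x" "x < t" "y < s \<or> t < y"
  shows "E s x"
proof -
  have s: "E u v \<Longrightarrow> E v u" for u v using assms(1) by (auto dest: sympD)
  have t: "E u v \<Longrightarrow> E v w \<Longrightarrow> E u w" for u v w using assms(2) by (auto dest: transpD)
  from assms(12) show ?thesis
  proof
    assume "t < y"
    then show ?thesis using assms unfolding nc_on_def by blast
  next
    assume "y < s"
    moreover have "E y x" using s assms(9) .
    ultimately have "E y s" using assms unfolding nc_on_def by blast
    then show ?thesis using s t \<open>E y x\<close> by blast
  qed
qed

text \<open>A new connection runs from \<open>u\<close> to \<open>p\<close>, jumps to
  \<open>q\<close>, and continues to \<open>v\<close> on the other side of the chord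
  \<open>s t\<close>. No element of \<open>V\<close> lies strictly between \<open>p\<close> and
  \<open>q\<close>, so the jump itself cannot pass an end of the chord. Hence one of the old links
  \<open>u p\<close> and \<open>q v\<close> crosses it, unless \<open>p\<close> or \<open>q\<close>
  is itself an end of the chord.\<close>

lemma nc_on_merge_chord:
  fixes E :: "'a::linorder \<Rightarrow> 'a \<Rightarrow> bool"
  assumes E: "symp E" "transp E" "nc_on V E"
    and V: "s \<in> V" "t \<in> V" "u \<in> V" "v \<in> V" "p \<in> V" "q \<in> V"
    and adj: "\<And>w. w \<in> V \<Longrightarrow> \<not> (p < w \<and> w < q) \<and> \<not> (q < w \<and> w < p)"
    and l: "E s t" "E u p" "E q v"
    and o: "s < u" "u < t" "v < s \<or> t < v"
  shows "merge E p q s u"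
proof -
  have s: "E u v \<Longrightarrow> E v u" for u v using E(1) by (auto dest: sympD)
  have t: "E u v \<Longrightarrow> E v w \<Longrightarrow> E u w" for u v w using E(2) by (auto dest: transpD)
  have "E s s" using s t l by blast
  consider "p = s \<or> p = t" | "q = s \<or> q = t" | "s < p" "p < t" "s < q" "q < t" | "p < s \<or> t < p"
    using adj[OF V(1)] adj[OF V(2)] by (metis linorder_neqE)
  then show ?thesis
  proof cases
    case 1
    then show ?thesis using l s t \<open>E s s\<close> unfolding merge_def by blast
  next
    case 2
    then show ?thesis using l s t \<open>E s s\<close> unfolding merge_def by blast
  next
    case 3
    have "E s q" using nc_on_cross[OF E V(1,2) V(6) V(4) l(1) l(3)] 3 o by blast
    then show ?thesis using l s unfolding merge_def by blast
  next
    case 4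
    have "E s u" using nc_on_cross[OF E V(1,2) V(3) V(5) l(1) l(2)] 4 o by blast
    then show ?thesis unfolding merge_def by blast
  qed
qed

lemma merge_commute: "merge E p q = merge E q p"
  by (intro ext) (auto simp: merge_def)

lemma nc_on_merge:
  fixes E :: "'a::linorder \<Rightarrow> 'a \<Rightarrow> bool"
  assumes E: "symp E" "transp E" "nc_on V E"
    and V: "p \<in> V" "q \<in> V"
    and adj: "\<And>w. w \<in> V \<Longrightarrow> \<not> (p < w \<and> w < q) \<and> \<not> (q < w \<and> w < p)"
  shows "nc_on V (merge E p q)"
  unfolding nc_on_def
proof (intro ballI impI)
  fix a b c d
  assume abcd: "a \<in> V" "b \<in> V" "c \<in> V" "d \<in> V" and o: "a < b" "b < c" "c < d"
    and m: "merge E p q a c" "merge E p q b d"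
  note sM = sympD[OF symp_merge[OF E(1), of p q]] and tM = transpD[OF transp_merge[OF E(1,2), of p q]]
  have s: "E u v \<Longrightarrow> E v u" for u v using E(1) by (auto dest: sympD)
  have adj': "\<And>w. w \<in> V \<Longrightarrow> \<not> (q < w \<and> w < p) \<and> \<not> (p < w \<and> w < q)" using adj by blast
  note chord = nc_on_merge_chord[OF E _ _ _ _ V adj]
  note chord' = nc_on_merge_chord[OF E _ _ _ _ V(2) V(1) adj', unfolded merge_commute[of E q p]]
  \<comment> \<open>Each of the two links is old or runs through \<open>p\<close> and
    \<open>q\<close> in one of two directions. If exactly one is new, the chord lemma applies; if
    both are new, \<open>a\<close> and \<open>b\<close> meet at \<open>p\<close> or
    \<open>q\<close>.\<close>
  consider "E a c" "E b d" | "E a c" "E b p" "E q d" | "E a c" "E b q" "E p d"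
    | "E b d" "E a p" "E q c" | "E b d" "E a q" "E p c" | "E a p \<and> E b p" | "E a q \<and> E b q"
    | "E a p \<and> E q b" | "E a q \<and> E p b"
    using m s unfolding merge_def by blast
  then show "merge E p q a b"
  proof cases
    case 1
    then show ?thesis using E(3) abcd o unfolding nc_on_def merge_def by blast
  next
    case 2
    then show ?thesis using chord[of a c b d] abcd o by auto
  next
    case 3
    then show ?thesis using chord'[of a c b d] abcd o by auto
  next
    case 4
    \<comment> \<open>Here the new link is \<open>a c\<close>: its end \<open>c\<close> lies inside
      the old chord \<open>b d\<close> and its end \<open>a\<close> outside.\<close>
    then have "merge E p q b c" using chord'[of b d c a] abcd o s by auto
    then show ?thesis using sM tM m by blast
  next
    case 5
    then have "merge E p q b c" using chord[of b d c a] abcd o s by auto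
    then show ?thesis using sM tM m by blast
  next
    case 6
    then show ?thesis using s transpD[OF E(2)] unfolding merge_def by blast
  next
    case 7
    then show ?thesis using s transpD[OF E(2)] unfolding merge_def by blast
  qed (auto simp: merge_def)
qed

text \<open>Besides \<open>p\<close> its block contains at most one point, and likewise for
  \<open>q\<close>; once \<open>p\<close> and \<open>q\<close> are deleted, the merged block keeps
  at most two points.\<close>

lemma small_on_merge:
  assumes "symp E" "small_on V E" "p \<in> V" "q \<in> V" "p \<noteq> q"
  shows "small_on (V - {p, q}) (merge E p q)"
  unfolding small_on_def
proof (intro ballI impI)
  fix x y z
  assume V: "x \<in> V - {p, q}" "y \<in> V - {p, q}" "z \<in> V - {p, q}"
    and m: "merge E p q x y" "merge E p q x z"
  have S: "E a b \<Longrightarrow> E a c \<Longrightarrow> a \<in> V \<Longrightarrow> b \<in> V \<Longrightarrow> c \<in> V \<Longrightarrow> a = b \<or> a = c \<or> b = c" for a b c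
    using assms(2) unfolding small_on_def by blast
  show "x = y \<or> x = z \<or> y = z"
    using m V assms(3-5) S[of x y z] S[of x y p] S[of x y q] S[of x p z] S[of x q z] S[of q y z]
      S[of p y z] S[of x p q]
    unfolding merge_def by auto
qed

text \<open>Merged points remain in the relation. Dropping them is expressed by restricting to
  integers of absolute value above \<open>k\<close>, among which \<open>- (k + 1)\<close> and
  \<open>k + 1\<close> are neighbours.\<close>

fun contract :: "(int \<Rightarrow> int \<Rightarrow> bool) \<Rightarrow> nat \<Rightarrow> int \<Rightarrow> int \<Rightarrow> bool" where
  "contract E 0 = E"
| "contract E (Suc k) = merge (contract E k) (- int (Suc k)) (int (Suc k))"

lemma symp_contract: "symp E \<Longrightarrow> symp (contract E k)"
  by (induction k) (auto intro: symp_merge)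

lemma transp_contract: "symp E \<Longrightarrow> transp E \<Longrightarrow> transp (contract E k)"
  by (induction k) (auto intro: transp_merge symp_contract)

lemma contract_mono: "k \<le> m \<Longrightarrow> contract E k x y \<Longrightarrow> contract E m x y"
  by (induction rule: dec_induct) (auto simp: merge_def)

lemma nc_on_contract:
  assumes "symp E" "transp E" "nc_on UNIV E"
  shows "nc_on {x. int k < \<bar>x\<bar>} (contract E k)"
proof (induction k)
  case 0
  then show ?case using assms(3) by (simp add: nc_on_def)
next
  case (Suc k)
  have "nc_on {x. int k < \<bar>x\<bar>} (contract E (Suc k))"
    unfolding contract.simps
    by (rule nc_on_merge[OF symp_contract[OF assms(1)] transp_contract[OF assms(1,2)] Suc.IH]) auto
  then show ?case by (rule nc_on_subset) auto
qed

lemma small_on_contract: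
  assumes "symp E" "small_on UNIV E"
  shows "small_on {x. int k < \<bar>x\<bar>} (contract E k)"
proof (induction k)
  case 0
  then show ?case using assms(2) by (simp add: small_on_def)
next
  case (Suc k)
  have "small_on ({x. int k < \<bar>x\<bar>} - {- int (Suc k), int (Suc k)}) (contract E (Suc k))"
    unfolding contract.simps
    by (rule small_on_merge[OF symp_contract[OF assms(1)] Suc.IH]) auto
  then show ?case by (rule small_on_subset) auto
qed

text \<open>The left factor fills \<open>-2n, ..., -1\<close> and the right factor
  \<open>1, ..., 2n\<close>, both in clockwise order. The outer rows are exactly the positions of
  absolute value above \<open>n\<close>, and \<open>pos_outer\<close> is the restriction of both
  layouts to them.\<close>

fun pos_left :: "nat \<Rightarrow> point \<Rightarrow> int" where
  "pos_left n (Upper i) = int i - 2 * int n - 1"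
| "pos_left n (Lower i) = - int i"

fun pos_right :: "nat \<Rightarrow> point \<Rightarrow> int" where
  "pos_right n (Upper i) = int i"
| "pos_right n (Lower i) = 2 * int n + 1 - int i"

fun pos_outer :: "nat \<Rightarrow> point \<Rightarrow> int" where
  "pos_outer n (Upper i) = int i - 2 * int n - 1"
| "pos_outer n (Lower i) = 2 * int n + 1 - int i"

definition line_rel :: "nat \<Rightarrow> point set set \<Rightarrow> point set set \<Rightarrow> int \<Rightarrow> int \<Rightarrow> bool" where
  "line_rel n \<alpha> \<beta> x y \<longleftrightarrow> (\<exists>u v. linked \<alpha> u v \<and> x = pos_left n u \<and> y = pos_left n v) \<or>
     (\<exists>u v. linked \<beta> u v \<and> x = pos_right n u \<and> y = pos_right n v)"

lemma pos_less:
  assumes "u \<in> points n" "v \<in> points n"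
  shows "pos_left n u < pos_left n v \<longleftrightarrow> pless u v" "pos_right n u < pos_right n v \<longleftrightarrow> pless u v"
    "pos_outer n u < pos_outer n v \<longleftrightarrow> pless u v"
  using assms by (cases u; cases v; auto)+

lemma pos_inj:
  assumes "u \<in> points n" "v \<in> points n"
  shows "pos_left n u = pos_left n v \<longleftrightarrow> u = v" "pos_right n u = pos_right n v \<longleftrightarrow> u = v"
    "pos_outer n u = pos_outer n v \<longleftrightarrow> u = v"
  using assms by (cases u; cases v; auto)+

lemma pos_sign:
  assumes "u \<in> points n"
  shows "pos_left n u < 0" "0 < pos_right n u" "int n < \<bar>pos_outer n u\<bar>"
  using assms by (cases u; auto)+

context
  fixes n :: nat and \<alpha> \<beta> :: "point set set"
  assumes part: "\<alpha> \<in> partitions n" "\<beta> \<in> partitions n"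
begin

lemma line_rel_iff:
  "line_rel n \<alpha> \<beta> x y \<longleftrightarrow>
     (\<exists>u\<in>points n. \<exists>v\<in>points n. linked \<alpha> u v \<and> x = pos_left n u \<and> y = pos_left n v) \<or>
     (\<exists>u\<in>points n. \<exists>v\<in>points n. linked \<beta> u v \<and> x = pos_right n u \<and> y = pos_right n v)"
  unfolding line_rel_def using linked_in_points[OF part(1)] linked_in_points[OF part(2)] by blast

lemma line_rel_neg: "line_rel n \<alpha> \<beta> x y \<Longrightarrow> x < 0 \<Longrightarrow>
    \<exists>u\<in>points n. \<exists>v\<in>points n. linked \<alpha> u v \<and> x = pos_left n u \<and> y = pos_left n v"
  unfolding line_rel_iff using pos_sign(2) by (metis not_less_iff_gr_or_eq)

lemma line_rel_pos: "line_rel n \<alpha> \<beta> x y \<Longrightarrow> 0 < x \<Longrightarrow>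
    \<exists>u\<in>points n. \<exists>v\<in>points n. linked \<beta> u v \<and> x = pos_right n u \<and> y = pos_right n v"
  unfolding line_rel_iff using pos_sign(1) by (metis not_less_iff_gr_or_eq)

lemma line_rel_left: "u \<in> points n \<Longrightarrow> v \<in> points n \<Longrightarrow>
    line_rel n \<alpha> \<beta> (pos_left n u) (pos_left n v) \<longleftrightarrow> linked \<alpha> u v"
  using line_rel_neg[of "pos_left n u" "pos_left n v"] pos_sign(1)[of u n] pos_inj(1)
  by (auto simp: line_rel_def)

lemma line_rel_right: "u \<in> points n \<Longrightarrow> v \<in> points n \<Longrightarrow>
    line_rel n \<alpha> \<beta> (pos_right n u) (pos_right n v) \<longleftrightarrow> linked \<beta> u v"
  using line_rel_pos[of "pos_right n u" "pos_right n v"] pos_sign(2)[of u n] pos_inj(2)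
  by (auto simp: line_rel_def)

lemma symp_line_rel: "symp (line_rel n \<alpha> \<beta>)"
  unfolding symp_def line_rel_def using linked_sym by blast

lemma line_rel_cases:
  assumes "line_rel n \<alpha> \<beta> x y"
  obtains (left) u v where "u \<in> points n" "v \<in> points n" "x = pos_left n u" "y = pos_left n v" "linked \<alpha> u v"
  | (right) u v where "u \<in> points n" "v \<in> points n" "x = pos_right n u" "y = pos_right n v" "linked \<beta> u v"
  using assms unfolding line_rel_iff by blast

lemma transp_line_rel: "transp (line_rel n \<alpha> \<beta>)"
proof (rule transpI)
  fix x y z assume xy: "line_rel n \<alpha> \<beta> x y" and yz: "line_rel n \<alpha> \<beta> y z"
  from xy show "line_rel n \<alpha> \<beta> x z"
  proof (cases rule: line_rel_cases)
    case (left u v)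
    then obtain v' w where "v' \<in> points n" "w \<in> points n" "linked \<alpha> v' w" "y = pos_left n v'" "z = pos_left n w"
      using line_rel_neg[OF yz] pos_sign(1) by blast
    then show ?thesis
      using left pos_inj(1) line_rel_left linked_trans[OF part(1)] by metis
  next
    case (right u v)
    then obtain v' w where "v' \<in> points n" "w \<in> points n" "linked \<beta> v' w" "y = pos_right n v'" "z = pos_right n w"
      using line_rel_pos[OF yz] pos_sign(2) by blast
    then show ?thesis
      using right pos_inj(2) line_rel_right linked_trans[OF part(2)] by metis
  qed
qed

lemma nc_on_line_rel:
  assumes "noncrossing \<alpha>" "noncrossing \<beta>"
  shows "nc_on UNIV (line_rel n \<alpha> \<beta>)"
  unfolding nc_on_def
proof (intro ballI impI)
  fix a b c d :: int
  assume o: "a < b" "b < c" "c < d" and ac: "line_rel n \<alpha> \<beta> a c" and bd: "line_rel n \<alpha> \<beta> b d"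
  from ac show "line_rel n \<alpha> \<beta> a b"
  proof (cases rule: line_rel_cases)
    case (left u v)
    then have "b < 0" using o pos_sign(1)[of v n] by linarith
    then obtain u' v' where "u' \<in> points n" "v' \<in> points n" "linked \<alpha> u' v'" "b = pos_left n u'" "d = pos_left n v'"
      using line_rel_neg[OF bd] by blast
    then show ?thesis
      using left o assms(1) pos_less(1) unfolding noncrossing_def by (simp add: line_rel_left; blast)
  next
    case (right u v)
    then have "0 < b" using o pos_sign(2)[of u n] by linarith
    then obtain u' v' where "u' \<in> points n" "v' \<in> points n" "linked \<beta> u' v'" "b = pos_right n u'" "d = pos_right n v'"
      using line_rel_pos[OF bd] by blast
    then show ?thesis
      using right o assms(2) pos_less(2) unfolding noncrossing_def by (simp add: line_rel_right; blast)
  qed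
qed

lemma small_on_line_rel:
  assumes "small_blocks \<alpha>" "small_blocks \<beta>"
  shows "small_on UNIV (line_rel n \<alpha> \<beta>)"
  unfolding small_on_def
proof (intro ballI impI)
  fix x y z :: int
  assume xy: "line_rel n \<alpha> \<beta> x y" and xz: "line_rel n \<alpha> \<beta> x z"
  from xy show "x = y \<or> x = z \<or> y = z"
  proof (cases rule: line_rel_cases)
    case (left u v)
    then obtain u' w where "u' \<in> points n" "w \<in> points n" "linked \<alpha> u' w" "x = pos_left n u'" "z = pos_left n w"
      using line_rel_neg[OF xz] pos_sign(1) by blast
    then show ?thesis
      using left assms(1) pos_inj(1) unfolding small_blocks_def by metis
  next
    case (right u v)
    then obtain u' w where "u' \<in> points n" "w \<in> points n" "linked \<beta> u' w" "x = pos_right n u'" "z = pos_right n w"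
      using line_rel_pos[OF xz] pos_sign(2) by blast
    then show ?thesis
      using right assms(2) pos_inj(2) unfolding small_blocks_def by metis
  qed
qed

text \<open>\<open>node\<close> sends a position back to its vertex of the product graph. For
  \<open>i\<close> up to \<open>n\<close>, both \<open>-i\<close> and \<open>i\<close> go to the
  middle point \<open>i\<close>, so merging the two creates no connection that the graph
  lacks.\<close>

lemma contract_imp_joined:
  defines "node \<equiv> \<lambda>x::int. if x < - int n then Inl (Upper (nat (x + 2 * int n + 1)))
    else if x \<le> int n then Inr (nat \<bar>x\<bar>) else Inl (Lower (nat (2 * int n + 1 - x)))"
  assumes "k \<le> n" "contract (line_rel n \<alpha> \<beta>) k x y"
  shows "joined \<alpha> \<beta> (node x) (node y)"
  using assms(2,3)
proof (induction k arbitrary: x y)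
  case 0
  have l: "node (pos_left n u) = lower_to_middle u" if "u \<in> points n" for u
    using that by (cases u) (auto simp: node_def)
  have r: "node (pos_right n u) = upper_to_middle u" if "u \<in> points n" for u
    using that by (cases u) (auto simp: node_def)
  from 0 have "line_rel n \<alpha> \<beta> x y" by simp
  then show ?case
  proof (cases rule: line_rel_cases)
    case (left u v)
    then show ?thesis using joined_leftI[of \<alpha> u v \<beta>] by (simp add: l)
  next
    case (right u v)
    then show ?thesis using joined_rightI[of \<beta> u v \<alpha>] by (simp add: r)
  qed
next
  case (Suc k)
  have "node (- int (Suc k)) = node (int (Suc k))"
    using Suc.prems(1) by (auto simp: node_def)
  then show ?case
    using Suc.prems(2) Suc.IH[of x y] Suc.IH[of x "- int (Suc k)"] Suc.IH[of "int (Suc k)" y]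
      Suc.IH[of x "int (Suc k)"] Suc.IH[of "- int (Suc k)" y] Suc.prems(1)
    unfolding contract.simps merge_def
    by (metis Suc_leD rtrancl_trans)
qed

text \<open>From left to right, a node is labelled by its class after all contractions, where the
  middle point \<open>i\<close> may be represented by \<open>-i\<close> because \<open>mid\<close>
  relates it to \<open>i\<close>.\<close>

lemma linked_pprod_contract:
  assumes "u \<in> points n" "v \<in> points n"
  shows "linked (pprod n \<alpha> \<beta>) u v \<longleftrightarrow> contract (line_rel n \<alpha> \<beta>) n (pos_outer n u) (pos_outer n v)"
proof
  let ?C = "contract (line_rel n \<alpha> \<beta>)"
  have s: "?C k x y \<Longrightarrow> ?C k y x" for k x y
    using symp_contract[OF symp_line_rel] by (auto dest: sympD)
  have t: "?C k x y \<Longrightarrow> ?C k y z \<Longrightarrow> ?C k x z" for k x y z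
    using transp_contract[OF symp_line_rel transp_line_rel] by (auto dest: transpD)
  have cong: "{w. ?C n x w} = {w. ?C n y w}" if "?C n x y" for x y
    by (intro Collect_cong) (meson s t that)
  have base: "?C n x y" if "line_rel n \<alpha> \<beta> x y" for x y
    using contract_mono[of 0 n "line_rel n \<alpha> \<beta>"] that by simp
  \<comment> \<open>Both positions are related to themselves before step \<open>i\<close>, and that
    step merges their classes.\<close>
  have mid: "?C n (- int i) (int i)" if i: "1 \<le> i" "i \<le> n" for i
  proof -
    have "linked \<alpha> (Lower i) (Lower i)" "linked \<beta> (Upper i) (Upper i)"
      using i linked_refl part by auto
    then have "line_rel n \<alpha> \<beta> (- int i) (- int i)" "line_rel n \<alpha> \<beta> (int i) (int i)"
      using line_rel_left[of "Lower i" "Lower i"] line_rel_right[of "Upper i" "Upper i"] i by auto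
    then have "?C (i - 1) (- int i) (- int i)" "?C (i - 1) (int i) (int i)"
      using contract_mono[of 0 "i - 1" "line_rel n \<alpha> \<beta>"] by auto
    moreover obtain k where "i = Suc k" using i by (cases i) auto
    ultimately have "?C i (- int i) (int i)"
      by (simp add: merge_def del: of_nat_Suc)
    then show ?thesis using i contract_mono[of i n] by simp
  qed
  define l where "l = (\<lambda>x. case x of Inl p \<Rightarrow> {w. ?C n (pos_outer n p) w} | Inr i \<Rightarrow> {w. ?C n (- int i) w})"
  assume "linked (pprod n \<alpha> \<beta>) u v"
  then have "l (Inl u) = l (Inl v)"
  proof (rule linked_pprod_label)
    fix x y assume xy: "linked \<alpha> x y"
    have "l (lower_to_middle z) = {w. ?C n (pos_left n z) w}" for z
      by (cases z) (auto simp: l_def)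
    then show "l (lower_to_middle x) = l (lower_to_middle y)"
      using cong[OF base, of "pos_left n x" "pos_left n y"] line_rel_left[of x y]
        linked_in_points[OF part(1) xy] xy by simp
  next
    fix x y assume xy: "linked \<beta> x y"
    have "l (upper_to_middle z) = {w. ?C n (pos_right n z) w}" if "z \<in> points n" for z
      using that cong[OF mid] by (cases z) (auto simp: l_def)
    then show "l (upper_to_middle x) = l (upper_to_middle y)"
      using cong[OF base, of "pos_right n x" "pos_right n y"] line_rel_right[of x y]
        linked_in_points[OF part(2) xy] xy by simp
  qed
  \<comment> \<open>Equal classes give a relation only because \<open>v\<close> lies in its own
    class.\<close>
  moreover have "linked \<alpha> v v" "linked \<beta> v v" using linked_refl part assms by auto
  then have "line_rel n \<alpha> \<beta> (pos_outer n v) (pos_outer n v)"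
    using line_rel_left[of v v] line_rel_right[of v v] assms by (cases v) auto
  then have "?C n (pos_outer n v) (pos_outer n v)" by (rule base)
  ultimately show "?C n (pos_outer n u) (pos_outer n v)" by (auto simp: l_def)
next
  assume "contract (line_rel n \<alpha> \<beta>) n (pos_outer n u) (pos_outer n v)"
  note contract_imp_joined[OF order_refl this]
  then show "linked (pprod n \<alpha> \<beta>) u v"
    using assms by (cases u; cases v) (auto simp: linked_pprod)
qed

lemma noncrossing_pprod:
  assumes "noncrossing \<alpha>" "noncrossing \<beta>"
  shows "noncrossing (pprod n \<alpha> \<beta>)"
  unfolding noncrossing_def
proof (intro allI impI)
  fix a b c d
  assume o: "pless a b" "pless b c" "pless c d"
    and l: "linked (pprod n \<alpha> \<beta>) a c" "linked (pprod n \<alpha> \<beta>) b d"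
  have p: "a \<in> points n" "b \<in> points n" "c \<in> points n" "d \<in> points n"
    using l by (auto simp: linked_pprod)
  have "nc_on {x. int n < \<bar>x\<bar>} (contract (line_rel n \<alpha> \<beta>) n)"
    by (rule nc_on_contract[OF symp_line_rel transp_line_rel nc_on_line_rel[OF assms]])
  then have "contract (line_rel n \<alpha> \<beta>) n (pos_outer n a) (pos_outer n b)"
    by (rule nc_onD[where c = "pos_outer n c" and d = "pos_outer n d"])
       (use l o p in \<open>simp_all add: linked_pprod_contract pos_less(3) pos_sign(3)\<close>)
  then show "linked (pprod n \<alpha> \<beta>) a b" using p by (simp add: linked_pprod_contract)
qed

lemma small_blocks_pprod:
  assumes "small_blocks \<alpha>" "small_blocks \<beta>"
  shows "small_blocks (pprod n \<alpha> \<beta>)"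
  unfolding small_blocks_def
proof (intro allI impI)
  fix x y z
  assume l: "linked (pprod n \<alpha> \<beta>) x y" "linked (pprod n \<alpha> \<beta>) x z"
  have p: "x \<in> points n" "y \<in> points n" "z \<in> points n"
    using l by (auto simp: linked_pprod)
  have "small_on {x. int n < \<bar>x\<bar>} (contract (line_rel n \<alpha> \<beta>) n)"
    by (rule small_on_contract[OF symp_line_rel small_on_line_rel[OF assms]])
  moreover have "pos_outer n u \<in> {x. int n < \<bar>x\<bar>}" if "u \<in> points n" for u
    using pos_sign(3)[OF that] by simp
  ultimately have "pos_outer n x = pos_outer n y \<or> pos_outer n x = pos_outer n z \<or> pos_outer n y = pos_outer n z"
    using l p unfolding small_on_def by (simp only: linked_pprod_contract; blast)
  then show "x = y \<or> x = z \<or> y = z"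
    using p pos_inj(3) by blast
qed

end

subsection \<open>Planar partitions are the noncrossing ones\<close>

text \<open>Polar coordinates \<open>(x, y) \<mapsto> (n + 1 - x) e\<^bsup>\<pi>iy\<^esup>\<close> turn the rectangle into a half annulus in
  the upper half plane, with the vertices on the real line in clockwise boundary order. There two
  crossing blocks are ruled out by the interlacing form of the Fashoda theorem, and edges can be
  drawn as semicircles.\<close>

fun bdry :: "nat \<Rightarrow> point \<Rightarrow> real" where
  "bdry n (Upper i) = real i - real n - 1"
| "bdry n (Lower i) = real n + 1 - real i"

lemma bdry_less: "u \<in> points n \<Longrightarrow> v \<in> points n \<Longrightarrow> bdry n u < bdry n v \<longleftrightarrow> pless u v"
  by (cases u; cases v) auto

lemma bdry_inj: "u \<in> points n \<Longrightarrow> v \<in> points n \<Longrightarrow> bdry n u = bdry n v \<longleftrightarrow> u = v"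
  by (cases u; cases v) auto

lemma bdry_bounds: "u \<in> points n \<Longrightarrow> 1 \<le> \<bar>bdry n u\<bar> \<and> \<bar>bdry n u\<bar> \<le> real n"
  by (cases u) auto

definition polar :: "nat \<Rightarrow> real \<times> real \<Rightarrow> real ^ 2" where
  "polar n p = vector [(real n + 1 - fst p) * cos (pi * snd p), (real n + 1 - fst p) * sin (pi * snd p)]"

lemma polar_component [simp]:
  "polar n p $ 1 = (real n + 1 - fst p) * cos (pi * snd p)"
  "polar n p $ 2 = (real n + 1 - fst p) * sin (pi * snd p)"
  by (simp_all add: polar_def)

lemma continuous_polar: "continuous_on S (polar n)"
proof -
  have "continuous_on S (\<lambda>p. polar n p $ i)" for i
  proof -
    have "continuous_on S (\<lambda>p. (real n + 1 - fst p) * cos (pi * snd p))"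
      "continuous_on S (\<lambda>p. (real n + 1 - fst p) * sin (pi * snd p))"
      by (intro continuous_intros)+
    then show ?thesis using exhaust_2[of i] by auto
  qed
  then have "continuous_on S (\<lambda>p. \<chi> i. polar n p $ i)"
    by (rule continuous_on_vec_lambda)
  then show ?thesis by simp
qed

text \<open>The modulus returns the first coordinate, and cosine is injective on the angles from 0
  to pi.\<close>

lemma inj_polar: "inj_on (polar n) ({1..real n} \<times> {0..1})"
proof (rule inj_onI)
  fix p q :: "real \<times> real"
  assume p: "p \<in> {1..real n} \<times> {0..1}" and q: "q \<in> {1..real n} \<times> {0..1}" and eq: "polar n p = polar n q"
  define r s where "r = real n + 1 - fst p" and "s = real n + 1 - fst q"
  have rs: "r > 0" "s > 0" using p q by (auto simp: r_def s_def mem_Times_iff)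
  have c: "r * cos (pi * snd p) = s * cos (pi * snd q)" "r * sin (pi * snd p) = s * sin (pi * snd q)"
    using arg_cong[OF eq, of "\<lambda>v. v $ 1"] arg_cong[OF eq, of "\<lambda>v. v $ 2"] by (simp_all add: r_def s_def)
  have "r\<^sup>2 = (r * cos (pi * snd p))\<^sup>2 + (r * sin (pi * snd p))\<^sup>2"
    by (simp add: power_mult_distrib flip: distrib_left)
  also have "\<dots> = s\<^sup>2"
    unfolding c by (simp add: power_mult_distrib flip: distrib_left)
  finally have "r = s" using rs by (simp add: power2_eq_iff)
  then have "cos (pi * snd p) = cos (pi * snd q)" using c rs by simp
  then have "pi * snd p = pi * snd q"
    by (rule cos_inj_pi[rotated 4]) (use p q in \<open>auto simp: mem_Times_iff\<close>)
  then show "p = q" using \<open>r = s\<close> by (auto simp: r_def s_def prod_eq_iff)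
qed

lemma polar_pos: "polar n (pos u) $ 1 = bdry n u" "polar n (pos u) $ 2 = 0"
  by (cases u; simp)+

section \<open>Drawings yield noncrossing partitions\<close>

lemma linked_graph_components:
  assumes "graph_on n E"
  shows "graph_components n E \<in> partitions n"
    and "linked (graph_components n E) x y \<longleftrightarrow>
      x \<in> points n \<and> y \<in> points n \<and> (x, y) \<in> {(u, v). {u, v} \<in> E}\<^sup>*"
proof -
  have "sym {(u, v). {u, v} \<in> E}" by (auto simp: sym_def insert_commute)
  then have s: "sym ({(u, v). {u, v} \<in> E}\<^sup>*)" by (rule sym_rtrancl)
  have e: "equiv (points n) {(x, y) \<in> points n \<times> points n. (x, y) \<in> {(u, v). {u, v} \<in> E}\<^sup>*}"
    by (intro equivI refl_onI symI transI) (auto dest: symD[OF s] rtrancl_trans)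
  show "graph_components n E \<in> partitions n"
    using partition_of_partitions[OF e] by (simp add: graph_components_def partition_of_def)
  show "linked (graph_components n E) x y \<longleftrightarrow>
      x \<in> points n \<and> y \<in> points n \<and> (x, y) \<in> {(u, v). {u, v} \<in> E}\<^sup>*"
    using linked_partition_of[OF e] by (simp add: graph_components_def partition_of_def)
qed

text \<open>The path stays on the drawn edges of the component of \<open>x\<close>. At least one
  edge is required: an isolated vertex lies on no edge, so even a constant path at it would leave
  this set.\<close>

lemma drawing_path_component:
  assumes "planar_drawing n E \<gamma>" "(x, y) \<in> {(u, v). {u, v} \<in> E}\<^sup>+"
  shows "path_component (\<Union>{path_image (\<gamma> e) | e. e \<in> E \<and> (\<exists>u\<in>e. (x, u) \<in> {(u, v). {u, v} \<in> E}\<^sup>*)}) (pos x) (pos y)"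
    (is "path_component ?U _ _")
proof -
  have edge: "path_component ?U (pos u) (pos v)" if "(x, u) \<in> {(u, v). {u, v} \<in> E}\<^sup>*" "{u, v} \<in> E" for u v
  proof -
    let ?g = "\<gamma> {u, v}"
    have "path ?g" and ends: "{pathstart ?g, pathfinish ?g} = {pos u, pos v}"
      using assms(1) that(2) by (auto simp: planar_drawing_def arc_def)
    moreover have "path_image ?g \<subseteq> ?U" using that by blast
    ultimately have "path_component ?U (pathstart ?g) (pathfinish ?g)"
      unfolding path_component_def by blast
    then show ?thesis
      using ends by (auto simp: doubleton_eq_iff dest: path_component_sym)
  qed
  from assms(2) show ?thesis
  proof induction
    case (base y)
    then show ?case using edge[of x y] by simp
  next
    case (step y z)
    have "path_component ?U (pos y) (pos z)"
      using step.hyps(2) by (intro edge[OF trancl_into_rtrancl[OF step.hyps(1)]]) simp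
    with step.IH show ?case by (rule path_component_trans)
  qed
qed

text \<open>If \<open>a\<close>, \<open>c\<close> and \<open>b\<close>, \<open>d\<close> belonged to
  different components, their drawn paths would become paths in the upper half plane with interlaced
  ends on the real line, and so would meet. By injectivity an edge of one component then meets an
  edge of the other inside the rectangle; in a drawing this happens only at a common vertex, which
  joins the components.\<close>

lemma planar_imp_noncrossing:
  assumes "planar_partition n \<alpha>"
  shows "noncrossing \<alpha>"
proof -
  obtain E \<gamma> where E: "graph_on n E" and D: "planar_drawing n E \<gamma>" and \<alpha>: "\<alpha> = graph_components n E"
    using assms unfolding planar_partition_def by blast
  let ?R = "{(u, v). {u, v} \<in> E}"
  let ?U = "\<lambda>x. \<Union>{path_image (\<gamma> e) | e. e \<in> E \<and> (\<exists>u\<in>e. (x, u) \<in> ?R\<^sup>*)}"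
  let ?box = "{1..real n} \<times> {0..1::real}"
  note link = linked_graph_components(2)[OF E, folded \<alpha>]
  have sym: "(u, v) \<in> ?R\<^sup>* \<Longrightarrow> (v, u) \<in> ?R\<^sup>*" for u v
    by (rule symD[OF sym_rtrancl]) (auto simp: sym_def insert_commute)
  have in_edge: "(u, v) \<in> ?R\<^sup>*" if "e \<in> E" "u \<in> e" "v \<in> e" for u v e
  proof (cases "u = v")
    case False
    have "card e = 2" using E that by (auto simp: graph_on_def)
    then have "e = {u, v}" using that False by (auto simp: card_2_iff)
    then show ?thesis using that by auto
  qed simp
  have path: "\<exists>g. path g \<and> path_image g \<subseteq> ?U x \<and> pathstart g = pos x \<and> pathfinish g = pos y"
    if "linked \<alpha> x y" "pless x y" for x y
  proof -
    have "x \<noteq> y" using that(2) by (cases x) auto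
    then have "(x, y) \<in> ?R\<^sup>+" using that(1) unfolding link by (auto dest: rtranclD)
    from drawing_path_component[OF D this] show ?thesis unfolding path_component_def by blast
  qed
  have U_box: "?U x \<subseteq> ?box" for x
    using D unfolding planar_drawing_def by blast
  have pless_trans: "pless x y \<Longrightarrow> pless y z \<Longrightarrow> pless x z" for x y z
    by (cases x; cases y; cases z) auto
  show ?thesis
    unfolding noncrossing_def
  proof (intro allI impI, rule ccontr)
    fix a b c d
    assume o: "pless a b" "pless b c" "pless c d" and ac: "linked \<alpha> a c" and bd: "linked \<alpha> b d"
      and ab: "\<not> linked \<alpha> a b"
    have pts: "a \<in> points n" "b \<in> points n" "c \<in> points n" "d \<in> points n"
      using ac bd unfolding link by auto
    obtain g where g: "path g" "path_image g \<subseteq> ?U a" "pathstart g = pos a" "pathfinish g = pos c"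
      using path[OF ac pless_trans[OF o(1,2)]] by blast
    obtain h where h: "path h" "path_image h \<subseteq> ?U b" "pathstart h = pos b" "pathfinish h = pos d"
      using path[OF bd pless_trans[OF o(2,3)]] by blast
    \<comment> \<open>The half annulus has outer radius \<open>n\<close>; this box contains it and
      has the real line as its bottom side, as the interlacing theorem requires.\<close>
    have box: "polar n p \<in> cbox (vector [- real n, 0]) (vector [real n, real n])" if "p \<in> ?box" for p
    proof -
      have r: "0 \<le> real n + 1 - fst p" "real n + 1 - fst p \<le> real n" and y: "0 \<le> snd p" "snd p \<le> 1"
        using that by (auto simp: mem_Times_iff)
      have "0 \<le> sin (pi * snd p)"
        using y by (intro sin_ge_zero) (auto simp: mult_left_le)
      moreover have "\<bar>(real n + 1 - fst p) * cos (pi * snd p)\<bar> \<le> real n * 1"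
        unfolding abs_mult using r by (intro mult_mono) auto
      moreover have "(real n + 1 - fst p) * sin (pi * snd p) \<le> real n * 1"
        using r by (intro mult_mono) (use \<open>0 \<le> sin (pi * snd p)\<close> in auto)
      ultimately show ?thesis using r by (auto simp: mem_box_cart forall_2 abs_le_iff)
    qed
    obtain z where "z \<in> path_image (polar n \<circ> g)" "z \<in> path_image (polar n \<circ> h)"
    proof (rule fashoda_interlace[of "polar n \<circ> g" "polar n \<circ> h" "vector [- real n, 0]" "vector [real n, real n]"])
      show "path (polar n \<circ> g)" "path (polar n \<circ> h)"
        using g h by (auto intro!: path_continuous_image continuous_polar)
      show "path_image (polar n \<circ> g) \<subseteq> cbox (vector [- real n, 0]) (vector [real n, real n])"
        "path_image (polar n \<circ> h) \<subseteq> cbox (vector [- real n, 0]) (vector [real n, real n])"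
        unfolding path_image_compose using g(2) h(2) U_box box by (meson image_subsetI subsetD)+
      show "pathstart (polar n \<circ> g) $ 1 < pathstart (polar n \<circ> h) $ 1"
        "pathstart (polar n \<circ> h) $ 1 < pathfinish (polar n \<circ> g) $ 1"
        "pathfinish (polar n \<circ> g) $ 1 < pathfinish (polar n \<circ> h) $ 1"
        using o pts by (simp_all only: pathstart_compose pathfinish_compose g h polar_pos bdry_less)
    qed (auto simp: pathstart_compose pathfinish_compose g h polar_pos simp del: polar_component)
    then obtain u v where "u \<in> path_image g" "v \<in> path_image h" "polar n u = polar n v"
      by (auto simp: path_image_compose)
    moreover from this have "u \<in> ?box" "v \<in> ?box"
      using g(2) h(2) U_box by (meson subsetD)+
    ultimately have "u = v" using inj_polar[of n] by (meson inj_onD)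
    have "u \<in> ?U a" using \<open>u \<in> path_image g\<close> g(2) by (rule subsetD[rotated])
    moreover have "u \<in> ?U b" using \<open>v \<in> path_image h\<close> h(2) unfolding \<open>u = v\<close> by (rule subsetD[rotated])
    ultimately obtain e e' x y where e: "e \<in> E" "x \<in> e" "(a, x) \<in> ?R\<^sup>*" "u \<in> path_image (\<gamma> e)"
      and e': "e' \<in> E" "y \<in> e'" "(b, y) \<in> ?R\<^sup>*" "u \<in> path_image (\<gamma> e')" by blast
    have "\<exists>w. w \<in> e \<and> w \<in> e'"
    proof (cases "e = e'")
      case False
      then have "u \<in> pos ` (e \<inter> e')" using D e e' unfolding planar_drawing_def by blast
      then show ?thesis by blast
    qed (use e in blast)
    then obtain w where "w \<in> e" "w \<in> e'" by blast
    then have "(x, w) \<in> ?R\<^sup>*" "(w, y) \<in> ?R\<^sup>*" using in_edge e e' by blast+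
    then have "(a, b) \<in> ?R\<^sup>*" using e(3) sym[OF e'(3)] by (meson rtrancl_trans)
    then show False using ab pts unfolding link by blast
  qed
qed

section \<open>Noncrossing partitions can be drawn: inverse polar coordinates and
  semicircles\<close>

definition unpolar :: "nat \<Rightarrow> real \<Rightarrow> real \<Rightarrow> real \<times> real" where
  "unpolar n s r = (real n + 1 - r, arccos (s / r) / pi)"

lemma unpolar_inj:
  assumes "unpolar n s r = unpolar n s' r'" "0 < r" "\<bar>s\<bar> \<le> r" "\<bar>s'\<bar> \<le> r'"
  shows "s = s'" "r = r'"
proof -
  show r: "r = r'" using assms(1) by (simp add: unpolar_def)
  have "arccos (s / r) = arccos (s' / r)" using assms(1) r by (simp add: unpolar_def)
  moreover have "\<bar>s / r\<bar> \<le> 1" "\<bar>s' / r\<bar> \<le> 1" using assms r by (auto simp: abs_le_iff field_simps)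
  ultimately have "s / r = s' / r" by (metis cos_arccos_abs)
  then show "s = s'" using assms(2) by simp
qed

lemma unpolar_bdry:
  assumes "u \<in> points n"
  shows "unpolar n (bdry n u) \<bar>bdry n u\<bar> = pos u"
proof (cases u)
  case (Upper i)
  then have "bdry n u < 0" using assms by auto
  then have "bdry n u / \<bar>bdry n u\<bar> = - 1" by (simp add: abs_if)
  then show ?thesis using Upper assms by (auto simp: unpolar_def)
next
  case (Lower i)
  then have "bdry n u > 0" using assms by auto
  then have "bdry n u / \<bar>bdry n u\<bar> = 1" by (simp add: abs_if)
  then show ?thesis using Lower assms by (auto simp: unpolar_def)
qed

text \<open>The semicircle over \<open>[p, q]\<close>, parametrised by its real part \<open>s = (1 - t) p + t q\<close>; its
  squared modulus \<open>(p + q) s - p q = (1 - t) p\<^sup>2 + t q\<^sup>2\<close> is affine in \<open>t\<close>.\<close>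

definition semicircle :: "nat \<Rightarrow> real \<Rightarrow> real \<Rightarrow> real \<Rightarrow> real \<times> real" where
  "semicircle n p q t = unpolar n ((1 - t) * p + t * q) (sqrt ((1 - t) * p\<^sup>2 + t * q\<^sup>2))"

text \<open>\<open>r\<^sup>2 - s\<^sup>2\<close> is the squared height above the real line, and the
  last equation is the altitude theorem for the semicircle over \<open>p\<close>, \<open>q\<close>.
  The bounds on \<open>r\<close> hold because \<open>r\<^sup>2\<close> is a convex combination of
  \<open>p\<^sup>2\<close> and \<open>q\<^sup>2\<close>.\<close>

lemma semicircle_modulus:
  fixes p q t :: real
  assumes "1 \<le> \<bar>p\<bar>" "\<bar>p\<bar> \<le> real n" "1 \<le> \<bar>q\<bar>" "\<bar>q\<bar> \<le> real n" "0 \<le> t" "t \<le> 1"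
  defines "r \<equiv> sqrt ((1 - t) * p\<^sup>2 + t * q\<^sup>2)" and "s \<equiv> (1 - t) * p + t * q"
  shows "1 \<le> r" "r \<le> real n" "\<bar>s\<bar> \<le> r" "r\<^sup>2 - s\<^sup>2 = (s - p) * (q - s)"
proof -
  have sq: "1 \<le> p\<^sup>2" "1 \<le> q\<^sup>2" "p\<^sup>2 \<le> (real n)\<^sup>2" "q\<^sup>2 \<le> (real n)\<^sup>2"
    using assms abs_le_square_iff[of 1 p] abs_le_square_iff[of 1 q]
      abs_le_square_iff[of p "real n"] abs_le_square_iff[of q "real n"] by auto
  have "(1 - t) * 1 + t * 1 \<le> (1 - t) * p\<^sup>2 + t * q\<^sup>2"
    using sq assms by (intro add_mono mult_left_mono) auto
  then have lo: "1 \<le> (1 - t) * p\<^sup>2 + t * q\<^sup>2" by simp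
  have "(1 - t) * p\<^sup>2 + t * q\<^sup>2 \<le> (1 - t) * (real n)\<^sup>2 + t * (real n)\<^sup>2"
    using sq assms by (intro add_mono mult_left_mono) auto
  then have hi: "(1 - t) * p\<^sup>2 + t * q\<^sup>2 \<le> (real n)\<^sup>2" by (simp add: algebra_simps)
  show "1 \<le> r" using lo by (simp add: r_def)
  show "r \<le> real n" unfolding r_def by (rule real_le_lsqrt) (use hi in auto)
  have r2: "r\<^sup>2 = (1 - t) * p\<^sup>2 + t * q\<^sup>2" using lo by (simp add: r_def)
  show *: "r\<^sup>2 - s\<^sup>2 = (s - p) * (q - s)"
    unfolding r2 s_def by (simp add: power2_eq_square algebra_simps)
  have "(s - p) * (q - s) = t * (1 - t) * (q - p)\<^sup>2"
    unfolding s_def by (simp add: power2_eq_square algebra_simps)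
  then have "0 \<le> (s - p) * (q - s)" using assms(5,6) by simp
  then have "s\<^sup>2 \<le> r\<^sup>2" using * by simp
  then show "\<bar>s\<bar> \<le> r" using \<open>1 \<le> r\<close> by (simp add: abs_le_square_iff[symmetric])
qed

lemma arc_semicircle:
  assumes "1 \<le> \<bar>p\<bar>" "\<bar>p\<bar> \<le> real n" "1 \<le> \<bar>q\<bar>" "\<bar>q\<bar> \<le> real n" "p < q"
  shows "arc (semicircle n p q)"
  unfolding arc_def
proof
  note m = semicircle_modulus[OF assms(1-4)]
  show "path (semicircle n p q)"
    unfolding path_def semicircle_def unpolar_def
  proof (intro continuous_intros ballI)
    fix t :: real assume t: "t \<in> {0..1}"
    show "sqrt ((1 - t) * p\<^sup>2 + t * q\<^sup>2) \<noteq> 0" using m(1)[of t] t by auto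
    show "- 1 \<le> ((1 - t) * p + t * q) / sqrt ((1 - t) * p\<^sup>2 + t * q\<^sup>2)
        \<and> ((1 - t) * p + t * q) / sqrt ((1 - t) * p\<^sup>2 + t * q\<^sup>2) \<le> 1"
      using m(1)[of t] m(3)[of t] t by (auto simp: abs_le_iff field_simps)
  qed simp
  show "inj_on (semicircle n p q) {0..1}"
  proof (rule inj_onI)
    fix t t' :: real
    assume t: "t \<in> {0..1}" "t' \<in> {0..1}" "semicircle n p q t = semicircle n p q t'"
    have "(1 - t) * p + t * q = (1 - t') * p + t' * q"
      using unpolar_inj(1)[OF t(3)[unfolded semicircle_def]] m(1)[of t] m(3)[of t] m(3)[of t'] t by auto
    then have "(t - t') * (q - p) = 0" by (simp add: algebra_simps)
    then show "t = t'" using assms(5) by simp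
  qed
qed

lemma path_image_semicircle:
  assumes "1 \<le> \<bar>p\<bar>" "\<bar>p\<bar> \<le> real n" "1 \<le> \<bar>q\<bar>" "\<bar>q\<bar> \<le> real n" "p < q"
    and "z \<in> path_image (semicircle n p q)"
  obtains s r where "z = unpolar n s r" "1 \<le> r" "r \<le> real n" "\<bar>s\<bar> \<le> r" "p \<le> s" "s \<le> q"
    "r\<^sup>2 - s\<^sup>2 = (s - p) * (q - s)"
proof -
  obtain t where t: "0 \<le> t" "t \<le> 1" "z = semicircle n p q t"
    using assms(6) by (auto simp: path_image_def)
  have "0 \<le> t * (q - p)" "0 \<le> (1 - t) * (q - p)" using t assms(5) by auto
  then have "p \<le> (1 - t) * p + t * q" "(1 - t) * p + t * q \<le> q" by (simp_all add: algebra_simps)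
  then show ?thesis
    using that[OF t(3)[unfolded semicircle_def]] semicircle_modulus[OF assms(1-4) t(1,2)] by blast
qed

text \<open>Over the same real part the wider of two nested semicircles is strictly higher, except
  at an end point.\<close>

lemma nested_semicircles:
  fixes p q p' q' s :: real
  assumes "p \<le> p'" "q' \<le> q" "p' \<le> s" "s \<le> q'" "(p, q) \<noteq> (p', q')"
    and eq: "(s - p) * (q - s) = (s - p') * (q' - s)"
  shows "(s - p) * (q - s) = 0"
proof (rule ccontr)
  assume "(s - p) * (q - s) \<noteq> 0"
  then have n: "s \<noteq> p'" "s \<noteq> q'" "s \<noteq> p" "s \<noteq> q" using eq by auto
  then have "0 < s - p'" "0 < q' - s" using assms by auto
  moreover have "p < p' \<or> q' < q" using assms by auto
  ultimately have "(s - p') * (q' - s) < (s - p) * (q - s)"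
  proof (elim disjE)
    assume "p < p'"
    then show ?thesis using \<open>0 < s - p'\<close> \<open>0 < q' - s\<close> assms by (intro mult_less_le_imp_less) auto
  next
    assume "q' < q"
    then show ?thesis using \<open>0 < s - p'\<close> \<open>0 < q' - s\<close> assms by (intro mult_le_less_imp_less) auto
  qed
  then show False using eq by simp
qed

text \<open>Two intervals that do not cross are nested or meet in at most an end point, where the
  height is 0.\<close>

lemma noncrossing_semicircles:
  fixes p q p' q' s :: real
  assumes "p \<le> s" "s \<le> q" "p' \<le> s" "s \<le> q'" "(p, q) \<noteq> (p', q')"
    and "\<not> (p < p' \<and> p' < q \<and> q < q')" "\<not> (p' < p \<and> p < q' \<and> q' < q)"
    and eq: "(s - p) * (q - s) = (s - p') * (q' - s)"
  shows "(s - p) * (q - s) = 0"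
proof -
  consider "p \<le> p'" "q' \<le> q" | "p' \<le> p" "q \<le> q'" | "q \<le> p'" | "q' \<le> p"
    using assms by linarith
  then show ?thesis
  proof cases
    case 1
    then show ?thesis using nested_semicircles assms by blast
  next
    case 2
    then show ?thesis using nested_semicircles[of p' p q q' s] assms by auto
  next
    case 3
    then show ?thesis using assms by auto
  next
    case 4
    then show ?thesis using assms by auto
  qed
qed

text \<open>Each block is drawn as a star, every other point being joined to a representative. Two
  crossing edges would belong to one block and hence share the representative as an end point, but
  the ends of crossing edges are four different points.\<close>

lemma noncrossing_imp_planar:
  assumes "\<alpha> \<in> partitions n" "noncrossing \<alpha>"
  shows "planar_partition n \<alpha>"
proof -
  \<comment> \<open>The choice depends only on the block as a set, so \<open>rep\<close> is constant
    on blocks.\<close>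
  define rep where "rep x = (SOME y. y \<in> {y. linked \<alpha> x y})" for x
  have rep_cong: "rep x = rep y" if "linked \<alpha> x y" for x y
  proof -
    have "{z. linked \<alpha> x z} = {z. linked \<alpha> y z}"
      using that linked_sym linked_trans[OF assms(1)] by blast
    then show ?thesis by (simp add: rep_def)
  qed
  have rep: "linked \<alpha> x (rep x)" if "x \<in> points n" for x
    using someI[of "\<lambda>y. y \<in> {y. linked \<alpha> x y}" x] linked_refl[OF assms(1)] that by (simp add: rep_def)
  define E where "E = {{rep x, x} | x. x \<in> points n \<and> rep x \<noteq> x}"
  let ?R = "{(u, v). {u, v} \<in> E}"
  have edge: "\<exists>u v. e = {u, v} \<and> u \<in> points n \<and> v \<in> points n \<and> bdry n u < bdry n v \<and> linked \<alpha> u v \<and> rep u \<in> e"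
    if e: "e \<in> E" for e
  proof -
    obtain x where x: "x \<in> points n" "rep x \<noteq> x" "e = {rep x, x}"
      using e unfolding E_def by blast
    have "rep x \<in> points n" "linked \<alpha> x (rep x)" "linked \<alpha> (rep x) x"
      using rep[OF x(1)] linked_in_points[OF assms(1)] linked_sym by blast+
    moreover have "rep (rep x) = rep x" using rep_cong rep x(1) by metis
    moreover have "bdry n x \<noteq> bdry n (rep x)" using bdry_inj x \<open>rep x \<in> points n\<close> by metis
    ultimately show ?thesis using x by (metis insert_commute insertI1 linorder_neqE_linordered_idom)
  qed
  have E: "graph_on n E"
    unfolding graph_on_def
  proof
    fix e assume "e \<in> E"
    then obtain u v where "e = {u, v}" "u \<in> points n" "v \<in> points n" "bdry n u < bdry n v" using edge by metis
    then show "e \<subseteq> points n \<and> card e = 2" by (auto simp: card_2_iff)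
  qed
  \<comment> \<open>Minimum and maximum order the two ends of an edge, which is an unordered
    pair.\<close>
  define \<gamma> where "\<gamma> e = semicircle n (Min (bdry n ` e)) (Max (bdry n ` e))" for e
  have \<gamma>: "\<gamma> {u, v} = semicircle n (bdry n u) (bdry n v)" if "bdry n u < bdry n v" for u v
    using that by (simp add: \<gamma>_def min_def max_def)
  note link = linked_graph_components[OF E]
  have "graph_components n E = \<alpha>"
  proof (rule partition_eqI[OF link(1) assms(1)])
    fix x y
    have "linked \<alpha> x y" if "(x, y) \<in> ?R\<^sup>*" "x \<in> points n" for x y
      using that
    proof induction
      case (step y z)
      obtain u v where "{y, z} = {u, v}" "linked \<alpha> u v" using edge[of "{y, z}"] step.hyps by auto
      then have "linked \<alpha> y z" using linked_sym by (auto simp: doubleton_eq_iff)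
      then show ?case using step linked_trans[OF assms(1)] by blast
    qed (simp add: linked_refl[OF assms(1)])
    moreover have "(x, y) \<in> ?R\<^sup>*" if "linked \<alpha> x y"
    proof -
      have to_rep: "(x, rep x) \<in> ?R\<^sup>*" "(rep x, x) \<in> ?R\<^sup>*" if "x \<in> points n" for x
      proof -
        have "rep x = x \<or> {rep x, x} \<in> E" using that by (auto simp: E_def)
        then have "rep x = x \<or> (x, rep x) \<in> ?R \<and> (rep x, x) \<in> ?R"
          by (simp add: insert_commute)
        then show "(x, rep x) \<in> ?R\<^sup>*" "(rep x, x) \<in> ?R\<^sup>*"
          by (metis rtrancl.rtrancl_refl r_into_rtrancl)+
      qed
      have "(x, rep y) \<in> ?R\<^sup>*"
        using to_rep(1)[of x] linked_in_points[OF assms(1) that] rep_cong[OF that] by simp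
      then show ?thesis
        using to_rep(2)[OF linked_in_points(2)[OF assms(1) that]] by (rule rtrancl_trans)
    qed
    ultimately show "linked (graph_components n E) x y \<longleftrightarrow> linked \<alpha> x y"
      unfolding link(2) using linked_in_points[OF assms(1)] by blast
  qed
  moreover have "planar_drawing n E \<gamma>"
    unfolding planar_drawing_def
  proof (intro conjI ballI impI)
    fix e assume "e \<in> E"
    then obtain u v where e: "e = {u, v}" "u \<in> points n" "v \<in> points n" "bdry n u < bdry n v"
      using edge by metis
    note b = bdry_bounds[OF e(2), THEN conjunct1] bdry_bounds[OF e(2), THEN conjunct2]
      bdry_bounds[OF e(3), THEN conjunct1] bdry_bounds[OF e(3), THEN conjunct2]
    have \<gamma>e: "\<gamma> e = semicircle n (bdry n u) (bdry n v)" using e \<gamma> by simp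
    show "arc (\<gamma> e)" unfolding \<gamma>e by (rule arc_semicircle[OF b e(4)])
    have ends: "pathstart (\<gamma> e) = pos u" "pathfinish (\<gamma> e) = pos v"
      unfolding pathstart_def pathfinish_def \<gamma>e semicircle_def
      using unpolar_bdry[OF e(2)] unpolar_bdry[OF e(3)] by simp_all
    then show "{pathstart (\<gamma> e), pathfinish (\<gamma> e)} = pos ` e" using e by simp
    show "path_image (\<gamma> e) \<subseteq> {1..real n} \<times> {0..1}"
    proof
      fix z assume "z \<in> path_image (\<gamma> e)"
      then obtain s r where z: "z = unpolar n s r" "1 \<le> r" "r \<le> real n" "\<bar>s\<bar> \<le> r"
        unfolding \<gamma>e by (rule path_image_semicircle[OF b e(4)])
      then have "- 1 \<le> s / r" "s / r \<le> 1" by (auto simp: abs_le_iff field_simps)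
      then show "z \<in> {1..real n} \<times> {0..1}"
        using z arccos_lbound[of "s / r"] arccos_ubound[of "s / r"] by (auto simp: unpolar_def)
    qed
    have "z \<in> pos ` e" if zi: "z \<in> path_image (\<gamma> e)" and zp: "z \<in> pos ` points n" for z
    proof -
      obtain s r where z: "z = unpolar n s r" "1 \<le> r" "\<bar>s\<bar> \<le> r" "r\<^sup>2 - s\<^sup>2 = (s - bdry n u) * (bdry n v - s)"
        using zi unfolding \<gamma>e by (rule path_image_semicircle[OF b e(4)])
      obtain w where w: "w \<in> points n" "z = pos w" using zp by blast
      have "unpolar n (bdry n w) \<bar>bdry n w\<bar> = unpolar n s r"
        using z(1) w unpolar_bdry[OF w(1)] by simp
      from unpolar_inj[OF this] have "bdry n w = s" "\<bar>bdry n w\<bar> = r"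
        using bdry_bounds[OF w(1)] z(3) by auto
      then have "(s - bdry n u) * (bdry n v - s) = 0" using z(4) by auto
      then have "w = u \<or> w = v" using \<open>bdry n w = s\<close> bdry_inj w(1) e by auto
      then show ?thesis using w e by auto
    qed
    moreover have "pos ` e \<subseteq> path_image (\<gamma> e)"
      using e ends pathstart_in_path_image[of "\<gamma> e"] pathfinish_in_path_image[of "\<gamma> e"] by auto
    ultimately show "path_image (\<gamma> e) \<inter> pos ` points n = pos ` e" using e by auto
  next
    fix e e' assume ee: "e \<in> E" "e' \<in> E" "e \<noteq> e'"
    obtain u v where e: "e = {u, v}" "u \<in> points n" "v \<in> points n" "bdry n u < bdry n v"
        "linked \<alpha> u v" "rep u \<in> e"
      using edge[OF ee(1)] by metis
    obtain u' v' where e': "e' = {u', v'}" "u' \<in> points n" "v' \<in> points n" "bdry n u' < bdry n v'"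
        "linked \<alpha> u' v'" "rep u' \<in> e'"
      using edge[OF ee(2)] by metis
    note b = bdry_bounds[OF e(2), THEN conjunct1] bdry_bounds[OF e(2), THEN conjunct2]
      bdry_bounds[OF e(3), THEN conjunct1] bdry_bounds[OF e(3), THEN conjunct2]
    note b' = bdry_bounds[OF e'(2), THEN conjunct1] bdry_bounds[OF e'(2), THEN conjunct2]
      bdry_bounds[OF e'(3), THEN conjunct1] bdry_bounds[OF e'(3), THEN conjunct2]
    have \<gamma>e: "\<gamma> e = semicircle n (bdry n u) (bdry n v)" "\<gamma> e' = semicircle n (bdry n u') (bdry n v')"
      using e e' \<gamma> by auto
    have nc1: "\<not> (bdry n u < bdry n u' \<and> bdry n u' < bdry n v \<and> bdry n v < bdry n v')"
    proof
      assume o: "bdry n u < bdry n u' \<and> bdry n u' < bdry n v \<and> bdry n v < bdry n v'"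
      then have "linked \<alpha> u u'"
        using noncrossingD[OF assms(2) e(5) e'(5)] e e' by (simp add: bdry_less)
      then have "rep u = rep u'" by (rule rep_cong)
      then show False using o e e' by auto
    qed
    have nc2: "\<not> (bdry n u' < bdry n u \<and> bdry n u < bdry n v' \<and> bdry n v' < bdry n v)"
    proof
      assume o: "bdry n u' < bdry n u \<and> bdry n u < bdry n v' \<and> bdry n v' < bdry n v"
      then have "linked \<alpha> u' u"
        using noncrossingD[OF assms(2) e'(5) e(5)] e e' by (simp add: bdry_less)
      then have "rep u' = rep u" by (rule rep_cong)
      then show False using o e e' by auto
    qed
    have ne: "(bdry n u, bdry n v) \<noteq> (bdry n u', bdry n v')"
      using ee(3) e e' bdry_inj by auto
    show "path_image (\<gamma> e) \<inter> path_image (\<gamma> e') \<subseteq> pos ` (e \<inter> e')"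
    proof (intro subsetI, elim IntE)
      fix z assume z: "z \<in> path_image (\<gamma> e)" "z \<in> path_image (\<gamma> e')"
      obtain s r where 1: "z = unpolar n s r" "1 \<le> r" "\<bar>s\<bar> \<le> r" "bdry n u \<le> s" "s \<le> bdry n v"
          "r\<^sup>2 - s\<^sup>2 = (s - bdry n u) * (bdry n v - s)"
        using z(1) unfolding \<gamma>e by (rule path_image_semicircle[OF b e(4)])
      obtain s' r' where 2: "z = unpolar n s' r'" "1 \<le> r'" "\<bar>s'\<bar> \<le> r'" "bdry n u' \<le> s'" "s' \<le> bdry n v'"
          "r'\<^sup>2 - s'\<^sup>2 = (s' - bdry n u') * (bdry n v' - s')"
        using z(2) unfolding \<gamma>e by (rule path_image_semicircle[OF b' e'(4)])
      have "unpolar n s r = unpolar n s' r'" using 1 2 by simp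
      from unpolar_inj[OF this] have [simp]: "s' = s" "r' = r" using 1 2 by auto
      \<comment> \<open>A common point has the same real part and height on both semicircles; the
        height must vanish, so \<open>s\<close> is an end point of each.\<close>
      have 3: "(s - bdry n u) * (bdry n v - s) = 0"
        by (rule noncrossing_semicircles[OF _ _ _ _ ne nc1 nc2]) (use 1 2 in auto)
      have "(s - bdry n u') * (bdry n v' - s) = r\<^sup>2 - s\<^sup>2" using 2(6) by simp
      also have "\<dots> = 0" unfolding 1(6) by (rule 3)
      finally have 4: "(s - bdry n u') * (bdry n v' - s) = 0" .
      obtain w where w: "w \<in> e" "bdry n w = s" using 3 e by auto
      obtain w' where w': "w' \<in> e'" "bdry n w' = s" using 4 e' by auto
      have "w \<in> points n" "w' \<in> points n" using w w' e e' by auto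
      then have "w = w'" using bdry_inj[of w n w'] w(2) w'(2) by simp
      have "r\<^sup>2 = s\<^sup>2" using 1(6) 3 by simp
      then have "\<bar>bdry n w\<bar> = r" using 1(2) w(2) by (auto simp: power2_eq_iff)
      then have "z = pos w" using unpolar_bdry[OF \<open>w \<in> points n\<close>] 1(1) w(2) by simp
      then show "z \<in> pos ` (e \<inter> e')" using w w' \<open>w = w'\<close> by auto
    qed
  qed
  ultimately show ?thesis using E unfolding planar_partition_def by metis
qed

lemma planar_iff_noncrossing:
  "\<alpha> \<in> partitions n \<Longrightarrow> planar_partition n \<alpha> \<longleftrightarrow> noncrossing \<alpha>"
  using planar_imp_noncrossing noncrossing_imp_planar by blast

subsection \<open>Rank\<close>

definition marked :: "point set set \<Rightarrow> nat \<Rightarrow> bool" where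
  "marked \<alpha> i \<longleftrightarrow> (\<exists>j. linked \<alpha> (Upper i) (Lower j))"

text \<open>A choice of at most one upper point from each transversal. By \<open>indep_card\<close>
  and \<open>indep_extend\<close> the rank is the largest size of such a set, which turns rank
  estimates into statements about \<open>linked\<close>.\<close>

definition indep :: "point set set \<Rightarrow> nat set \<Rightarrow> bool" where
  "indep \<alpha> X \<longleftrightarrow> (\<forall>x\<in>X. marked \<alpha> x) \<and> (\<forall>x\<in>X. \<forall>y\<in>X. linked \<alpha> (Upper x) (Upper y) \<longrightarrow> x = y)"

lemma marked_range: "\<alpha> \<in> partitions n \<Longrightarrow> marked \<alpha> i \<Longrightarrow> i \<in> {1..n}"
  unfolding marked_def using linked_in_points(1) by fastforce

lemma marked_cong:
  assumes "\<alpha> \<in> partitions n" "linked \<alpha> (Upper i) (Upper j)" "marked \<alpha> j"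
  shows "marked \<alpha> i"
  using assms linked_trans unfolding marked_def by blast

lemma indep_subset: "indep \<alpha> X \<Longrightarrow> Y \<subseteq> X \<Longrightarrow> indep \<alpha> Y"
  unfolding indep_def by (meson subsetD)

lemma indep_range: "\<alpha> \<in> partitions n \<Longrightarrow> indep \<alpha> X \<Longrightarrow> X \<subseteq> {1..n}"
  unfolding indep_def by (meson marked_range subsetI)

lemma indep_finite: "\<alpha> \<in> partitions n \<Longrightarrow> indep \<alpha> X \<Longrightarrow> finite X"
  by (meson finite_atLeastAtMost finite_subset indep_range)

lemma finite_partition: "\<alpha> \<in> partitions n \<Longrightarrow> finite \<alpha>"
  using finite_elements[OF finite_points] by (simp add: partitions_def)

context
  fixes n :: nat and \<alpha> :: "point set set"
  assumes part: "\<alpha> \<in> partitions n"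
begin

lemma transversal_block:
  assumes "marked \<alpha> x"
  shows "{y. linked \<alpha> (Upper x) y} \<in> {A \<in> \<alpha>. transversal A}"
proof -
  have x: "Upper x \<in> points n" using marked_range[OF part assms] by simp
  then have "{y. linked \<alpha> (Upper x) y} \<in> \<alpha>" using mem_partition_iff[OF part] by blast
  moreover have "linked \<alpha> (Upper x) (Upper x)" using x linked_refl[OF part] by blast
  ultimately show ?thesis using assms unfolding transversal_def marked_def by blast
qed

lemma inj_on_block:
  assumes "indep \<alpha> X"
  shows "inj_on (\<lambda>x. {y. linked \<alpha> (Upper x) y}) X"
proof (rule inj_onI)
  fix x y assume xy: "x \<in> X" "y \<in> X" and eq: "{z. linked \<alpha> (Upper x) z} = {z. linked \<alpha> (Upper y) z}"
  have "Upper y \<in> points n" using indep_range[OF part assms] xy by auto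
  then have "linked \<alpha> (Upper x) (Upper y)" using eq linked_refl[OF part] by blast
  then show "x = y" using assms xy unfolding indep_def by blast
qed

lemma block_image_subset:
  assumes "indep \<alpha> X"
  shows "(\<lambda>x. {y. linked \<alpha> (Upper x) y}) ` X \<subseteq> {A \<in> \<alpha>. transversal A}"
proof (rule image_subsetI)
  fix x assume "x \<in> X"
  then show "{y. linked \<alpha> (Upper x) y} \<in> {A \<in> \<alpha>. transversal A}"
    using assms by (intro transversal_block) (simp add: indep_def)
qed

lemma indep_card:
  assumes "indep \<alpha> X"
  shows "card X \<le> prank \<alpha>"
  unfolding prank_def
  by (rule card_inj_on_le[OF inj_on_block[OF assms] block_image_subset[OF assms]])
     (simp add: finite_partition[OF part])

lemma indep_cover:
  assumes "indep \<alpha> X" "card X = prank \<alpha>" "marked \<alpha> i"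
  obtains x where "x \<in> X" "linked \<alpha> (Upper i) (Upper x)"
proof -
  have "(\<lambda>x. {y. linked \<alpha> (Upper x) y}) ` X = {A \<in> \<alpha>. transversal A}"
    using assms(2) card_image[OF inj_on_block[OF assms(1)]] finite_partition[OF part]
    by (intro card_subset_eq[OF _ block_image_subset[OF assms(1)]]) (auto simp: prank_def)
  then have "{y. linked \<alpha> (Upper i) y} \<in> (\<lambda>x. {y. linked \<alpha> (Upper x) y}) ` X"
    using transversal_block[OF assms(3)] by blast
  then obtain x where x: "x \<in> X" "{y. linked \<alpha> (Upper i) y} = {y. linked \<alpha> (Upper x) y}" by blast
  have "Upper i \<in> points n" using marked_range[OF part assms(3)] by simp
  then have "linked \<alpha> (Upper x) (Upper i)" using x linked_refl[OF part] by blast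
  then show ?thesis using that x(1) linked_sym by blast
qed

text \<open>Every transversal that \<open>Z\<close> misses contributes a chosen upper point
  \<open>c A\<close>. With \<open>Z\<close> empty this computes the rank; with a singleton it finds
  a full system through a prescribed point.\<close>

lemma indep_extend:
  assumes "indep \<alpha> Z"
  obtains X where "Z \<subseteq> X" "indep \<alpha> X" "card X = prank \<alpha>"
proof -
  let ?T = "{A \<in> \<alpha>. transversal A}"
  let ?B = "\<lambda>x. {y. linked \<alpha> (Upper x) y}"
  define c where "c A = (SOME i. Upper i \<in> A)" for A :: "point set"
  have c: "Upper (c A) \<in> A" if "A \<in> ?T" for A
    using that someI_ex[of "\<lambda>i. Upper i \<in> A"] by (auto simp: c_def transversal_def)
  have Bc: "?B (c A) = A" if "A \<in> ?T" for A
    using that c[OF that] linked_block[OF part, of A "Upper (c A)"] by simp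
  have mc: "marked \<alpha> (c A)" if "A \<in> ?T" for A
    using that Bc[OF that] by (auto simp: marked_def transversal_def)
  define X where "X = Z \<union> c ` (?T - ?B ` Z)"
  have eqB: "?B x = ?B y" if "linked \<alpha> (Upper x) (Upper y)" for x y
    using that linked_trans[OF part] linked_sym by blast
  have X: "indep \<alpha> X"
    unfolding indep_def
  proof (intro conjI ballI impI)
    show "marked \<alpha> x" if "x \<in> X" for x
      using that mc assms by (auto simp: X_def indep_def)
    show "x = y" if xy: "x \<in> X" "y \<in> X" and l: "linked \<alpha> (Upper x) (Upper y)" for x y
    proof (cases "x \<in> Z"; cases "y \<in> Z")
      assume "x \<in> Z" "y \<in> Z"
      then show ?thesis using assms l unfolding indep_def by blast
    next
      assume "x \<in> Z" "y \<notin> Z"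
      then obtain A where "A \<in> ?T - ?B ` Z" "y = c A" using xy by (auto simp: X_def)
      then have "A = ?B x" using Bc eqB[OF l] by simp
      then show ?thesis using \<open>A \<in> ?T - ?B ` Z\<close> \<open>x \<in> Z\<close> by blast
    next
      assume "x \<notin> Z" "y \<in> Z"
      then obtain A where "A \<in> ?T - ?B ` Z" "x = c A" using xy by (auto simp: X_def)
      then have "A = ?B y" using Bc eqB[OF l] by simp
      then show ?thesis using \<open>A \<in> ?T - ?B ` Z\<close> \<open>y \<in> Z\<close> by blast
    next
      assume "x \<notin> Z" "y \<notin> Z"
      then obtain A A' where "A \<in> ?T" "x = c A" "A' \<in> ?T" "y = c A'" using xy by (auto simp: X_def)
      then show ?thesis using Bc[of A] Bc[of A'] eqB[OF l] by simp
    qed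
  qed
  have "?T \<subseteq> ?B ` X"
  proof
    fix A assume "A \<in> ?T"
    show "A \<in> ?B ` X"
    proof (cases "A \<in> ?B ` Z")
      case False
      then have "c A \<in> X" using \<open>A \<in> ?T\<close> by (simp add: X_def)
      then show ?thesis using Bc[OF \<open>A \<in> ?T\<close>] by blast
    qed (auto simp: X_def)
  qed
  then have "prank \<alpha> \<le> card X"
    unfolding prank_def using indep_finite[OF part X] by (rule surj_card_le[rotated])
  then have "card X = prank \<alpha>" using indep_card[OF X] by simp
  then show ?thesis using that X by (auto simp: X_def)
qed

lemma prank_pstar: "prank (pstar \<alpha>) = prank \<alpha>"
proof -
  have "transversal (flip ` A) \<longleftrightarrow> transversal A" for A
    unfolding transversal_def mem_flip_image by auto
  then have "{A \<in> pstar \<alpha>. transversal A} = image flip ` {A \<in> \<alpha>. transversal A}"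
    unfolding pstar_def by auto
  moreover have "inj_on (image flip) {A \<in> \<alpha>. transversal A}"
    using inj_flip by (simp add: inj_on_image inj_on_def inj_image_eq_iff)
  ultimately show ?thesis unfolding prank_def by (simp add: card_image)
qed

end

lemma marked_pstar: "marked (pstar \<alpha>) j \<longleftrightarrow> (\<exists>i. linked \<alpha> (Upper i) (Lower j))"
  unfolding marked_def linked_pstar using linked_sym by auto

lemma prank_0_iff:
  assumes "\<alpha> \<in> partitions n"
  shows "prank \<alpha> = 0 \<longleftrightarrow> (\<forall>i. \<not> marked \<alpha> i)"
proof
  assume "prank \<alpha> = 0"
  show "\<forall>i. \<not> marked \<alpha> i"
  proof (intro allI notI)
    fix i assume "marked \<alpha> i"
    then have "indep \<alpha> {i}" by (simp add: indep_def)
    then show False using indep_card[OF assms] \<open>prank \<alpha> = 0\<close> by fastforce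
  qed
next
  assume "\<forall>i. \<not> marked \<alpha> i"
  moreover obtain X where "indep \<alpha> X" "card X = prank \<alpha>"
    using indep_extend[OF assms, of "{}"] by (auto simp: indep_def)
  ultimately show "prank \<alpha> = 0" unfolding indep_def by (metis card.empty equals0I)
qed

lemma prank_le_1_linked:
  assumes "\<alpha> \<in> partitions n" "prank \<alpha> \<le> 1" "marked \<alpha> i" "marked \<alpha> j"
  shows "linked \<alpha> (Upper i) (Upper j)"
proof (rule ccontr)
  assume "\<not> linked \<alpha> (Upper i) (Upper j)"
  moreover from this have "i \<noteq> j"
    using linked_refl[OF assms(1)] marked_range[OF assms(1,3)] by auto
  ultimately have "indep \<alpha> {i, j}" using assms linked_sym[of \<alpha>] by (auto simp: indep_def)
  then have "card {i, j} \<le> 1" using indep_card[OF assms(1)] assms(2) by fastforce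
  then show False using \<open>i \<noteq> j\<close> by simp
qed

section \<open>Blocks and rank of a product\<close>

lemma linked_pprod_upperI: "\<alpha> \<in> partitions n \<Longrightarrow> linked \<alpha> (Upper i) (Upper j) \<Longrightarrow> linked (pprod n \<alpha> \<beta>) (Upper i) (Upper j)"
  using joined_leftI[of \<alpha> "Upper i" "Upper j" \<beta>] linked_in_points[of \<alpha> n "Upper i" "Upper j"] by (simp add: linked_pprod)

lemma linked_pprod_lowerI: "\<beta> \<in> partitions n \<Longrightarrow> linked \<beta> (Lower i) (Lower j) \<Longrightarrow> linked (pprod n \<alpha> \<beta>) (Lower i) (Lower j)"
  using joined_rightI[of \<beta> "Lower i" "Lower j" \<alpha>] linked_in_points[of \<beta> n "Lower i" "Lower j"] by (simp add: linked_pprod)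

text \<open>An upper block without lower points never touches the middle row, so membership in it,
  false on all other nodes, is a valid labelling.\<close>

lemma linked_pprod_unmarked:
  assumes "\<alpha> \<in> partitions n" "\<not> marked \<alpha> i"
  shows "linked (pprod n \<alpha> \<beta>) (Upper i) p \<longleftrightarrow> linked \<alpha> (Upper i) p"
proof
  assume l: "linked (pprod n \<alpha> \<beta>) (Upper i) p"
  have no: "\<not> linked \<alpha> (Upper i) (Lower z)" for z using assms(2) unfolding marked_def by blast
  define lab where "lab u = (case u of Inl p \<Rightarrow> linked \<alpha> (Upper i) p | Inr _ \<Rightarrow> False)" for u :: "point + nat"
  have "lab (Inl (Upper i)) = lab (Inl p)"
  proof (rule linked_pprod_label[OF l])
    have "lab (lower_to_middle z) = linked \<alpha> (Upper i) z" for z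
      using no by (cases z) (auto simp: lab_def)
    then show "lab (lower_to_middle x) = lab (lower_to_middle y)" if "linked \<alpha> x y" for x y
      using that linked_sym linked_trans[OF assms(1)] by blast
    have "\<not> lab (upper_to_middle z)" for z
      using no by (cases z) (auto simp: lab_def)
    then show "lab (upper_to_middle x) = lab (upper_to_middle y)" for x y by blast
  qed
  moreover have "Upper i \<in> points n" using l by (simp add: linked_pprod)
  ultimately show "linked \<alpha> (Upper i) p" using linked_refl[OF assms(1)] by (simp add: lab_def)
next
  assume l: "linked \<alpha> (Upper i) p"
  then obtain j where "p = Upper j" using assms(2) unfolding marked_def by (cases p) auto
  then show "linked (pprod n \<alpha> \<beta>) (Upper i) p" using l linked_pprod_upperI[OF assms(1)] by blast
qed

lemma marked_pprod: "\<alpha> \<in> partitions n \<Longrightarrow> marked (pprod n \<alpha> \<beta>) i \<Longrightarrow> marked \<alpha> i"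
  using linked_pprod_unmarked unfolding marked_def by blast

text \<open>An independent set of the product is independent for \<alpha>: a transversal of the
  product starts in transversals of \<alpha>, and upper blocks of \<alpha> can only grow.\<close>

lemma prank_pprod_left:
  assumes "\<alpha> \<in> partitions n"
  shows "prank (pprod n \<alpha> \<beta>) \<le> prank \<alpha>"
proof -
  obtain X where X: "indep (pprod n \<alpha> \<beta>) X" "card X = prank (pprod n \<alpha> \<beta>)"
    using indep_extend[OF pprod_partitions, of n \<alpha> \<beta> "{}"] by (auto simp: indep_def)
  have "indep \<alpha> X"
    unfolding indep_def
  proof (intro conjI ballI impI)
    show "marked \<alpha> x" if "x \<in> X" for x
      using X(1) that by (intro marked_pprod[OF assms, of \<beta>]) (simp add: indep_def)
    show "x = y" if "x \<in> X" "y \<in> X" "linked \<alpha> (Upper x) (Upper y)" for x y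
      using X(1) that(1,2) linked_pprod_upperI[OF assms that(3), of \<beta>] by (simp add: indep_def)
  qed
  then show ?thesis using indep_card[OF assms] X(2) by metis
qed

lemma prank_pprod_right:
  assumes "\<beta> \<in> partitions n"
  shows "prank (pprod n \<alpha> \<beta>) \<le> prank \<beta>"
proof -
  have "prank (pprod n \<alpha> \<beta>) = prank (pprod n (pstar \<beta>) (pstar \<alpha>))"
    using prank_pstar[OF pprod_partitions, of n \<alpha> \<beta>] by (simp add: pstar_pprod)
  also have "\<dots> \<le> prank (pstar \<beta>)" using assms by (intro prank_pprod_left) simp
  finally show ?thesis using prank_pstar[OF assms] by simp
qed

text \<open>With at most one transversal there are no two upper blocks that a right factor could
  join.\<close>

lemma linked_pprod_rank_1:
  assumes "\<alpha> \<in> partitions n" "prank \<alpha> \<le> 1"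
  shows "linked (pprod n \<alpha> \<beta>) (Upper i) (Upper j) \<longleftrightarrow> linked \<alpha> (Upper i) (Upper j)"
proof -
  consider "marked \<alpha> i" "marked \<alpha> j" | "\<not> marked \<alpha> i" | "\<not> marked \<alpha> j" by blast
  then show ?thesis
  proof cases
    case 1
    then show ?thesis using prank_le_1_linked[OF assms 1] linked_pprod_upperI[OF assms(1)] by blast
  next
    case 2
    then show ?thesis by (rule linked_pprod_unmarked[OF assms(1)])
  next
    case 3
    then show ?thesis using linked_pprod_unmarked[OF assms(1) 3, of \<beta> "Upper i"] linked_sym by blast
  qed
qed

subsection \<open>Partitions with trivial lower part\<close>

text \<open>\<kappa> is the upper pattern, and \<open>f\<close> sends an upper class to the lower
  end of its transversal, if it has one; no two lower points are linked. Partial bijections,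
  \<open>cap\<close> and the split patterns below all have this shape, so one product formula serves
  them all.\<close>

fun tie_rel :: "(nat \<Rightarrow> nat \<Rightarrow> bool) \<Rightarrow> (nat \<Rightarrow> nat option) \<Rightarrow> point \<Rightarrow> point \<Rightarrow> bool" where
  "tie_rel \<kappa> f (Upper i) (Upper j) \<longleftrightarrow> \<kappa> i j"
| "tie_rel \<kappa> f (Upper i) (Lower j) \<longleftrightarrow> f i = Some j"
| "tie_rel \<kappa> f (Lower i) (Upper j) \<longleftrightarrow> f j = Some i"
| "tie_rel \<kappa> f (Lower i) (Lower j) \<longleftrightarrow> i = j"

definition tie :: "nat \<Rightarrow> (nat \<Rightarrow> nat \<Rightarrow> bool) \<Rightarrow> (nat \<Rightarrow> nat option) \<Rightarrow> point set set" where
  "tie n \<kappa> f = partition_of n (tie_rel \<kappa> f)"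

definition tie_ok :: "nat \<Rightarrow> (nat \<Rightarrow> nat \<Rightarrow> bool) \<Rightarrow> (nat \<Rightarrow> nat option) \<Rightarrow> bool" where
  "tie_ok n \<kappa> f \<longleftrightarrow>
     (\<forall>i\<in>{1..n}. \<kappa> i i) \<and> (\<forall>i\<in>{1..n}. \<forall>j\<in>{1..n}. \<kappa> i j \<longrightarrow> \<kappa> j i) \<and>
     (\<forall>i\<in>{1..n}. \<forall>j\<in>{1..n}. \<forall>k\<in>{1..n}. \<kappa> i j \<longrightarrow> \<kappa> j k \<longrightarrow> \<kappa> i k) \<and>
     (\<forall>i\<in>{1..n}. \<forall>j\<in>{1..n}. \<kappa> i j \<longrightarrow> f i = f j) \<and>
     (\<forall>i\<in>{1..n}. \<forall>j\<in>{1..n}. f i \<noteq> None \<longrightarrow> f i = f j \<longrightarrow> \<kappa> i j) \<and>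
     (\<forall>i\<in>{1..n}. \<forall>z. f i = Some z \<longrightarrow> z \<in> {1..n})"

context
  fixes n \<kappa> f assumes ok: "tie_ok n \<kappa> f"
begin

lemma tie_okD:
  assumes "i \<in> {1..n}" "j \<in> {1..n}"
  shows "\<kappa> i i" "\<kappa> i j \<Longrightarrow> \<kappa> j i" "k \<in> {1..n} \<Longrightarrow> \<kappa> i j \<Longrightarrow> \<kappa> j k \<Longrightarrow> \<kappa> i k" "\<kappa> i j \<Longrightarrow> f i = f j"
    "f i \<noteq> None \<Longrightarrow> f i = f j \<Longrightarrow> \<kappa> i j" "f i = Some z \<Longrightarrow> z \<in> {1..n}"
  using ok assms unfolding tie_ok_def by blast+

lemma equiv_tie: "equiv (points n) {(x, y) \<in> points n \<times> points n. tie_rel \<kappa> f x y}"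
proof (intro equivI refl_onI symI transI)
  show "(x, x) \<in> {(x, y) \<in> points n \<times> points n. tie_rel \<kappa> f x y}" if "x \<in> points n" for x
    using that tie_okD(1) by (cases x) auto
  show "(y, x) \<in> {(x, y) \<in> points n \<times> points n. tie_rel \<kappa> f x y}"
    if "(x, y) \<in> {(x, y) \<in> points n \<times> points n. tie_rel \<kappa> f x y}" for x y
    using that tie_okD(2) by (cases x; cases y) auto
  show "(x, z) \<in> {(x, y) \<in> points n \<times> points n. tie_rel \<kappa> f x y}"
    if "(x, y) \<in> {(x, y) \<in> points n \<times> points n. tie_rel \<kappa> f x y}"
      "(y, z) \<in> {(x, y) \<in> points n \<times> points n. tie_rel \<kappa> f x y}" for x y z
  proof -
    have p: "x \<in> points n" "y \<in> points n" "z \<in> points n" and t: "tie_rel \<kappa> f x y" "tie_rel \<kappa> f y z"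
      using that by auto
    have "tie_rel \<kappa> f x z"
    proof (cases x; cases y; cases z)
      fix i j k assume "x = Upper i" "y = Upper j" "z = Upper k"
      then show ?thesis using p t tie_okD(3)[of i j k] by simp
    next
      fix i j k assume "x = Upper i" "y = Upper j" "z = Lower k"
      then show ?thesis using p t tie_okD(4)[of i j] by simp
    next
      fix i j k assume "x = Upper i" "y = Lower j" "z = Upper k"
      then show ?thesis using p t tie_okD(5)[of i k] by simp
    next
      fix i j k assume "x = Lower i" "y = Upper j" "z = Upper k"
      then show ?thesis using p t tie_okD(4)[of j k] by simp
    qed (use t in auto)
    then show ?thesis using p by simp
  qed
qed auto

lemma tie_partitions: "tie n \<kappa> f \<in> partitions n"
  unfolding tie_def by (rule partition_of_partitions[OF equiv_tie])

lemma linked_tie: "linked (tie n \<kappa> f) x y \<longleftrightarrow> x \<in> points n \<and> y \<in> points n \<and> tie_rel \<kappa> f x y"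
  unfolding tie_def by (rule linked_partition_of[OF equiv_tie])

text \<open>The premises treat a crossing with none, one or two of its points in the lower row; with
  three of them there, two different lower points would be linked.\<close>

lemma noncrossing_tie:
  assumes nest: "\<And>i j k l. i < j \<Longrightarrow> j < k \<Longrightarrow> k < l \<Longrightarrow> {i, j, k, l} \<subseteq> {1..n} \<Longrightarrow> \<kappa> i k \<Longrightarrow> \<kappa> j l \<Longrightarrow> \<kappa> i j"
    and out: "\<And>i j k. i < j \<Longrightarrow> j < k \<Longrightarrow> {i, j, k} \<subseteq> {1..n} \<Longrightarrow> \<kappa> i k \<Longrightarrow> f j \<noteq> None \<Longrightarrow> \<kappa> i j"
    and mono: "\<And>i j x y. i < j \<Longrightarrow> {i, j} \<subseteq> {1..n} \<Longrightarrow> f i = Some x \<Longrightarrow> f j = Some y \<Longrightarrow> x \<le> y"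
  shows "noncrossing (tie n \<kappa> f)"
  unfolding noncrossing_def
proof (intro allI impI)
  fix a b c d
  assume o: "pless a b" "pless b c" "pless c d" and l: "linked (tie n \<kappa> f) a c" "linked (tie n \<kappa> f) b d"
  have p: "a \<in> points n" "b \<in> points n" "c \<in> points n" "d \<in> points n"
    and t: "tie_rel \<kappa> f a c" "tie_rel \<kappa> f b d"
    using l by (auto simp: linked_tie)
  have "tie_rel \<kappa> f a b"
  proof (cases d)
    case d: (Upper l)
    then obtain i j k where "a = Upper i" "b = Upper j" "c = Upper k"
      using o by (cases a; cases b; cases c) auto
    then show ?thesis using nest[of i j k l] o p t d by auto
  next
    case d: (Lower l)
    show ?thesis
    proof (cases b)
      case b: (Upper j)
      then obtain i where a: "a = Upper i" using o by (cases a) auto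
      show ?thesis
      proof (cases c)
        case c: (Upper k)
        then show ?thesis using out[of i j k] o p t a b d by auto
      next
        case c: (Lower k)
        then show ?thesis using mono[of i j k l] o p t a b d by auto
      qed
    next
      case (Lower j)
      then show ?thesis using o t d by (cases c) auto
    qed
  qed
  then show "linked (tie n \<kappa> f) a b" using p by (simp add: linked_tie)
qed

lemma small_blocks_tie:
  assumes "\<And>i j k. {i, j, k} \<subseteq> {1..n} \<Longrightarrow> \<kappa> i j \<Longrightarrow> \<kappa> i k \<Longrightarrow> i = j \<or> i = k \<or> j = k"
    and "\<And>i j x. {i, j} \<subseteq> {1..n} \<Longrightarrow> \<kappa> i j \<Longrightarrow> f i = Some x \<Longrightarrow> i = j"
  shows "small_blocks (tie n \<kappa> f)"
  unfolding small_blocks_def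
proof (intro allI impI)
  fix x y z
  assume l: "linked (tie n \<kappa> f) x y" "linked (tie n \<kappa> f) x z"
  have p: "x \<in> points n" "y \<in> points n" "z \<in> points n" and t: "tie_rel \<kappa> f x y" "tie_rel \<kappa> f x z"
    using l by (auto simp: linked_tie)
  show "x = y \<or> x = z \<or> y = z"
  proof (cases x)
    case x: (Upper i)
    show ?thesis
    proof (cases y)
      case y: (Upper j)
      show ?thesis
      proof (cases z)
        case z: (Upper k)
        have "{i, j, k} \<subseteq> {1..n}" "\<kappa> i j" "\<kappa> i k" using p t x y z by simp_all
        from assms(1)[OF this] show ?thesis unfolding x y z by blast
      next
        case z: (Lower k)
        have "{i, j} \<subseteq> {1..n}" "\<kappa> i j" "f i = Some k" using p t x y z by simp_all
        from assms(2)[OF this] show ?thesis unfolding x y by blast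
      qed
    next
      case y: (Lower j)
      show ?thesis
      proof (cases z)
        case z: (Upper k)
        have "{i, k} \<subseteq> {1..n}" "\<kappa> i k" "f i = Some j" using p t x y z by simp_all
        from assms(2)[OF this] show ?thesis unfolding x z by blast
      next
        case z: (Lower k)
        then show ?thesis using t x y by simp
      qed
    qed
  next
    case x: (Lower i)
    show ?thesis
    proof (cases y)
      case y: (Upper j)
      show ?thesis
      proof (cases z)
        case z: (Upper k)
        have jk: "{j, k} \<subseteq> {1..n}" "f j = Some i" "f k = Some i" using p t x y z by simp_all
        then have "\<kappa> j k" using tie_okD(5)[of j k] by simp
        from assms(2)[OF jk(1) this jk(2)] show ?thesis unfolding y z by blast
      next
        case z: (Lower k)
        then show ?thesis using t x by simp
      qed
    next
      case y: (Lower j)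
      then show ?thesis using t x by simp
    qed
  qed
qed

text \<open>Lower points of the left factor are pairwise unlinked, so a path cannot pass through the
  left factor from one middle point to another without returning along the same transversal. Hence
  only links inside \<alpha> matter in the middle row.\<close>

lemma linked_tie_pprod:
  assumes "\<alpha> \<in> partitions n"
  shows "linked (pprod n (tie n \<kappa> f) \<alpha>) (Upper i) (Upper j) \<longleftrightarrow> i \<in> {1..n} \<and> j \<in> {1..n} \<and>
      (\<kappa> i j \<or> (\<exists>x y. f i = Some x \<and> f j = Some y \<and> linked \<alpha> (Upper x) (Upper y)))" (is ?UU)
    and "linked (pprod n (tie n \<kappa> f) \<alpha>) (Upper i) (Lower j) \<longleftrightarrow> i \<in> {1..n} \<and>
      (\<exists>x. f i = Some x \<and> linked \<alpha> (Upper x) (Lower j))" (is ?UL)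
    and "linked (pprod n (tie n \<kappa> f) \<alpha>) (Lower i) (Lower j) \<longleftrightarrow> linked \<alpha> (Lower i) (Lower j)" (is ?LL)
proof -
  let ?t = "tie n \<kappa> f"
  define Q where "Q p = {y. linked \<alpha> p y}" for p
  have QI: "Q p = Q q" if "linked \<alpha> p q" for p q
    using that linked_sym linked_trans[OF assms] unfolding Q_def by blast
  have QD: "linked \<alpha> p q" if "Q p = Q q" "q \<in> points n" for p q
    using that linked_refl[OF assms] unfolding Q_def by blast
  \<comment> \<open>Middle and lower nodes carry their class in \<alpha>; an upper point carries the
    class that it reaches through \<open>f\<close>, or its own \<kappa>-class if it reaches
    none.\<close>
  define lab where "lab u = (case u of Inl (Lower j) \<Rightarrow> Inl (Q (Lower j)) | Inr i \<Rightarrow> Inl (Q (Upper i))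
      | Inl (Upper i) \<Rightarrow> (case f i of Some x \<Rightarrow> Inl (Q (Upper x)) | None \<Rightarrow> Inr {j \<in> {1..n}. \<kappa> i j}))" for u
  have lab: "lab (Inl x) = lab (Inl y)" if "linked (pprod n ?t \<alpha>) x y" for x y
  proof (rule linked_pprod_label[OF that])
    fix x y assume "linked ?t x y"
    then have p: "x \<in> points n" "y \<in> points n" and t: "tie_rel \<kappa> f x y" by (auto simp: linked_tie)
    show "lab (lower_to_middle x) = lab (lower_to_middle y)"
    proof (cases x)
      case x: (Upper i)
      show ?thesis
      proof (cases y)
        case y: (Upper j)
        have ij: "i \<in> {1..n}" "j \<in> {1..n}" "\<kappa> i j" using p t x y by simp_all
        have "\<kappa> i k \<longleftrightarrow> \<kappa> j k" if "k \<in> {1..n}" for k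
          using tie_okD(2)[OF ij] tie_okD(3)[OF ij(1,2) that ij(3)] tie_okD(3)[OF ij(2,1) that] ij(3) by blast
        then have "{k \<in> {1..n}. \<kappa> i k} = {k \<in> {1..n}. \<kappa> j k}" by blast
        moreover have "f i = f j" by (rule tie_okD(4)[OF ij])
        ultimately show ?thesis unfolding x y lab_def lower_to_middle.simps sum.case point.case by (simp only:)
      next
        case y: (Lower j)
        then show ?thesis using t x by (simp add: lab_def)
      qed
    next
      case x: (Lower i)
      then show ?thesis using t by (cases y) (simp_all add: lab_def)
    qed
  next
    fix x y assume "linked \<alpha> x y"
    have "lab (upper_to_middle z) = Inl (Q z)" for z by (cases z) (auto simp: lab_def)
    then show "lab (upper_to_middle x) = lab (upper_to_middle y)" using QI[OF \<open>linked \<alpha> x y\<close>] by simp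
  qed
  have up: "joined ?t \<alpha> (Inl (Upper i)) (Inr x)" if "i \<in> {1..n}" "f i = Some x" for i x
  proof -
    have "linked ?t (Upper i) (Lower x)" using that tie_okD(6)[OF that(1,1,2)] by (simp add: linked_tie)
    from joined_leftI[OF this] show ?thesis by simp
  qed
  have pts: "x \<in> {1..n}" if "linked \<alpha> (Upper x) q" for x q
    using linked_in_points(1)[OF assms that] by simp
  show ?UU
  proof
    assume l: "linked (pprod n ?t \<alpha>) (Upper i) (Upper j)"
    then have ij: "i \<in> {1..n}" "j \<in> {1..n}" by (auto simp: linked_pprod)
    have eq: "lab (Inl (Upper i)) = lab (Inl (Upper j))" by (rule lab[OF l])
    have "\<kappa> i j \<or> (\<exists>x y. f i = Some x \<and> f j = Some y \<and> linked \<alpha> (Upper x) (Upper y))"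
    proof (cases "f i"; cases "f j")
      assume "f i = None" "f j = None"
      then have "{k \<in> {1..n}. \<kappa> i k} = {k \<in> {1..n}. \<kappa> j k}" using eq by (simp add: lab_def)
      then show ?thesis using ij tie_okD(1)[OF ij(2) ij(2)] by blast
    next
      fix x y assume "f i = Some x" "f j = Some y"
      then show ?thesis using eq QD[of "Upper x" "Upper y"] tie_okD(6)[OF ij(2) ij(2)] by (auto simp: lab_def)
    qed (use eq in \<open>auto simp: lab_def\<close>)
    then show "i \<in> {1..n} \<and> j \<in> {1..n} \<and> (\<kappa> i j \<or> (\<exists>x y. f i = Some x \<and> f j = Some y \<and> linked \<alpha> (Upper x) (Upper y)))"
      using ij by blast
  next
    assume r: "i \<in> {1..n} \<and> j \<in> {1..n} \<and> (\<kappa> i j \<or> (\<exists>x y. f i = Some x \<and> f j = Some y \<and> linked \<alpha> (Upper x) (Upper y)))"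
    then consider "\<kappa> i j" | x y where "f i = Some x" "f j = Some y" "linked \<alpha> (Upper x) (Upper y)" by blast
    then show "linked (pprod n ?t \<alpha>) (Upper i) (Upper j)"
    proof cases
      case 1
      then show ?thesis using r by (intro linked_pprod_upperI tie_partitions) (auto simp: linked_tie)
    next
      case 2
      have "joined ?t \<alpha> (Inl (Upper i)) (Inr x)" "joined ?t \<alpha> (Inr x) (Inr y)"
        "joined ?t \<alpha> (Inr y) (Inl (Upper j))"
        using up[of i x] up[of j y, THEN joined_sym] joined_rightI[OF 2(3), of ?t] r 2 by simp_all
      then have "joined ?t \<alpha> (Inl (Upper i)) (Inl (Upper j))" by (meson rtrancl_trans)
      then show ?thesis using r by (simp add: linked_pprod)
    qed
  qed
  show ?UL
  proof
    assume l: "linked (pprod n ?t \<alpha>) (Upper i) (Lower j)"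
    then have ij: "i \<in> {1..n}" "Lower j \<in> points n" by (auto simp: linked_pprod)
    have eq: "lab (Inl (Upper i)) = lab (Inl (Lower j))" by (rule lab[OF l])
    show "i \<in> {1..n} \<and> (\<exists>x. f i = Some x \<and> linked \<alpha> (Upper x) (Lower j))"
      using eq ij QD by (cases "f i") (auto simp: lab_def)
  next
    assume "i \<in> {1..n} \<and> (\<exists>x. f i = Some x \<and> linked \<alpha> (Upper x) (Lower j))"
    then obtain x where x: "i \<in> {1..n}" "f i = Some x" "linked \<alpha> (Upper x) (Lower j)" by blast
    have "joined ?t \<alpha> (Inr x) (Inl (Lower j))" using joined_rightI[OF x(3), of ?t] by simp
    with up[OF x(1,2)] have "joined ?t \<alpha> (Inl (Upper i)) (Inl (Lower j))" by (rule rtrancl_trans)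
    then show "linked (pprod n ?t \<alpha>) (Upper i) (Lower j)"
      using x linked_in_points[OF assms x(3)] by (simp add: linked_pprod)
  qed
  show ?LL
  proof
    assume l: "linked (pprod n ?t \<alpha>) (Lower i) (Lower j)"
    then have "Lower j \<in> points n" by (auto simp: linked_pprod)
    moreover have "lab (Inl (Lower i)) = lab (Inl (Lower j))" by (rule lab[OF l])
    ultimately show "linked \<alpha> (Lower i) (Lower j)" using QD by (simp add: lab_def)
  qed (rule linked_pprod_lowerI[OF assms])
qed

end

subsection \<open>Planar diagrams\<close>

text \<open>An increasing bijection preserves the number of elements below a point, and this number
  determines the image in \<open>Y\<close>.\<close>

lemma strict_mono_on_bij_unique:
  fixes g h :: "nat \<Rightarrow> nat"
  assumes "finite X" "bij_betw g X Y" "strict_mono_on X g" "bij_betw h X Y" "strict_mono_on X h" "x \<in> X"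
  shows "g x = h x"
proof -
  have card_below: "card {w \<in> Y. w < k x} = card {z \<in> X. z < x}"
    if k: "bij_betw k X Y" "strict_mono_on X k" for k :: "nat \<Rightarrow> nat"
  proof -
    have less: "k z < k x \<longleftrightarrow> z < x" if "z \<in> X" for z
      using strict_mono_on_less[OF k(2) that assms(6)] .
    have "k ` {z \<in> X. z < x} = {w \<in> Y. w < k x}"
      using less bij_betw_imp_surj_on[OF k(1)] by auto
    moreover have "inj_on k {z \<in> X. z < x}"
      using bij_betw_imp_inj_on[OF k(1)] by (rule inj_on_subset) auto
    ultimately show ?thesis using card_image by metis
  qed
  have fin: "finite Y" using bij_betw_finite[OF assms(2)] assms(1) by simp
  have le: "\<not> k x < l x" if "bij_betw k X Y" "strict_mono_on X k" "bij_betw l X Y" "strict_mono_on X l"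
    for k l :: "nat \<Rightarrow> nat"
  proof
    assume "k x < l x"
    moreover have "k x \<in> Y" using that(1) assms(6) by (rule bij_betwE[rule_format])
    ultimately have "{w \<in> Y. w < k x} \<subset> {w \<in> Y. w < l x}" by auto
    then have "card {w \<in> Y. w < k x} < card {w \<in> Y. w < l x}"
      using fin by (intro psubset_card_mono) auto
    then show False using card_below that by simp
  qed
  show ?thesis using le[OF assms(2-5)] le[OF assms(4,5,2,3)] by simp
qed

lemma ex_strict_mono_bij:
  fixes X Y :: "nat set"
  assumes "finite X" "finite Y" "card X = card Y"
  obtains m where "bij_betw m X Y" "strict_mono_on X m"
proof -
  obtain g where g: "bij_betw g {..<card X} X" "strict_mono_on {..<card X} g"
    using ex_bij_betw_strict_mono_card[OF assms(1)] by blast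
  obtain h where h: "bij_betw h {..<card X} Y" "strict_mono_on {..<card X} h"
    using ex_bij_betw_strict_mono_card[OF assms(2)] assms(3) by metis
  let ?k = "inv_into {..<card X} g"
  have k: "bij_betw ?k X {..<card X}" by (rule bij_betw_inv_into[OF g(1)])
  have "bij_betw (h \<circ> ?k) X Y" by (rule bij_betw_trans[OF k h(1)])
  moreover have "strict_mono_on X (h \<circ> ?k)"
  proof (rule strict_mono_onI)
    fix r s assume rs: "r \<in> X" "s \<in> X" "r < s"
    have ks: "?k r \<in> {..<card X}" "?k s \<in> {..<card X}" using bij_betwE[OF k] rs by blast+
    have "g (?k r) < g (?k s)"
      using rs bij_betw_inv_into_right[OF g(1)] by simp
    then have "?k r < ?k s" using strict_mono_on_less[OF g(2) ks] by simp
    then show "(h \<circ> ?k) r < (h \<circ> ?k) s" using strict_mono_onD[OF h(2) ks] by simp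
  qed
  ultimately show ?thesis by (rule that)
qed

text \<open>The diagram of an order-preserving partial injection, with all remaining points as
  singletons. As a left factor it relabels upper points; its star does the same for lower points
  from the right.\<close>

definition pinj :: "nat \<Rightarrow> nat set \<Rightarrow> (nat \<Rightarrow> nat) \<Rightarrow> point set set" where
  "pinj n X g = tie n (=) (\<lambda>i. if i \<in> X then Some (g i) else None)"

definition pid :: "nat \<Rightarrow> nat set \<Rightarrow> point set set" where
  "pid n X = pinj n X (\<lambda>i. i)"

text \<open>\<open>mot\<close> switches the restriction to blocks of size at most two on or off, so
  both monoids are instances.\<close>

locale planar_diagrams =
  fixes n :: nat and mot :: bool
  assumes n2: "2 \<le> n"
begin

definition D :: "point set set set" where
  "D = {\<alpha> \<in> partitions n. noncrossing \<alpha> \<and> (mot \<longrightarrow> small_blocks \<alpha>)}"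

abbreviation mul (infixl "\<cdot>" 70) where "\<alpha> \<cdot> \<beta> \<equiv> pprod n \<alpha> \<beta>"

abbreviation e where "e \<equiv> pid n"

lemma D_part: "\<alpha> \<in> D \<Longrightarrow> \<alpha> \<in> partitions n" by (simp add: D_def)

lemma D_nc: "\<alpha> \<in> D \<Longrightarrow> noncrossing \<alpha>" by (simp add: D_def)

lemma D_mul [intro, simp]: "\<alpha> \<in> D \<Longrightarrow> \<beta> \<in> D \<Longrightarrow> \<alpha> \<cdot> \<beta> \<in> D"
  unfolding D_def using noncrossing_pprod small_blocks_pprod by simp

lemma D_star [simp]: "pstar \<alpha> \<in> D \<longleftrightarrow> \<alpha> \<in> D"
proof -
  have "pstar \<alpha> \<in> D" if "\<alpha> \<in> D" for \<alpha>
    using that noncrossing_pstar[of \<alpha> n] small_blocks_pstar[of \<alpha>] unfolding D_def by simp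
  from this[of \<alpha>] this[of "pstar \<alpha>"] show ?thesis by auto
qed

lemma D_assoc: "\<alpha> \<in> D \<Longrightarrow> \<beta> \<in> D \<Longrightarrow> \<gamma> \<in> D \<Longrightarrow> \<alpha> \<cdot> \<beta> \<cdot> \<gamma> = \<alpha> \<cdot> (\<beta> \<cdot> \<gamma>)"
  by (simp add: pprod_assoc D_part)

lemma prank_star [simp]: "\<alpha> \<in> D \<Longrightarrow> prank (pstar \<alpha>) = prank \<alpha>"
  by (rule prank_pstar[OF D_part])

lemma prank_left: "\<alpha> \<in> D \<Longrightarrow> prank (\<alpha> \<cdot> \<beta>) \<le> prank \<alpha>"
  by (simp add: prank_pprod_left D_part)

lemma prank_right: "\<beta> \<in> D \<Longrightarrow> prank (\<alpha> \<cdot> \<beta>) \<le> prank \<beta>"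
  by (simp add: prank_pprod_right D_part)

lemma prank_mid: "\<beta> \<in> D \<Longrightarrow> prank (\<alpha> \<cdot> \<beta> \<cdot> \<gamma>) \<le> prank \<beta>"
  using prank_pprod_left[of "\<alpha> \<cdot> \<beta>" n \<gamma>] prank_right[of \<beta> \<alpha>] by simp

lemma D_eqI:
  assumes "\<alpha> \<in> partitions n" "\<beta> \<in> partitions n"
    and "\<And>i j. linked \<alpha> (Upper i) (Upper j) \<longleftrightarrow> linked \<beta> (Upper i) (Upper j)"
    and "\<And>i j. linked \<alpha> (Upper i) (Lower j) \<longleftrightarrow> linked \<beta> (Upper i) (Lower j)"
    and "\<And>i j. linked \<alpha> (Lower i) (Lower j) \<longleftrightarrow> linked \<beta> (Lower i) (Lower j)"
  shows "\<alpha> = \<beta>"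
proof (rule partition_eqI[OF assms(1,2)])
  fix x y show "linked \<alpha> x y \<longleftrightarrow> linked \<beta> x y"
    using assms(3-5) linked_sym by (cases x; cases y) metis+
qed

lemma linked_U: "\<alpha> \<in> partitions n \<Longrightarrow> linked \<alpha> (Upper i) p \<Longrightarrow> i \<in> {1..n}"
  using linked_in_points(1)[of \<alpha> n "Upper i" p] by simp

lemma linked_L: "\<alpha> \<in> partitions n \<Longrightarrow> linked \<alpha> p (Lower i) \<Longrightarrow> i \<in> {1..n}"
  using linked_in_points(2)[of \<alpha> n p "Lower i"] by simp

lemma linked_UU: "\<alpha> \<in> partitions n \<Longrightarrow> linked \<alpha> (Upper i) (Upper j) \<Longrightarrow> i \<in> {1..n} \<and> j \<in> {1..n}"
  using linked_in_points[of \<alpha> n "Upper i" "Upper j"] by simp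

lemma linked_LL: "\<alpha> \<in> partitions n \<Longrightarrow> linked \<alpha> (Lower i) (Lower j) \<Longrightarrow> i \<in> {1..n} \<and> j \<in> {1..n}"
  using linked_in_points[of \<alpha> n "Lower i" "Lower j"] by simp

section \<open>Partial bijections and partial identities as diagrams\<close>

context
  fixes X g assumes X: "X \<subseteq> {1..n}" "g ` X \<subseteq> {1..n}" "strict_mono_on X g"
begin

lemma tie_ok_pinj: "tie_ok n (=) (\<lambda>i. if i \<in> X then Some (g i) else None)"
  unfolding tie_ok_def using X strict_mono_on_imp_inj_on[OF X(3)] by (auto dest: inj_onD)

lemma pinj_D [simp]: "pinj n X g \<in> D"
proof -
  have "noncrossing (pinj n X g)"
    unfolding pinj_def
    by (rule noncrossing_tie[OF tie_ok_pinj])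
       (use strict_mono_onD[OF X(3)] in \<open>auto split: if_splits intro: less_imp_le\<close>)
  moreover have "small_blocks (pinj n X g)"
    unfolding pinj_def by (rule small_blocks_tie[OF tie_ok_pinj]) auto
  ultimately show ?thesis unfolding D_def using tie_partitions[OF tie_ok_pinj] by (simp add: pinj_def)
qed

lemma linked_pinj:
  "linked (pinj n X g) (Upper i) (Upper j) \<longleftrightarrow> i \<in> {1..n} \<and> i = j"
  "linked (pinj n X g) (Upper i) (Lower j) \<longleftrightarrow> i \<in> X \<and> j = g i"
  "linked (pinj n X g) (Lower i) (Lower j) \<longleftrightarrow> i \<in> {1..n} \<and> i = j"
  unfolding pinj_def using X(1,2) by (auto simp: linked_tie[OF tie_ok_pinj] split: if_splits)

lemma linked_pinj_mul:
  assumes "\<alpha> \<in> partitions n"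
  shows "linked (pinj n X g \<cdot> \<alpha>) (Upper i) (Upper j) \<longleftrightarrow>
      i \<in> {1..n} \<and> j \<in> {1..n} \<and> (i = j \<or> i \<in> X \<and> j \<in> X \<and> linked \<alpha> (Upper (g i)) (Upper (g j)))"
    and "linked (pinj n X g \<cdot> \<alpha>) (Upper i) (Lower j) \<longleftrightarrow> i \<in> X \<and> linked \<alpha> (Upper (g i)) (Lower j)"
    and "linked (pinj n X g \<cdot> \<alpha>) (Lower i) (Lower j) \<longleftrightarrow> linked \<alpha> (Lower i) (Lower j)"
  unfolding pinj_def linked_tie_pprod[OF tie_ok_pinj assms] using X(1) by auto

lemma linked_mul_pinj:
  assumes "\<alpha> \<in> partitions n"
  shows "linked (\<alpha> \<cdot> pstar (pinj n X g)) (Upper i) (Upper j) \<longleftrightarrow> linked \<alpha> (Upper i) (Upper j)"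
    and "linked (\<alpha> \<cdot> pstar (pinj n X g)) (Upper i) (Lower j) \<longleftrightarrow> j \<in> X \<and> linked \<alpha> (Upper i) (Lower (g j))"
    and "linked (\<alpha> \<cdot> pstar (pinj n X g)) (Lower i) (Lower j) \<longleftrightarrow>
      i \<in> {1..n} \<and> j \<in> {1..n} \<and> (i = j \<or> i \<in> X \<and> j \<in> X \<and> linked \<alpha> (Lower (g i)) (Lower (g j)))"
proof -
  have *: "linked (\<alpha> \<cdot> pstar (pinj n X g)) x y \<longleftrightarrow> linked (pinj n X g \<cdot> pstar \<alpha>) (flip x) (flip y)" for x y
    using linked_pstar[of "pinj n X g \<cdot> pstar \<alpha>" x y] by (simp add: pstar_pprod)
  have p: "pstar \<alpha> \<in> partitions n" using assms by simp
  show "linked (\<alpha> \<cdot> pstar (pinj n X g)) (Upper i) (Upper j) \<longleftrightarrow> linked \<alpha> (Upper i) (Upper j)"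
    by (simp add: * linked_pinj_mul[OF p] linked_pstar)
  show "linked (\<alpha> \<cdot> pstar (pinj n X g)) (Upper i) (Lower j) \<longleftrightarrow> j \<in> X \<and> linked \<alpha> (Upper i) (Lower (g j))"
    unfolding * linked_sym[of _ "flip (Upper i)"]
    by (simp add: linked_pinj_mul[OF p] linked_pstar linked_sym[of \<alpha> "Lower (g j)"])
  show "linked (\<alpha> \<cdot> pstar (pinj n X g)) (Lower i) (Lower j) \<longleftrightarrow>
      i \<in> {1..n} \<and> j \<in> {1..n} \<and> (i = j \<or> i \<in> X \<and> j \<in> X \<and> linked \<alpha> (Lower (g i)) (Lower (g j)))"
    by (simp add: * linked_pinj_mul[OF p] linked_pstar)
qed

end

lemma pid_ok: "X \<subseteq> {1..n} \<Longrightarrow> (\<lambda>i. i) ` X \<subseteq> {1..n}" "strict_mono_on X (\<lambda>i::nat. i)"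
  by (auto intro: strict_mono_onI)

lemma pid_D [simp]: "X \<subseteq> {1..n} \<Longrightarrow> e X \<in> D"
  unfolding pid_def by (intro pinj_D pid_ok)

context
  fixes X assumes X: "X \<subseteq> {1..n}"
begin

lemmas linked_pid = linked_pinj[OF X pid_ok(1)[OF X] pid_ok(2), folded pid_def]

lemmas linked_pid_mul = linked_pinj_mul[OF X pid_ok(1)[OF X] pid_ok(2), folded pid_def]

end

lemma pid_star [simp]:
  assumes "X \<subseteq> {1..n}"
  shows "pstar (e X) = e X"
  by (rule D_eqI) (use assms in \<open>auto simp: D_part linked_pid linked_pstar linked_sym[of _ "Lower _" "Upper _"]\<close>)

lemma linked_mul_pid:
  assumes "X \<subseteq> {1..n}" "\<alpha> \<in> partitions n"
  shows "linked (\<alpha> \<cdot> e X) (Upper i) (Upper j) \<longleftrightarrow> linked \<alpha> (Upper i) (Upper j)"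
    and "linked (\<alpha> \<cdot> e X) (Upper i) (Lower j) \<longleftrightarrow> j \<in> X \<and> linked \<alpha> (Upper i) (Lower j)"
    and "linked (\<alpha> \<cdot> e X) (Lower i) (Lower j) \<longleftrightarrow>
      i \<in> {1..n} \<and> j \<in> {1..n} \<and> (i = j \<or> i \<in> X \<and> j \<in> X \<and> linked \<alpha> (Lower i) (Lower j))"
  using linked_mul_pinj[OF assms(1) pid_ok(1)[OF assms(1)] pid_ok(2) assms(2), folded pid_def] assms(1) by simp_all

lemma marked_pid: "X \<subseteq> {1..n} \<Longrightarrow> marked (e X) i \<longleftrightarrow> i \<in> X"
  by (simp add: marked_def linked_pid)

lemma prank_pid [simp]:
  assumes "X \<subseteq> {1..n}"
  shows "prank (e X) = card X"
proof (rule antisym)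
  have p: "e X \<in> partitions n" using assms by (simp add: D_part)
  have "indep (e X) X" using assms by (auto simp: indep_def marked_pid linked_pid)
  then show "card X \<le> prank (e X)" by (rule indep_card[OF p])
  obtain Z where Z: "indep (e X) Z" "card Z = prank (e X)"
    using indep_extend[OF p, of "{}"] by (auto simp: indep_def)
  have "Z \<subseteq> X"
    using Z(1) marked_pid[OF assms] unfolding indep_def by blast
  then show "prank (e X) \<le> card X"
    unfolding Z(2)[symmetric] using assms by (intro card_mono) (auto intro: finite_subset)
qed

lemma prank_le_n: "\<alpha> \<in> D \<Longrightarrow> prank \<alpha> \<le> n"
  using indep_extend[OF D_part, of \<alpha> "{}"] indep_range[OF D_part, of \<alpha>]
  by (metis card_atLeastAtMost card_mono diff_Suc_1 empty_iff finite_atLeastAtMost indep_def)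

lemma id_bar_eq:
  assumes "q \<le> n"
  shows "id_bar n q = e {1..q}"
proof -
  define Y where "Y = {1..q}"
  have X: "Y \<subseteq> {1..n}" and Y: "i \<in> Y \<longleftrightarrow> 1 \<le> i \<and> i \<le> q" for i using assms by (auto simp: Y_def)
  have up: "{y. linked (e Y) (Upper i) y} = (if i \<le> q then {Upper i, Lower i} else {Upper i})"
    if "i \<in> {1..n}" for i
  proof (unfold set_eq_iff, intro allI)
    fix y show "y \<in> {y. linked (e Y) (Upper i) y} \<longleftrightarrow> y \<in> (if i \<le> q then {Upper i, Lower i} else {Upper i})"
      using that by (cases y) (auto simp: linked_pid[OF X] Y)
  qed
  have lo: "{y. linked (e Y) (Lower i) y} = (if i \<le> q then {Upper i, Lower i} else {Lower i})"
    if "i \<in> {1..n}" for i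
  proof (unfold set_eq_iff, intro allI)
    fix y show "y \<in> {y. linked (e Y) (Lower i) y} \<longleftrightarrow> y \<in> (if i \<le> q then {Upper i, Lower i} else {Lower i})"
      using that by (cases y) (auto simp: linked_pid[OF X] linked_sym[of _ "Lower i" "Upper _"] Y)
  qed
  have "A \<in> e Y \<longleftrightarrow> A \<in> id_bar n q" for A
  proof -
    have "A \<in> e Y \<longleftrightarrow> (\<exists>i\<in>{1..n}. A = {y. linked (e Y) (Upper i) y}) \<or> (\<exists>i\<in>{1..n}. A = {y. linked (e Y) (Lower i) y})"
      unfolding mem_partition_iff[OF D_part[OF pid_D[OF X]]] by (auto simp: points_def)
    also have "\<dots> \<longleftrightarrow> (\<exists>i\<in>{1..n}. A = (if i \<le> q then {Upper i, Lower i} else {Upper i})) \<or>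
        (\<exists>i\<in>{1..n}. A = (if i \<le> q then {Upper i, Lower i} else {Lower i}))"
      by (intro arg_cong2[of _ _ _ _ "(\<or>)"] bex_cong refl) (simp_all only: up lo)
    also have "\<dots> \<longleftrightarrow> A \<in> id_bar n q"
    proof
      assume "(\<exists>i\<in>{1..n}. A = (if i \<le> q then {Upper i, Lower i} else {Upper i})) \<or>
        (\<exists>i\<in>{1..n}. A = (if i \<le> q then {Upper i, Lower i} else {Lower i}))"
      then show "A \<in> id_bar n q" unfolding id_bar_def by (auto split: if_splits)
    next
      assume "A \<in> id_bar n q"
      then consider i where "i \<in> {1..q}" "A = {Upper i, Lower i}" | i where "i \<in> {q<..n}" "A = {Upper i}"
        | i where "i \<in> {q<..n}" "A = {Lower i}"
        unfolding id_bar_def by blast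
      then show "(\<exists>i\<in>{1..n}. A = (if i \<le> q then {Upper i, Lower i} else {Upper i})) \<or>
        (\<exists>i\<in>{1..n}. A = (if i \<le> q then {Upper i, Lower i} else {Lower i}))"
      proof cases
        case (1 i) then show ?thesis using assms by (intro disjI1 bexI[of _ i]) auto
      next
        case (2 i) then show ?thesis by (intro disjI1 bexI[of _ i]) auto
      next
        case (3 i) then show ?thesis by (intro disjI2 bexI[of _ i]) auto
      qed
    qed
    finally show ?thesis .
  qed
  then show ?thesis unfolding Y_def by blast
qed

lemma one_mul [simp]:
  assumes "\<alpha> \<in> D"
  shows "e {1..n} \<cdot> \<alpha> = \<alpha>" "\<alpha> \<cdot> e {1..n} = \<alpha>"
proof -
  note p = D_part[OF assms]
  show "e {1..n} \<cdot> \<alpha> = \<alpha>"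
    by (rule D_eqI[OF _ p])
       (auto simp: linked_pid_mul p linked_refl[OF p] dest: linked_UU[OF p] linked_U[OF p])
  show "\<alpha> \<cdot> e {1..n} = \<alpha>"
    by (rule D_eqI[OF _ p])
       (auto simp: linked_mul_pid p linked_refl[OF p] dest: linked_LL[OF p] linked_L[OF p])
qed

text \<open>If \<open>x < y\<close> but \<open>a y < a x\<close>, the points \<open>x\<close>,
  \<open>y\<close>, \<open>a x\<close>, \<open>a y\<close> follow each other clockwise and the two
  transversals cross; equal partners would put \<open>x\<close> and \<open>y\<close> into one
  block.\<close>

lemma partner_strict_mono:
  assumes "\<alpha> \<in> D" "indep \<alpha> X" "\<And>x. x \<in> X \<Longrightarrow> linked \<alpha> (Upper x) (Lower (a x))"
  shows "strict_mono_on X a"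
proof (rule strict_mono_onI, rule ccontr)
  fix x y assume xy: "x \<in> X" "y \<in> X" "x < y" and "\<not> a x < a y"
  note l = assms(3)[OF xy(1)] assms(3)[OF xy(2)]
  consider "a x = a y" | "a y < a x" using \<open>\<not> a x < a y\<close> by linarith
  then have "linked \<alpha> (Upper x) (Upper y)"
  proof cases
    case 1
    then show ?thesis using l linked_sym linked_trans[OF D_part[OF assms(1)]] by metis
  next
    case 2
    then show ?thesis by (intro noncrossingD[OF D_nc[OF assms(1)] l]) (use xy in auto)
  qed
  then show False using assms(2) xy unfolding indep_def by blast
qed

lemma ex_partners:
  assumes "indep \<alpha> X"
  obtains a where "\<And>x. x \<in> X \<Longrightarrow> linked \<alpha> (Upper x) (Lower (a x))"
  using assms unfolding indep_def marked_def by metis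

text \<open>As many transversals of \<alpha> as \<beta> has are selected and relabelled by
  representatives \<open>B\<close> of the transversals of \<beta>; this turns \<alpha> into the
  partial identity on \<open>B\<close>, through which \<beta> factors. Both outer factors contain
  \<beta>, so the case of equal \<alpha> and \<beta> gives regularity as well as the order of the
  \<open>J\<close>-classes.\<close>

lemma J_factor:
  assumes \<alpha>: "\<alpha> \<in> D" and \<beta>: "\<beta> \<in> D" and le: "prank \<beta> \<le> prank \<alpha>"
  shows "\<exists>u\<in>D. \<exists>v\<in>D. \<beta> = (\<beta> \<cdot> u) \<cdot> \<alpha> \<cdot> (v \<cdot> \<beta>)"
proof -
  note p\<beta> = D_part[OF \<beta>] and p\<alpha> = D_part[OF \<alpha>]
  obtain A where A: "indep \<alpha> A" "card A = prank \<alpha>"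
    using indep_extend[OF p\<alpha>, of "{}"] by (auto simp: indep_def)
  obtain A1 where A1: "A1 \<subseteq> A" "card A1 = prank \<beta>" "finite A1"
    using obtain_subset_with_card_n[of "prank \<beta>" A] le A(2) by metis
  have iA1: "indep \<alpha> A1" by (rule indep_subset[OF A(1) A1(1)])
  obtain B where B: "indep \<beta> B" "card B = prank \<beta>"
    using indep_extend[OF p\<beta>, of "{}"] by (auto simp: indep_def)
  obtain a where a: "\<And>x. x \<in> A1 \<Longrightarrow> linked \<alpha> (Upper x) (Lower (a x))" using ex_partners[OF iA1] by blast
  obtain b where b: "\<And>x. x \<in> B \<Longrightarrow> linked \<beta> (Upper x) (Lower (b x))" using ex_partners[OF B(1)] by blast
  obtain m where m: "bij_betw m B A1" "strict_mono_on B m"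
    using ex_strict_mono_bij[OF indep_finite[OF p\<beta> B(1)] A1(3)] B(2) A1(2) by metis
  have mB: "m ` B = A1" using m(1) by (rule bij_betw_imp_surj_on)
  have mA: "m x \<in> A1" if "x \<in> B" for x using mB that by blast
  have rB: "B \<subseteq> {1..n}" by (rule indep_range[OF p\<beta> B(1)])
  have rm: "m ` B \<subseteq> {1..n}" unfolding mB by (rule indep_range[OF p\<alpha> iA1])
  have rb: "b ` B \<subseteq> {1..n}" using b linked_L[OF p\<beta>] by blast
  have ram: "(\<lambda>x. a (m x)) ` B \<subseteq> {1..n}" using a[OF mA] linked_L[OF p\<alpha>] by blast
  have sb: "strict_mono_on B b" by (rule partner_strict_mono[OF \<beta> B(1) b])
  have sam: "strict_mono_on B (\<lambda>x. a (m x))"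
    using partner_strict_mono[OF \<alpha> iA1 a] m(2) mA unfolding strict_mono_on_def by blast
  let ?b = "pinj n B b" and ?m = "pinj n B m" and ?am = "pinj n B (\<lambda>x. a (m x))"
  have inB: "x = y" if "x \<in> B" "y \<in> B" "linked \<beta> (Upper x) (Upper y)" for x y
    using B(1) that unfolding indep_def by blast
  have inA: "x = y" if "x \<in> B" "y \<in> B" "linked \<alpha> (Upper (m x)) (Upper (m y))" for x y
  proof -
    have "m x = m y" using iA1 mA that unfolding indep_def by blast
    then show ?thesis using bij_betw_imp_inj_on[OF m(1)] that by (simp add: inj_on_eq_iff)
  qed
  have t\<alpha>: "linked \<alpha> x y \<Longrightarrow> linked \<alpha> y z \<Longrightarrow> linked \<alpha> x z" for x y z by (rule linked_trans[OF p\<alpha>])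
  have t\<beta>: "linked \<beta> x y \<Longrightarrow> linked \<beta> y z \<Longrightarrow> linked \<beta> x z" for x y z by (rule linked_trans[OF p\<beta>])
  have s\<alpha>: "linked \<alpha> x y \<Longrightarrow> linked \<alpha> y x" and s\<beta>: "linked \<beta> x y \<Longrightarrow> linked \<beta> y x" for x y
    using linked_sym by blast+
  \<comment> \<open>On the selected transversals \<open>?m\<close> relabels the upper ends and
    \<open>?am\<close> the lower ends, both by \<open>B\<close>.\<close>
  have mid: "?m \<cdot> \<alpha> \<cdot> pstar ?am = e B"
  proof (rule D_eqI)
    fix i j
    show "linked (?m \<cdot> \<alpha> \<cdot> pstar ?am) (Upper i) (Upper j) \<longleftrightarrow> linked (e B) (Upper i) (Upper j)"
      using inA[of i j] by (auto simp: linked_mul_pinj[OF rB ram sam] linked_pinj_mul[OF rB rm m(2) p\<alpha>] linked_pid[OF rB])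
    have "linked \<alpha> (Upper (m i)) (Lower (a (m j))) \<longleftrightarrow> i = j" if "i \<in> B" "j \<in> B"
    proof
      assume "linked \<alpha> (Upper (m i)) (Lower (a (m j)))"
      then have "linked \<alpha> (Upper (m i)) (Upper (m j))" using a[OF mA[OF that(2)]] t\<alpha> s\<alpha> by blast
      then show "i = j" by (rule inA[OF that])
    qed (use a[OF mA] that in auto)
    then show "linked (?m \<cdot> \<alpha> \<cdot> pstar ?am) (Upper i) (Lower j) \<longleftrightarrow> linked (e B) (Upper i) (Lower j)"
      by (auto simp: linked_mul_pinj[OF rB ram sam] linked_pinj_mul[OF rB rm m(2) p\<alpha>] linked_pid[OF rB])
    have "i = j" if "i \<in> B" "j \<in> B" "linked \<alpha> (Lower (a (m i))) (Lower (a (m j)))"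
      using inA[OF that(1,2)] a[OF mA[OF that(1)]] a[OF mA[OF that(2)]] that(3) t\<alpha> s\<alpha> by blast
    then show "linked (?m \<cdot> \<alpha> \<cdot> pstar ?am) (Lower i) (Lower j) \<longleftrightarrow> linked (e B) (Lower i) (Lower j)"
      by (auto simp: linked_mul_pinj[OF rB ram sam] linked_pinj_mul[OF rB rm m(2) p\<alpha>] linked_pid[OF rB])
  qed (use rB in \<open>simp_all add: D_part\<close>)
  \<comment> \<open>\<open>f\<close> maps each transversal of \<beta> to its representative in
    \<open>B\<close>; together with \<open>?\<kappa>\<close> it describes the upper half of
    \<beta>.\<close>
  define f where "f i = (if \<exists>x\<in>B. linked \<beta> (Upper i) (Upper x) then Some (SOME x. x \<in> B \<and> linked \<beta> (Upper i) (Upper x)) else None)" for i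
  have f: "f i = Some x \<longleftrightarrow> x \<in> B \<and> linked \<beta> (Upper i) (Upper x)" for i x
  proof
    assume fi: "f i = Some x"
    then have "\<exists>x. x \<in> B \<and> linked \<beta> (Upper i) (Upper x)" by (auto simp: f_def split: if_splits)
    from someI_ex[OF this] show "x \<in> B \<and> linked \<beta> (Upper i) (Upper x)"
      using fi by (auto simp: f_def split: if_splits)
  next
    assume x: "x \<in> B \<and> linked \<beta> (Upper i) (Upper x)"
    then have "(SOME x. x \<in> B \<and> linked \<beta> (Upper i) (Upper x)) = x"
      by (intro some_equality) (use inB t\<beta> s\<beta> in blast)+
    then show "f i = Some x" using x by (auto simp: f_def)
  qed
  let ?\<kappa> = "\<lambda>i j. linked \<beta> (Upper i) (Upper j)"
  have f_cong: "f i = f j" if "?\<kappa> i j" for i j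
  proof -
    have *: "f i = Some x \<longleftrightarrow> f j = Some x" for x unfolding f using that t\<beta> s\<beta> by blast
    show ?thesis using *[of "the (f i)"] *[of "the (f j)"] by (cases "f i"; cases "f j") simp_all
  qed
  have f_inj: "?\<kappa> i j" if "f i = Some x" "f j = Some x" for i j x
    using that t\<beta> s\<beta> unfolding f by blast
  have ok: "tie_ok n ?\<kappa> f"
    unfolding tie_ok_def
  proof (intro conjI ballI impI allI)
    show "?\<kappa> i i" if "i \<in> {1..n}" for i using that linked_refl[OF p\<beta>] by simp
    show "?\<kappa> j i" if "?\<kappa> i j" for i j by (rule s\<beta>[OF that])
    show "?\<kappa> i k" if "?\<kappa> i j" "?\<kappa> j k" for i j k by (rule t\<beta>[OF that])
    show "f i = f j" if "?\<kappa> i j" for i j by (rule f_cong[OF that])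
    show "?\<kappa> i j" if "f i \<noteq> None" "f i = f j" for i j using that f_inj by (cases "f i") auto
    show "z \<in> {1..n}" if "f i = Some z" for i z using that rB unfolding f by blast
  qed
  \<comment> \<open>Restricting the lower row to the chosen ends of the transversals, and
    relabelling these by \<open>B\<close>, leaves only the upper half of \<beta>.\<close>
  have \<tau>: "\<beta> \<cdot> pstar ?b = tie n ?\<kappa> f"
  proof (rule D_eqI)
    fix i j
    show "linked (\<beta> \<cdot> pstar ?b) (Upper i) (Upper j) \<longleftrightarrow> linked (tie n ?\<kappa> f) (Upper i) (Upper j)"
      using linked_in_points[OF p\<beta>, of "Upper i" "Upper j"]
      by (auto simp: linked_mul_pinj[OF rB rb sb p\<beta>] linked_tie[OF ok])
    have "linked \<beta> (Upper i) (Lower (b j)) \<longleftrightarrow> ?\<kappa> i j" if "j \<in> B"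
      using b[OF that] t\<beta> s\<beta> by blast
    then show "linked (\<beta> \<cdot> pstar ?b) (Upper i) (Lower j) \<longleftrightarrow> linked (tie n ?\<kappa> f) (Upper i) (Lower j)"
      using rB linked_U[OF p\<beta>, of i "Upper j"]
      by (auto simp: linked_mul_pinj[OF rB rb sb p\<beta>] linked_tie[OF ok] f)
    have "i = j" if "i \<in> B" "j \<in> B" "linked \<beta> (Lower (b i)) (Lower (b j))"
      using inB[OF that(1,2)] b[OF that(1)] b[OF that(2)] that(3) t\<beta> s\<beta> by blast
    then show "linked (\<beta> \<cdot> pstar ?b) (Lower i) (Lower j) \<longleftrightarrow> linked (tie n ?\<kappa> f) (Lower i) (Lower j)"
      by (auto simp: linked_mul_pinj[OF rB rb sb p\<beta>] linked_tie[OF ok])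
  qed (simp_all add: tie_partitions[OF ok])
  have pe: "e B \<cdot> \<beta> \<in> partitions n" by simp
  have "tie n ?\<kappa> f \<cdot> (e B \<cdot> \<beta>) = \<beta>"
  proof (rule D_eqI[OF _ p\<beta>])
    fix i j
    show "linked (tie n ?\<kappa> f \<cdot> (e B \<cdot> \<beta>)) (Upper i) (Upper j) \<longleftrightarrow> linked \<beta> (Upper i) (Upper j)"
      unfolding linked_tie_pprod[OF ok pe] linked_pid_mul[OF rB p\<beta>] f
      using linked_U[OF p\<beta>, of i "Upper j"] linked_U[OF p\<beta>, of j "Upper i"] s\<beta> t\<beta> by blast
    have "\<exists>x. x \<in> B \<and> linked \<beta> (Upper i) (Upper x) \<and> linked \<beta> (Upper x) (Lower j)" if l: "linked \<beta> (Upper i) (Lower j)"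
    proof -
      have "marked \<beta> i" using l unfolding marked_def by blast
      then obtain x where "x \<in> B" "linked \<beta> (Upper i) (Upper x)" using indep_cover[OF p\<beta> B] by blast
      then show ?thesis using l t\<beta> s\<beta> by blast
    qed
    then show "linked (tie n ?\<kappa> f \<cdot> (e B \<cdot> \<beta>)) (Upper i) (Lower j) \<longleftrightarrow> linked \<beta> (Upper i) (Lower j)"
      unfolding linked_tie_pprod[OF ok pe] linked_pid_mul[OF rB p\<beta>] f
      using linked_U[OF p\<beta>, of i "Lower j"] t\<beta> by blast
    show "linked (tie n ?\<kappa> f \<cdot> (e B \<cdot> \<beta>)) (Lower i) (Lower j) \<longleftrightarrow> linked \<beta> (Lower i) (Lower j)"
      unfolding linked_tie_pprod[OF ok pe] linked_pid_mul[OF rB p\<beta>] ..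
  qed simp
  then have "\<beta> = \<beta> \<cdot> pstar ?b \<cdot> (?m \<cdot> \<alpha> \<cdot> pstar ?am \<cdot> \<beta>)" unfolding \<tau> mid by simp
  moreover have mD: "?b \<in> D" "?m \<in> D" "?am \<in> D"
    using rB rb sb rm m(2) ram sam by simp_all
  ultimately have "\<beta> = (\<beta> \<cdot> (pstar ?b \<cdot> ?m)) \<cdot> \<alpha> \<cdot> (pstar ?am \<cdot> \<beta>)"
    using \<alpha> \<beta> by (simp add: D_assoc)
  moreover have "pstar ?b \<cdot> ?m \<in> D" "pstar ?am \<in> D" using mD by simp_all
  ultimately show ?thesis by blast
qed

lemma J_below:
  assumes "\<alpha> \<in> D" "\<beta> \<in> D" "prank \<beta> \<le> prank \<alpha>"
  shows "\<exists>u\<in>D. \<exists>v\<in>D. \<beta> = u \<cdot> \<alpha> \<cdot> v"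
  using J_factor[OF assms] assms(2) D_mul by meson

lemma D_regular:
  assumes "\<alpha> \<in> D"
  shows "\<exists>\<beta>\<in>D. \<alpha> \<cdot> \<beta> \<cdot> \<alpha> = \<alpha>"
proof -
  obtain u v where uv: "u \<in> D" "v \<in> D" "\<alpha> = (\<alpha> \<cdot> u) \<cdot> \<alpha> \<cdot> (v \<cdot> \<alpha>)"
    using J_factor[OF assms assms] by blast
  have "\<alpha> \<cdot> (u \<cdot> \<alpha> \<cdot> v) \<cdot> \<alpha> = (\<alpha> \<cdot> u) \<cdot> \<alpha> \<cdot> (v \<cdot> \<alpha>)" using assms uv(1,2) by (simp add: D_assoc)
  then have "\<alpha> \<cdot> (u \<cdot> \<alpha> \<cdot> v) \<cdot> \<alpha> = \<alpha>" using uv(3) by simp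
  moreover have "u \<cdot> \<alpha> \<cdot> v \<in> D" using assms uv by simp
  ultimately show ?thesis by blast
qed


declare one_mul [simplified, simp]

subsection \<open>Separating diagrams of equal rank\<close>

text \<open>The shape left after cutting with \<open>e X\<close> on the left and \<open>e Y\<close>
  on the right.\<close>

definition confined :: "point set set \<Rightarrow> nat set \<Rightarrow> nat set \<Rightarrow> bool" where
  "confined \<gamma> X Y \<longleftrightarrow> (\<forall>i j. linked \<gamma> (Upper i) (Lower j) \<longrightarrow> i \<in> X \<and> j \<in> Y) \<and>
     (\<forall>i j. linked \<gamma> (Upper i) (Upper j) \<longrightarrow> i = j \<or> i \<in> X \<and> j \<in> X) \<and>
     (\<forall>i j. linked \<gamma> (Lower i) (Lower j) \<longrightarrow> i = j \<or> i \<in> Y \<and> j \<in> Y)"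

lemma confinedD:
  assumes "confined \<gamma> X Y"
  shows "linked \<gamma> (Upper i) (Lower j) \<Longrightarrow> i \<in> X" "linked \<gamma> (Upper i) (Lower j) \<Longrightarrow> j \<in> Y"
    "linked \<gamma> (Upper i) (Upper j) \<Longrightarrow> i = j \<or> i \<in> X \<and> j \<in> X"
    "linked \<gamma> (Lower i) (Lower j) \<Longrightarrow> i = j \<or> i \<in> Y \<and> j \<in> Y"
  using assms by (simp_all add: confined_def)

text \<open>A maximum independent set lies inside \<open>X\<close> and has as many elements, hence
  is \<open>X\<close>.\<close>

lemma full_indep:
  assumes "\<gamma> \<in> D" "\<And>i. marked \<gamma> i \<Longrightarrow> i \<in> X" "finite X" "card X = prank \<gamma>"
  shows "indep \<gamma> X"
proof -
  obtain Z where Z: "indep \<gamma> Z" "card Z = prank \<gamma>"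
    using indep_extend[OF D_part[OF assms(1)], of "{}"] by (auto simp: indep_def)
  have "Z \<subseteq> X" using Z(1) assms(2) by (auto simp: indep_def)
  then have "Z = X" using card_subset_eq[OF assms(3)] Z(2) assms(4) by simp
  then show ?thesis using Z(1) by simp
qed

lemma rigid_map:
  assumes \<gamma>: "\<gamma> \<in> D" "confined \<gamma> X Y" and fin: "finite X" "finite Y"
    and card: "card X = prank \<gamma>" "card Y = prank \<gamma>"
  obtains g where "bij_betw g X Y" "strict_mono_on X g"
    "\<forall>i j. linked \<gamma> (Upper i) (Lower j) \<longleftrightarrow> i \<in> X \<and> j = g i"
    "indep \<gamma> X" "indep (pstar \<gamma>) Y"
proof -
  note inX = confinedD(1)[OF \<gamma>(2)] and inY = confinedD(2)[OF \<gamma>(2)]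
  have iX: "indep \<gamma> X"
    by (rule full_indep[OF \<gamma>(1) _ fin(1) card(1)]) (use inX in \<open>auto simp: marked_def\<close>)
  have iY: "indep (pstar \<gamma>) Y"
    by (rule full_indep) (use \<gamma>(1) fin card inY in \<open>auto simp: marked_pstar\<close>)
  obtain g where g: "\<And>x. x \<in> X \<Longrightarrow> linked \<gamma> (Upper x) (Lower (g x))" using ex_partners[OF iX] by blast
  have mono: "strict_mono_on X g" by (rule partner_strict_mono[OF \<gamma>(1) iX g])
  have inj: "inj_on g X" by (rule strict_mono_on_imp_inj_on[OF mono])
  have "g ` X \<subseteq> Y" using g inY by blast
  then have "g ` X = Y" using card_image[OF inj] card fin(2) by (intro card_subset_eq) auto
  then have bij: "bij_betw g X Y" using inj by (simp add: bij_betw_def)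
  have iff: "\<forall>i j. linked \<gamma> (Upper i) (Lower j) \<longleftrightarrow> i \<in> X \<and> j = g i"
  proof (intro allI iffI)
    fix i j
    assume l: "linked \<gamma> (Upper i) (Lower j)"
    have i: "i \<in> X" by (rule inX[OF l])
    have "linked \<gamma> (Lower j) (Lower (g i))"
      using l g[OF i] linked_sym linked_trans[OF D_part[OF \<gamma>(1)]] by meson
    then have "linked (pstar \<gamma>) (Upper j) (Upper (g i))" by (simp add: linked_pstar)
    moreover have "j \<in> Y" "g i \<in> Y" using inY[OF l] inY[OF g[OF i]] .
    ultimately have "j = g i" using iY unfolding indep_def by blast
    then show "i \<in> X \<and> j = g i" using i by blast
  next
    show "linked \<gamma> (Upper i) (Lower j)" if "i \<in> X \<and> j = g i" for i j
      using g[of i] that by simp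
  qed
  show ?thesis by (rule that[OF bij mono iff iX iY])
qed

text \<open>With rank \<open>card X = card Y\<close>, each point of \<open>X\<close> and of
  \<open>Y\<close> lies on a transversal of its own. No other links remain, and planarity makes the
  transversals the increasing bijection from \<open>X\<close> to \<open>Y\<close>, which is
  unique.\<close>

lemma rigid:
  assumes \<gamma>: "\<gamma> \<in> D" "confined \<gamma> X Y" and \<delta>: "\<delta> \<in> D" "confined \<delta> X Y"
    and fin: "finite X" "finite Y"
    and card: "card X = prank \<gamma>" "card Y = prank \<gamma>" "prank \<delta> = prank \<gamma>"
  shows "\<gamma> = \<delta>"
proof -
  obtain g where g: "bij_betw g X Y" "strict_mono_on X g"
    "\<forall>i j. linked \<gamma> (Upper i) (Lower j) \<longleftrightarrow> i \<in> X \<and> j = g i" and g_ind: "indep \<gamma> X" "indep (pstar \<gamma>) Y"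
    by (rule rigid_map[OF \<gamma> fin card(1,2)])
  have c: "card X = prank \<delta>" "card Y = prank \<delta>" using card by simp_all
  obtain h where h: "bij_betw h X Y" "strict_mono_on X h"
    "\<forall>i j. linked \<delta> (Upper i) (Lower j) \<longleftrightarrow> i \<in> X \<and> j = h i" and h_ind: "indep \<delta> X" "indep (pstar \<delta>) Y"
    by (rule rigid_map[OF \<delta> fin c])
  have gh: "g x = h x" if "x \<in> X" for x
    by (rule strict_mono_on_bij_unique[OF fin(1) g(1,2) h(1,2) that])
  have UU: "linked \<epsilon> (Upper i) (Upper j) \<longleftrightarrow> i \<in> {1..n} \<and> i = j"
    if "\<epsilon> \<in> D" "confined \<epsilon> X Y" "indep \<epsilon> X" for \<epsilon> i j
  proof
    assume l: "linked \<epsilon> (Upper i) (Upper j)"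
    then have "i = j \<or> i \<in> X \<and> j \<in> X" by (rule confinedD(3)[OF that(2)])
    then have "i = j" using that(3) l unfolding indep_def by blast
    then show "i \<in> {1..n} \<and> i = j" using linked_UU[OF D_part[OF that(1)] l] by blast
  qed (use linked_refl[OF D_part[OF that(1)]] in simp)
  have LL: "linked \<epsilon> (Lower i) (Lower j) \<longleftrightarrow> i \<in> {1..n} \<and> i = j"
    if "\<epsilon> \<in> D" "confined \<epsilon> X Y" "indep (pstar \<epsilon>) Y" for \<epsilon> i j
  proof
    assume l: "linked \<epsilon> (Lower i) (Lower j)"
    then have "i = j \<or> i \<in> Y \<and> j \<in> Y" by (rule confinedD(4)[OF that(2)])
    moreover have "linked (pstar \<epsilon>) (Upper i) (Upper j)" using l by (simp add: linked_pstar)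
    ultimately have "i = j" using that(3) unfolding indep_def by blast
    then show "i \<in> {1..n} \<and> i = j" using linked_LL[OF D_part[OF that(1)] l] by blast
  qed (use linked_refl[OF D_part[OF that(1)]] in simp)
  show ?thesis
  proof (rule D_eqI[OF D_part[OF \<gamma>(1)] D_part[OF \<delta>(1)]])
    fix i j
    show "linked \<gamma> (Upper i) (Upper j) \<longleftrightarrow> linked \<delta> (Upper i) (Upper j)"
      using UU[OF \<gamma> g_ind(1)] UU[OF \<delta> h_ind(1)] by simp
    show "linked \<gamma> (Upper i) (Lower j) \<longleftrightarrow> linked \<delta> (Upper i) (Lower j)"
      unfolding g(3)[rule_format] h(3)[rule_format] using gh by auto
    show "linked \<gamma> (Lower i) (Lower j) \<longleftrightarrow> linked \<delta> (Lower i) (Lower j)"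
      using LL[OF \<gamma> g_ind(2)] LL[OF \<delta> h_ind(2)] by simp
  qed
qed

lemma linked_cut:
  assumes "\<alpha> \<in> D" "X \<subseteq> {1..n}" "Y \<subseteq> {1..n}"
  shows "linked (e X \<cdot> \<alpha> \<cdot> e Y) (Upper i) (Upper j) \<longleftrightarrow>
      i \<in> {1..n} \<and> j \<in> {1..n} \<and> (i = j \<or> i \<in> X \<and> j \<in> X \<and> linked \<alpha> (Upper i) (Upper j))"
    "linked (e X \<cdot> \<alpha> \<cdot> e Y) (Upper i) (Lower j) \<longleftrightarrow> i \<in> X \<and> j \<in> Y \<and> linked \<alpha> (Upper i) (Lower j)"
    "linked (e X \<cdot> \<alpha> \<cdot> e Y) (Lower i) (Lower j) \<longleftrightarrow>
      i \<in> {1..n} \<and> j \<in> {1..n} \<and> (i = j \<or> i \<in> Y \<and> j \<in> Y \<and> linked \<alpha> (Lower i) (Lower j))"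
  using linked_mul_pid[OF assms(3) pprod_partitions, of "e X" \<alpha>] linked_pid_mul[OF assms(2) D_part[OF assms(1)]]
  by auto

lemma confined_cut:
  assumes "\<alpha> \<in> D" "X \<subseteq> {1..n}" "Y \<subseteq> {1..n}"
  shows "confined (e X \<cdot> \<alpha> \<cdot> e Y) X Y"
  unfolding confined_def linked_cut[OF assms] by blast

lemma prank_cut_partners:
  assumes \<alpha>: "\<alpha> \<in> D" "indep \<alpha> X" and a: "\<And>x. x \<in> X \<Longrightarrow> linked \<alpha> (Upper x) (Lower (a x))"
  shows "prank (e X \<cdot> \<alpha> \<cdot> e (a ` X)) = card X"
proof (rule antisym)
  have X: "X \<subseteq> {1..n}" by (rule indep_range[OF D_part[OF \<alpha>(1)] \<alpha>(2)])
  have Y: "a ` X \<subseteq> {1..n}" using a linked_L[OF D_part[OF \<alpha>(1)]] by blast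
  show "prank (e X \<cdot> \<alpha> \<cdot> e (a ` X)) \<le> card X"
    using prank_left[of "e X \<cdot> \<alpha>" "e (a ` X)"] prank_left[of "e X" \<alpha>] X \<alpha>(1) by simp
  have "indep (e X \<cdot> \<alpha> \<cdot> e (a ` X)) X"
    unfolding indep_def
  proof (intro conjI ballI impI)
    show "marked (e X \<cdot> \<alpha> \<cdot> e (a ` X)) x" if "x \<in> X" for x
      unfolding marked_def using linked_cut(2)[OF \<alpha>(1) X Y, of x "a x"] a[OF that] that by blast
    show "x = y" if "x \<in> X" "y \<in> X" "linked (e X \<cdot> \<alpha> \<cdot> e (a ` X)) (Upper x) (Upper y)" for x y
      using that(3) \<alpha>(2) that(1,2) unfolding linked_cut[OF \<alpha>(1) X Y] indep_def by blast
  qed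
  then show "card X \<le> prank (e X \<cdot> \<alpha> \<cdot> e (a ` X))"
    by (rule indep_card[OF pprod_partitions])
qed

text \<open>\<alpha> is cut down to a full system of transversals through the given link, which
  keeps its rank. By \<open>same\<close> the cut of \<beta> has the same rank, so the two cuts
  coincide by rigidity and \<beta> has the link too.\<close>

lemma linked_transversal_transfer:
  assumes \<alpha>: "\<alpha> \<in> D" and \<beta>: "\<beta> \<in> D" and rank: "prank \<alpha> = prank \<beta>"
    and same: "\<And>s t. s \<in> D \<Longrightarrow> t \<in> D \<Longrightarrow> prank (s \<cdot> \<alpha> \<cdot> t) = prank \<alpha> \<Longrightarrow> prank (s \<cdot> \<beta> \<cdot> t) = prank \<alpha>"
    and l: "linked \<alpha> (Upper x) (Lower y)"
  shows "linked \<beta> (Upper x) (Lower y)"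
proof -
  have "indep \<alpha> {x}" using l unfolding indep_def marked_def by blast
  then obtain X where X: "{x} \<subseteq> X" "indep \<alpha> X" "card X = prank \<alpha>"
    by (rule indep_extend[OF D_part[OF \<alpha>]])
  obtain a0 where a0: "\<And>x. x \<in> X \<Longrightarrow> linked \<alpha> (Upper x) (Lower (a0 x))" using ex_partners[OF X(2)] by blast
  \<comment> \<open>The partner of \<open>x\<close> is forced to be \<open>y\<close>, so that the
    given link survives the cut.\<close>
  define a where "a = a0(x := y)"
  have a: "linked \<alpha> (Upper z) (Lower (a z))" if "z \<in> X" for z
    using a0[OF that] l by (simp add: a_def)
  let ?Y = "a ` X"
  have rX: "X \<subseteq> {1..n}" by (rule indep_range[OF D_part[OF \<alpha>] X(2)])
  have rY: "?Y \<subseteq> {1..n}" using a linked_L[OF D_part[OF \<alpha>]] by blast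
  have ra: "prank (e X \<cdot> \<alpha> \<cdot> e ?Y) = card X" by (rule prank_cut_partners[OF \<alpha> X(2) a])
  then have rb: "prank (e X \<cdot> \<beta> \<cdot> e ?Y) = prank \<alpha>"
    using same[of "e X" "e ?Y"] rX rY X(3) by simp
  have "inj_on a X" by (rule strict_mono_on_imp_inj_on[OF partner_strict_mono[OF \<alpha> X(2) a]])
  then have cY: "card ?Y = card X" by (rule card_image)
  have fin: "finite X" "finite ?Y" using indep_finite[OF D_part[OF \<alpha>] X(2)] by auto
  have "e X \<cdot> \<alpha> \<cdot> e ?Y = e X \<cdot> \<beta> \<cdot> e ?Y"
    by (rule rigid[OF _ confined_cut[OF \<alpha> rX rY] _ confined_cut[OF \<beta> rX rY] fin])
       (use ra rb cY X(3) rX rY \<alpha> \<beta> in simp_all)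
  moreover have "linked (e X \<cdot> \<alpha> \<cdot> e ?Y) (Upper x) (Lower y)"
    unfolding linked_cut[OF \<alpha> rX rY] using l X(1) by (auto simp: a_def)
  ultimately have "linked (e X \<cdot> \<beta> \<cdot> e ?Y) (Upper x) (Lower y)" by simp
  then show ?thesis unfolding linked_cut[OF \<beta> rX rY] by blast
qed

text \<open>Vertical strands at the points of \<open>W\<close> and one lower block
  \<open>{q, z}\<close>; the condition \<open>gap\<close> below keeps the strands from crossing that
  block.\<close>

fun cup_rel :: "nat set \<Rightarrow> nat \<Rightarrow> nat \<Rightarrow> point \<Rightarrow> point \<Rightarrow> bool" where
  "cup_rel W q z (Upper i) (Upper j) \<longleftrightarrow> i = j"
| "cup_rel W q z (Upper i) (Lower j) \<longleftrightarrow> i = j \<and> i \<in> W"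
| "cup_rel W q z (Lower i) (Upper j) \<longleftrightarrow> i = j \<and> i \<in> W"
| "cup_rel W q z (Lower i) (Lower j) \<longleftrightarrow> i = j \<or> i = q \<and> j = z \<or> i = z \<and> j = q"

definition cup :: "nat set \<Rightarrow> nat \<Rightarrow> nat \<Rightarrow> point set set" where
  "cup W q z = partition_of n (cup_rel W q z)"

context
  fixes W :: "nat set" and q z :: nat
  assumes W: "q \<notin> W" "z \<notin> W" "q \<noteq> z"
    and gap: "\<And>w. w \<in> W \<Longrightarrow> \<not> (q < w \<and> w < z) \<and> \<not> (z < w \<and> w < q)"
begin

lemma equiv_cup: "equiv (points n) {(x, y) \<in> points n \<times> points n. cup_rel W q z x y}"
proof (intro equivI refl_onI symI transI)
  show "(x, x) \<in> {(x, y) \<in> points n \<times> points n. cup_rel W q z x y}" if "x \<in> points n" for x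
    using that by (cases x) auto
  show "(y, x) \<in> {(x, y) \<in> points n \<times> points n. cup_rel W q z x y}"
    if "(x, y) \<in> {(x, y) \<in> points n \<times> points n. cup_rel W q z x y}" for x y
    using that by (cases x; cases y) auto
  show "(x, w) \<in> {(x, y) \<in> points n \<times> points n. cup_rel W q z x y}"
    if "(x, y) \<in> {(x, y) \<in> points n \<times> points n. cup_rel W q z x y}"
      "(y, w) \<in> {(x, y) \<in> points n \<times> points n. cup_rel W q z x y}" for x y w
    using that W by (cases x; cases y; cases w) auto
qed auto

lemma linked_cup: "linked (cup W q z) x y \<longleftrightarrow> x \<in> points n \<and> y \<in> points n \<and> cup_rel W q z x y"
  unfolding cup_def by (rule linked_partition_of[OF equiv_cup])

lemma cup_D: "cup W q z \<in> D"
proof -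
  have "noncrossing (cup W q z)"
    unfolding noncrossing_def
  proof (intro allI impI)
    fix a b c d
    assume o: "pless a b" "pless b c" "pless c d"
      and l: "linked (cup W q z) a c" "linked (cup W q z) b d"
    have t: "cup_rel W q z a c" "cup_rel W q z b d" using l by (simp_all add: linked_cup)
    have False
    proof (cases b)
      case b: (Upper j)
      then obtain i where a: "a = Upper i" using o by (cases a) auto
      then obtain k where "c = Lower k" using t o b by (cases c) auto
      then show False using o t a b by (cases d) auto
    next
      case b: (Lower j)
      then obtain k l where "c = Lower k" "d = Lower l" using o by (cases c; cases d) auto
      then show False using o t b gap W by (cases a) auto
    qed
    then show "linked (cup W q z) a b" ..
  qed
  moreover have "small_blocks (cup W q z)"
    unfolding small_blocks_def
  proof (intro allI impI)
    fix x y w assume "linked (cup W q z) x y" "linked (cup W q z) x w"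
    then have "cup_rel W q z x y" "cup_rel W q z x w" by (simp_all add: linked_cup)
    then show "x = y \<or> x = w \<or> y = w" using W by (cases x; cases y; cases w) auto
  qed
  moreover have "cup W q z \<in> partitions n"
    unfolding cup_def by (rule partition_of_partitions[OF equiv_cup])
  ultimately show ?thesis by (simp add: D_def)
qed

end

text \<open>If \<open>p\<close> and \<open>q\<close> lie in one non-transversal upper block and \<open>z\<close> in a transversal one, then a
  left factor with a lower block \<open>{q', z'}\<close> reroutes the transversal of \<open>z\<close> to \<open>p\<close>.\<close>

lemma cup_separates:
  assumes \<alpha>: "\<alpha> \<in> D" and \<beta>: "\<beta> \<in> D" and rank: "prank \<alpha> = prank \<beta>"
    and UL: "\<And>i j. linked \<alpha> (Upper i) (Lower j) \<longleftrightarrow> linked \<beta> (Upper i) (Lower j)"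
    and pq: "linked \<alpha> (Upper p) (Upper q)" "p \<noteq> q" "\<not> marked \<alpha> p" "\<not> linked \<beta> (Upper q) (Upper p)"
    and z: "marked \<alpha> z" and gap: "\<And>w. marked \<alpha> w \<or> w = p \<Longrightarrow> \<not> (q < w \<and> w < z) \<and> \<not> (z < w \<and> w < q)"
  shows "\<exists>s\<in>D. prank (s \<cdot> \<alpha>) = prank \<alpha> \<and> prank (s \<cdot> \<beta>) < prank \<alpha>"
proof -
  note p\<alpha> = D_part[OF \<alpha>] and p\<beta> = D_part[OF \<beta>]
  have t\<alpha>: "linked \<alpha> x y \<Longrightarrow> linked \<alpha> y z \<Longrightarrow> linked \<alpha> x z" for x y z by (rule linked_trans[OF p\<alpha>])
  have s\<alpha>: "linked \<alpha> x y \<Longrightarrow> linked \<alpha> y x" and s\<beta>: "linked \<beta> x y \<Longrightarrow> linked \<beta> y x" for x y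
    using linked_sym by blast+
  have mk: "marked \<beta> i \<longleftrightarrow> marked \<alpha> i" for i using UL by (simp add: marked_def)
  have unm: "\<not> marked \<alpha> i" if "linked \<alpha> (Upper i) (Upper p)" for i
    using marked_cong[OF p\<alpha> s\<alpha>[OF that]] pq(3) by blast
  have unm\<beta>: "\<not> marked \<alpha> i" if "linked \<beta> (Upper i) (Upper p)" for i
    using marked_cong[OF p\<beta> s\<beta>[OF that]] pq(3) mk by blast
  have q: "\<not> marked \<alpha> q" by (rule unm[OF s\<alpha>[OF pq(1)]])
  have "indep \<alpha> {z}" using z by (simp add: indep_def)
  then obtain X where X: "{z} \<subseteq> X" "indep \<alpha> X" "card X = prank \<alpha>" by (rule indep_extend[OF p\<alpha>])
  have mX: "marked \<alpha> x" if "x \<in> X" for x using X(2) that by (simp add: indep_def)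
  have fin: "finite X" by (rule indep_finite[OF p\<alpha> X(2)])
  \<comment> \<open>\<open>p\<close> takes over from \<open>z\<close>, so \<open>W\<close> has as
    many points as \<alpha> has transversals. The strand at \<open>p\<close> reaches the transversal
    of \<open>z\<close> through the block of \<open>p\<close> and \<open>q\<close> and then the
    lower block \<open>{q, z}\<close>.\<close>
  define W where "W = insert p (X - {z})"
  have pX: "p \<notin> X" using mX pq(3) by blast
  have cW: "card W = prank \<alpha>"
    using pX card_Suc_Diff1[OF fin, of z] fin X(1,3) by (simp add: W_def del: card_Diff_insert card_Diff_singleton)
  have W: "q \<notin> W" "z \<notin> W" "q \<noteq> z"
    using q pq(2,3) mX z unfolding W_def by auto
  have gapW: "\<not> (q < w \<and> w < z) \<and> \<not> (z < w \<and> w < q)" if "w \<in> W" for w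
    using that gap[of w] mX[of w] unfolding W_def by blast
  let ?s = "cup W q z"
  have sD: "?s \<in> D" by (rule cup_D[OF W gapW])
  note lk = linked_cup[OF W gapW]
  have pqz: "p \<in> {1..n}" "q \<in> {1..n}" "z \<in> {1..n}"
    using linked_UU[OF p\<alpha> pq(1)] marked_range[OF p\<alpha> z] by auto
  have rW: "i \<in> {1..n}" if "i \<in> W" for i
    using that pqz marked_range[OF p\<alpha> mX, of i] unfolding W_def by auto
  have straight: "joined ?s \<gamma> (Inl (Upper i)) (Inr i)" if "i \<in> W" for i \<gamma>
  proof -
    have "linked ?s (Upper i) (Lower i)" using that rW[OF that] by (simp add: lk)
    from joined_leftI[OF this] show ?thesis by simp
  qed
  have bend: "joined ?s \<gamma> (Inr q) (Inr z)" for \<gamma>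
  proof -
    have "linked ?s (Lower q) (Lower z)" using pqz by (simp add: lk)
    from joined_leftI[OF this] show ?thesis by simp
  qed
  define Q where "Q p = {y. linked \<alpha> p y}" for p
  have QI: "Q x = Q y" if "linked \<alpha> x y" for x y
    using that s\<alpha> t\<alpha> unfolding Q_def by blast
  have QD: "linked \<alpha> x y" if "Q x = Q y" "y \<in> points n" for x y
    using that linked_refl[OF p\<alpha>] unfolding Q_def by blast
  \<comment> \<open>The block of a middle point in \<alpha>, with the block of \<open>p\<close>
    identified with the transversal of \<open>z\<close>; this makes the values at \<open>q\<close>
    and \<open>z\<close> equal.\<close>
  define R where "R i = Q (Upper (if linked \<alpha> (Upper i) (Upper p) then z else i))" for i
  define lab where "lab u = (case u of Inl (Upper i) \<Rightarrow> if i \<in> W then Some (R i) else None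
      | Inl (Lower j) \<Rightarrow> Some (Q (Lower j)) | Inr i \<Rightarrow> Some (R i))" for u
  have Rqz: "R q = R z"
    using pq(1) s\<alpha> unm[of z] z by (auto simp: R_def)
  have lab: "lab (Inl x) = lab (Inl y)" if "linked (?s \<cdot> \<alpha>) x y" for x y
  proof (rule linked_pprod_label[OF that])
    fix x y assume "linked ?s x y"
    then have "cup_rel W q z x y" "x \<in> points n" "y \<in> points n" by (simp_all add: lk)
    moreover have "R j = R i" if "i = q \<and> j = z \<or> i = z \<and> j = q" for i j using that Rqz by auto
    ultimately show "lab (lower_to_middle x) = lab (lower_to_middle y)"
      by (cases x; cases y) (auto simp: lab_def)
  next
    fix x y assume l: "linked \<alpha> x y"
    have UU: "R i = R j" if "linked \<alpha> (Upper i) (Upper j)" for i j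
    proof -
      have "linked \<alpha> (Upper i) (Upper p) \<longleftrightarrow> linked \<alpha> (Upper j) (Upper p)" using that s\<alpha> t\<alpha> by blast
      then show ?thesis using QI[OF that] by (simp add: R_def)
    qed
    have UL: "R i = Q (Lower j)" if "linked \<alpha> (Upper i) (Lower j)" for i j
    proof -
      have "marked \<alpha> i" using that unfolding marked_def by blast
      then have "\<not> linked \<alpha> (Upper i) (Upper p)" using unm by blast
      then show ?thesis using QI[OF that] by (simp add: R_def)
    qed
    show "lab (upper_to_middle x) = lab (upper_to_middle y)"
    proof (cases x)
      case x: (Upper i)
      show ?thesis
      proof (cases y)
        case (Upper j)
        then show ?thesis using UU[of i j] l x by (simp add: lab_def)
      next
        case (Lower j)
        then show ?thesis using UL[of i j] l x by (simp add: lab_def)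
      qed
    next
      case x: (Lower i)
      show ?thesis
      proof (cases y)
        case (Upper j)
        then show ?thesis using UL[of j i] s\<alpha>[OF l] x by (simp add: lab_def)
      next
        case (Lower j)
        then show ?thesis using QI[OF l] x by (simp add: lab_def)
      qed
    qed
  qed
  have "indep (?s \<cdot> \<alpha>) W"
    unfolding indep_def
  proof (intro conjI ballI impI)
    fix i assume i: "i \<in> W"
    show "marked (?s \<cdot> \<alpha>) i"
    proof (cases "i = p")
      case True
      obtain j where j: "linked \<alpha> (Upper z) (Lower j)" using z unfolding marked_def by blast
      have 1: "joined ?s \<alpha> (Inl (Upper p)) (Inr p)" using straight[OF i] True by simp
      have 2: "joined ?s \<alpha> (Inr p) (Inr q)" using joined_rightI[OF pq(1), of ?s] by simp
      have 3: "joined ?s \<alpha> (Inr z) (Inl (Lower j))" using joined_rightI[OF j, of ?s] by simp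
      have "joined ?s \<alpha> (Inl (Upper p)) (Inl (Lower j))"
        by (rule rtrancl_trans[OF 1 rtrancl_trans[OF 2 rtrancl_trans[OF bend 3]]])
      then show ?thesis
        using True pqz(1) linked_in_points(2)[OF p\<alpha> j] unfolding marked_def by (auto simp: linked_pprod)
    next
      case False
      then obtain j where j: "linked \<alpha> (Upper i) (Lower j)"
        using i mX[of i] unfolding W_def marked_def by blast
      have "joined ?s \<alpha> (Inr i) (Inl (Lower j))" using joined_rightI[OF j, of ?s] by simp
      then have "joined ?s \<alpha> (Inl (Upper i)) (Inl (Lower j))" by (rule rtrancl_trans[OF straight[OF i]])
      then show ?thesis
        using rW[OF i] linked_in_points(2)[OF p\<alpha> j] unfolding marked_def by (auto simp: linked_pprod)
    qed
  next
    fix i j assume ij: "i \<in> W" "j \<in> W" and l: "linked (?s \<cdot> \<alpha>) (Upper i) (Upper j)"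
    have R: "R i = R j" using lab[OF l] ij by (simp add: lab_def)
    define k where "k i = (if i = p then z else i)" for i
    have k: "R i = Q (Upper (k i))" "k i \<in> X" if "i \<in> W" for i
    proof -
      have "linked \<alpha> (Upper p) (Upper p)" using linked_refl[OF p\<alpha>] pqz(1) by simp
      moreover have "i = p \<or> marked \<alpha> i" using that mX[of i] unfolding W_def by blast
      ultimately have "linked \<alpha> (Upper i) (Upper p) \<longleftrightarrow> i = p" using unm[of i] by blast
      then show "R i = Q (Upper (k i))" by (simp add: R_def k_def)
      show "k i \<in> X" using that X(1) by (auto simp: k_def W_def)
    qed
    have "Q (Upper (k i)) = Q (Upper (k j))" using R k ij by simp
    moreover have "Upper (k j) \<in> points n" using marked_range[OF p\<alpha> mX[OF k(2)[OF ij(2)]]] by simp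
    ultimately have "linked \<alpha> (Upper (k i)) (Upper (k j))" by (rule QD)
    then have "k i = k j" using X(2) k(2) ij unfolding indep_def by blast
    then show "i = j" using ij unfolding k_def W_def by (auto split: if_splits)
  qed
  then have "card W \<le> prank (?s \<cdot> \<alpha>)" by (rule indep_card[OF pprod_partitions])
  then have 1: "prank (?s \<cdot> \<alpha>) = prank \<alpha>" using cW prank_right[OF \<alpha>, of ?s] by simp
  obtain V where V: "indep (?s \<cdot> \<beta>) V" "card V = prank (?s \<cdot> \<beta>)"
    using indep_extend[OF pprod_partitions, of n ?s \<beta> "{}"] by (auto simp: indep_def)
  have VW: "V \<subseteq> W"
  proof
    fix i assume "i \<in> V"
    then have "marked (?s \<cdot> \<beta>) i" using V(1) by (simp add: indep_def)
    then have "marked ?s i" by (rule marked_pprod[OF D_part[OF sD]])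
    then show "i \<in> W" by (auto simp: marked_def lk)
  qed
  \<comment> \<open>In \<beta> the block of \<open>p\<close> is not transversal and contains neither
    \<open>q\<close> nor \<open>z\<close>, so the strand entering at \<open>p\<close> ends there.
    This costs one transversal.\<close>
  have "\<not> linked (?s \<cdot> \<beta>) (Upper p) (Lower j)" for j
  proof
    assume l: "linked (?s \<cdot> \<beta>) (Upper p) (Lower j)"
    define lb where "lb u = (case u of Inl (Upper i) \<Rightarrow> i = p | Inl (Lower j) \<Rightarrow> False
        | Inr i \<Rightarrow> linked \<beta> (Upper i) (Upper p))" for u
    have "lb (Inl (Upper p)) = lb (Inl (Lower j))"
    proof (rule linked_pprod_label[OF l])
      fix x y assume "linked ?s x y"
      then have "cup_rel W q z x y" by (simp add: lk)
      moreover have "linked \<beta> (Upper i) (Upper p) \<longleftrightarrow> i = p" if "i \<in> W" for i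
      proof -
        have "linked \<beta> (Upper p) (Upper p)" using linked_refl[OF p\<beta>] pqz(1) by simp
        moreover have "i = p \<or> marked \<alpha> i" using that mX[of i] unfolding W_def by blast
        ultimately show ?thesis using unm\<beta>[of i] by blast
      qed
      moreover have "\<not> linked \<beta> (Upper z) (Upper p)" using unm\<beta>[of z] z by blast
      ultimately show "lb (lower_to_middle x) = lb (lower_to_middle y)"
        using pq(4) by (cases x; cases y) (auto simp: lb_def)
    next
      fix x y assume xy: "linked \<beta> x y"
      have "lb (upper_to_middle w) \<longleftrightarrow> linked \<beta> w (Upper p)" for w
      proof (cases w)
        case (Lower k)
        have "\<not> linked \<beta> (Upper p) (Lower k)" using pq(3) mk[of p] unfolding marked_def by blast
        then show ?thesis using Lower s\<beta> by (auto simp: lb_def)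
      qed (simp add: lb_def)
      then show "lb (upper_to_middle x) = lb (upper_to_middle y)"
        using xy s\<beta> linked_trans[OF p\<beta>] by blast
    qed
    then show False by (simp add: lb_def)
  qed
  then have "p \<notin> V" using V(1) unfolding indep_def marked_def by blast
  then have "V \<subseteq> W - {p}" using VW by blast
  moreover have "finite W" using fin by (simp add: W_def)
  ultimately have "card V \<le> card (W - {p})" by (intro card_mono) auto
  also have "\<dots> < card W" using \<open>finite W\<close> by (intro psubset_card_mono) (auto simp: W_def)
  finally have "prank (?s \<cdot> \<beta>) < prank \<alpha>" using V(2) cW by simp
  then show ?thesis using 1 sD by blast
qed

text \<open>Links on transversals follow from \<open>UL\<close>. For a non-transversal pair
  \<open>a < b\<close> a marked point \<open>z\<close> must be bent to one of its ends without an
  obstacle: the next marked point to the right of \<open>b\<close> serves, with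
  \<open>q = b\<close>. If there is none, the last marked point serves with \<open>q = a\<close>; it
  lies left of \<open>a\<close>, since a transversal between \<open>a\<close> and \<open>b\<close>
  would cross their block.\<close>

lemma linked_upper_transfer:
  assumes \<alpha>: "\<alpha> \<in> D" and \<beta>: "\<beta> \<in> D" and rank: "prank \<alpha> = prank \<beta>" "1 \<le> prank \<alpha>"
    and UL: "\<And>i j. linked \<alpha> (Upper i) (Lower j) \<longleftrightarrow> linked \<beta> (Upper i) (Lower j)"
    and same: "\<And>s. s \<in> D \<Longrightarrow> prank (s \<cdot> \<alpha>) = prank \<alpha> \<Longrightarrow> prank (s \<cdot> \<beta>) = prank \<alpha>"
    and l: "linked \<alpha> (Upper i) (Upper j)"
  shows "linked \<beta> (Upper i) (Upper j)"
proof -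
  note p\<alpha> = D_part[OF \<alpha>] and p\<beta> = D_part[OF \<beta>]
  have sep: "linked \<beta> (Upper q) (Upper p)"
    if "linked \<alpha> (Upper p) (Upper q)" "p \<noteq> q" "\<not> marked \<alpha> p" "marked \<alpha> z"
      "\<And>w. marked \<alpha> w \<or> w = p \<Longrightarrow> \<not> (q < w \<and> w < z) \<and> \<not> (z < w \<and> w < q)" for p q z
    using cup_separates[OF \<alpha> \<beta> rank(1) UL that(1-3) _ that(4,5)] same by (metis less_irrefl)
  have lt: "linked \<beta> (Upper a) (Upper b)"
    if l: "linked \<alpha> (Upper a) (Upper b)" and "a < b" and a: "\<not> marked \<alpha> a" for a b
  proof -
    have b: "\<not> marked \<alpha> b" using marked_cong[OF p\<alpha> l] a by blast
    have between: "\<not> marked \<alpha> w" if "a < w" "w < b" for w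
    proof
      assume "marked \<alpha> w"
      then obtain j where "linked \<alpha> (Upper w) (Lower j)" unfolding marked_def by blast
      then have "linked \<alpha> (Upper a) (Upper w)"
        by (intro noncrossingD[OF D_nc[OF \<alpha>] l]) (use that in auto)
      then show False using marked_cong[OF p\<alpha>] a \<open>marked \<alpha> w\<close> by blast
    qed
    have "\<exists>z. marked \<alpha> z" using prank_0_iff[OF p\<alpha>] rank(2) by auto
    then obtain z0 where z0: "marked \<alpha> z0" by blast
    show ?thesis
    proof (cases "\<exists>z>b. marked \<alpha> z")
      case True
      define z where "z = (LEAST z. b < z \<and> marked \<alpha> z)"
      have z: "b < z" "marked \<alpha> z"
        using LeastI_ex[of "\<lambda>z. b < z \<and> marked \<alpha> z"] True unfolding z_def by blast+
      have "\<not> (b < w \<and> w < z)" if "marked \<alpha> w" for w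
        using not_less_Least[of w "\<lambda>z. b < z \<and> marked \<alpha> z"] that unfolding z_def by blast
      then have "linked \<beta> (Upper b) (Upper a)"
        using z \<open>a < b\<close> by (intro sep[OF l _ a z(2)]) auto
      then show ?thesis using linked_sym by blast
    next
      case False
      have below: "w < a" if "marked \<alpha> w" for w
        using that between[of w] False a b by (metis linorder_neqE_nat)
      define z where "z = Max {w. marked \<alpha> w}"
      have fin: "finite {w. marked \<alpha> w}"
        by (rule finite_subset[of _ "{1..n}"]) (use marked_range[OF p\<alpha>] in auto)
      have z: "marked \<alpha> z" using Max_in[OF fin] z0 unfolding z_def by blast
      have zmax: "w \<le> z" if "marked \<alpha> w" for w using Max_ge[OF fin] that unfolding z_def by blast
      have l': "linked \<alpha> (Upper b) (Upper a)" using l linked_sym by blast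
      show ?thesis
      proof (rule sep[OF l' _ b z])
        show "b \<noteq> a" using \<open>a < b\<close> by simp
        show "\<not> (a < w \<and> w < z) \<and> \<not> (z < w \<and> w < a)" if "marked \<alpha> w \<or> w = b" for w
          using that
        proof
          assume "marked \<alpha> w"
          then show ?thesis using zmax[of w] below[of w] by linarith
        next
          assume "w = b"
          then show ?thesis using \<open>a < b\<close> below[OF z] by linarith
        qed
      qed
    qed
  qed
  show ?thesis
  proof (cases "marked \<alpha> i")
    case True
    then obtain k where k: "linked \<alpha> (Upper i) (Lower k)" unfolding marked_def by blast
    then have "linked \<alpha> (Upper j) (Lower k)" using l linked_sym linked_trans[OF p\<alpha>] by meson
    then show ?thesis using k UL linked_sym linked_trans[OF p\<beta>] by meson
  next
    case False
    consider "i = j" | "i < j" | "j < i" by linarith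
    then show ?thesis
    proof cases
      case 1
      then show ?thesis using linked_UU[OF p\<alpha> l] linked_refl[OF p\<beta>] by simp
    next
      case 2
      then show ?thesis using lt[OF l] False by blast
    next
      case 3
      have l': "linked \<alpha> (Upper j) (Upper i)" using l linked_sym by blast
      have "\<not> marked \<alpha> j" using marked_cong[OF p\<alpha> l] False by blast
      then show ?thesis using lt[OF l' 3] linked_sym by blast
    qed
  qed
qed

text \<open>Two-sided cuts detect transversal links, left factors detect upper links, and mirroring
  gives the lower links. At rank 0 all multiples have rank 0 and the criterion says nothing.\<close>

lemma rank_determines:
  assumes \<alpha>: "\<alpha> \<in> D" and \<beta>: "\<beta> \<in> D" and rank: "prank \<alpha> = prank \<beta>" "1 \<le> prank \<alpha>"
    and same: "\<And>s t. s \<in> D \<Longrightarrow> t \<in> D \<Longrightarrow> prank (s \<cdot> \<alpha> \<cdot> t) = prank \<alpha> \<longleftrightarrow> prank (s \<cdot> \<beta> \<cdot> t) = prank \<alpha>"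
  shows "\<alpha> = \<beta>"
proof -
  have one: "{1..n} \<subseteq> {1..n}" by simp
  have UL: "linked \<alpha> (Upper i) (Lower j) \<longleftrightarrow> linked \<beta> (Upper i) (Lower j)" for i j
    using linked_transversal_transfer[OF \<alpha> \<beta> rank(1), of i j]
      linked_transversal_transfer[OF \<beta> \<alpha> rank(1)[symmetric], of i j] same rank(1) by auto
  have left: "prank (s \<cdot> \<alpha>) = prank \<alpha> \<longleftrightarrow> prank (s \<cdot> \<beta>) = prank \<alpha>" if "s \<in> D" for s
    using same[OF that pid_D[OF one]] \<alpha> \<beta> that by simp
  have right: "prank (s \<cdot> pstar \<alpha>) = prank \<alpha> \<longleftrightarrow> prank (s \<cdot> pstar \<beta>) = prank \<alpha>" if "s \<in> D" for s
  proof -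
    have "prank (pstar (\<alpha> \<cdot> pstar s)) = prank \<alpha> \<longleftrightarrow> prank (pstar (\<beta> \<cdot> pstar s)) = prank \<alpha>"
      using same[OF pid_D[OF one], of "pstar s"] \<alpha> \<beta> that by simp
    then show ?thesis by (simp add: pstar_pprod)
  qed
  have UL': "linked (pstar \<alpha>) (Upper i) (Lower j) \<longleftrightarrow> linked (pstar \<beta>) (Upper i) (Lower j)" for i j
    unfolding linked_pstar flip.simps using UL[of j i] linked_sym by blast
  have s: "pstar \<alpha> \<in> D" "pstar \<beta> \<in> D" "prank (pstar \<alpha>) = prank (pstar \<beta>)" "1 \<le> prank (pstar \<alpha>)"
    using \<alpha> \<beta> rank by simp_all
  show ?thesis
  proof (rule D_eqI[OF D_part[OF \<alpha>] D_part[OF \<beta>]])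
    fix i j
    show "linked \<alpha> (Upper i) (Upper j) \<longleftrightarrow> linked \<beta> (Upper i) (Upper j)"
      using linked_upper_transfer[OF \<alpha> \<beta> rank UL, of i j]
        linked_upper_transfer[OF \<beta> \<alpha> rank(1)[symmetric] _ UL[symmetric], of i j] left rank by auto
    have "linked (pstar \<alpha>) (Upper i) (Upper j) \<longleftrightarrow> linked (pstar \<beta>) (Upper i) (Upper j)"
      using linked_upper_transfer[OF s UL', of i j]
        linked_upper_transfer[OF s(2,1) s(3)[symmetric] _ UL'[symmetric], of i j] right rank \<alpha> \<beta> by auto
    then show "linked \<alpha> (Lower i) (Lower j) \<longleftrightarrow> linked \<beta> (Lower i) (Lower j)"
      by (simp add: linked_pstar)
  qed (rule UL)
qed


subsection \<open>Diagrams of rank at most one\<close>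

text \<open>On rank 0 this is Green's relation \<open>R\<close>, and \<open>same_lo\<close> is
  \<open>L\<close>; see \<open>green_R_iff\<close> and \<open>green_L_iff\<close>.\<close>

definition same_up :: "point set set \<Rightarrow> point set set \<Rightarrow> bool" where
  "same_up \<alpha> \<beta> \<longleftrightarrow> (\<forall>i j. linked \<alpha> (Upper i) (Upper j) \<longleftrightarrow> linked \<beta> (Upper i) (Upper j))"

definition same_lo :: "point set set \<Rightarrow> point set set \<Rightarrow> bool" where
  "same_lo \<alpha> \<beta> \<longleftrightarrow> (\<forall>i j. linked \<alpha> (Lower i) (Lower j) \<longleftrightarrow> linked \<beta> (Lower i) (Lower j))"

lemma same_up_refl [simp]: "same_up \<alpha> \<alpha>" and same_lo_refl [simp]: "same_lo \<alpha> \<alpha>"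
  by (simp_all add: same_up_def same_lo_def)

lemma same_up_sym: "same_up \<alpha> \<beta> \<Longrightarrow> same_up \<beta> \<alpha>" and same_lo_sym: "same_lo \<alpha> \<beta> \<Longrightarrow> same_lo \<beta> \<alpha>"
  by (simp_all add: same_up_def same_lo_def)

lemma same_up_trans: "same_up \<alpha> \<beta> \<Longrightarrow> same_up \<beta> \<gamma> \<Longrightarrow> same_up \<alpha> \<gamma>"
  and same_lo_trans: "same_lo \<alpha> \<beta> \<Longrightarrow> same_lo \<beta> \<gamma> \<Longrightarrow> same_lo \<alpha> \<gamma>"
  by (simp_all add: same_up_def same_lo_def)

lemma same_star [simp]: "same_up (pstar \<alpha>) (pstar \<beta>) \<longleftrightarrow> same_lo \<alpha> \<beta>"
  "same_lo (pstar \<alpha>) (pstar \<beta>) \<longleftrightarrow> same_up \<alpha> \<beta>"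
  by (simp_all add: same_up_def same_lo_def linked_pstar)

lemma same_up_mul: "\<alpha> \<in> D \<Longrightarrow> prank \<alpha> \<le> 1 \<Longrightarrow> same_up (\<alpha> \<cdot> \<beta>) \<alpha>"
  unfolding same_up_def by (simp add: linked_pprod_rank_1 D_part)

lemma same_lo_mul:
  assumes "\<beta> \<in> D" "prank \<beta> \<le> 1"
  shows "same_lo (\<alpha> \<cdot> \<beta>) \<beta>"
proof -
  have "same_up (pstar (\<alpha> \<cdot> \<beta>)) (pstar \<beta>)"
    unfolding pstar_pprod using assms by (intro same_up_mul) simp_all
  then show ?thesis by simp
qed

lemma no_transversal: "\<alpha> \<in> D \<Longrightarrow> prank \<alpha> = 0 \<Longrightarrow> \<not> linked \<alpha> (Upper i) (Lower j)"
  using prank_0_iff[OF D_part] unfolding marked_def by blast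

lemma rank_0_eqI:
  assumes "\<alpha> \<in> D" "\<beta> \<in> D" "prank \<alpha> = 0" "prank \<beta> = 0" "same_up \<alpha> \<beta>" "same_lo \<alpha> \<beta>"
  shows "\<alpha> = \<beta>"
  by (rule D_eqI) (use assms no_transversal in \<open>auto simp: D_part same_up_def same_lo_def\<close>)

abbreviation z0 where "z0 \<equiv> e {}"

lemma z0_D [simp]: "z0 \<in> D" and prank_z0 [simp]: "prank z0 = 0"
  by simp_all

lemma prank_mul_0: "\<alpha> \<in> D \<Longrightarrow> \<beta> \<in> D \<Longrightarrow> prank \<alpha> = 0 \<or> prank \<beta> = 0 \<Longrightarrow> prank (\<alpha> \<cdot> \<beta>) = 0"
  using prank_left[of \<alpha> \<beta>] prank_right[of \<beta> \<alpha>] by auto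

text \<open>\<open>z0\<close> consists of singletons. In the middle it cuts all transversals,
  leaving the upper pattern of the first factor and the lower pattern of the last.\<close>

definition retr :: "point set set \<Rightarrow> point set set" where
  "retr \<alpha> = \<alpha> \<cdot> z0 \<cdot> \<alpha>"

lemma retr_D [simp]: "\<alpha> \<in> D \<Longrightarrow> retr \<alpha> \<in> D" by (simp add: retr_def)

lemma prank_retr [simp]: "\<alpha> \<in> D \<Longrightarrow> prank (retr \<alpha>) = 0"
  unfolding retr_def by (intro prank_mul_0) (auto intro: prank_mul_0)

lemma same_up_retr: "\<alpha> \<in> D \<Longrightarrow> prank \<alpha> \<le> 1 \<Longrightarrow> same_up (retr \<alpha>) \<alpha>"
  unfolding retr_def by (simp add: D_assoc same_up_mul)

lemma same_lo_retr: "\<alpha> \<in> D \<Longrightarrow> prank \<alpha> \<le> 1 \<Longrightarrow> same_lo (retr \<alpha>) \<alpha>"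
  unfolding retr_def by (simp add: same_lo_mul)

lemma retr_unique:
  assumes "\<alpha> \<in> D" "prank \<alpha> \<le> 1" "\<beta> \<in> D" "prank \<beta> = 0" "same_up \<beta> \<alpha>" "same_lo \<beta> \<alpha>"
  shows "\<beta> = retr \<alpha>"
  by (rule rank_0_eqI)
     (use assms same_up_trans[OF assms(5) same_up_sym[OF same_up_retr[OF assms(1,2)]]]
        same_lo_trans[OF assms(6) same_lo_sym[OF same_lo_retr[OF assms(1,2)]]] in simp_all)

lemma retr_0: "\<alpha> \<in> D \<Longrightarrow> prank \<alpha> = 0 \<Longrightarrow> retr \<alpha> = \<alpha>"
  using retr_unique[of \<alpha> \<alpha>] by simp

text \<open>\<alpha> times \<open>z0\<close> depends only on the upper pattern of \<alpha>, and
  multiplying \<open>s\<close> \<alpha> by \<open>z0\<close> on the right keeps its upper pattern,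
  as its rank is still at most 1.\<close>

lemma same_up_left:
  assumes "\<alpha> \<in> D" "\<beta> \<in> D" "s \<in> D" "prank \<alpha> \<le> 1" "prank \<beta> \<le> 1" "same_up \<alpha> \<beta>"
  shows "same_up (s \<cdot> \<alpha>) (s \<cdot> \<beta>)"
proof -
  have eq: "\<alpha> \<cdot> z0 = \<beta> \<cdot> z0"
  proof (rule rank_0_eqI)
    show "same_up (\<alpha> \<cdot> z0) (\<beta> \<cdot> z0)"
      using assms same_up_mul same_up_trans same_up_sym by meson
    have "same_lo (\<gamma> \<cdot> z0) z0" for \<gamma> by (rule same_lo_mul) simp_all
    then show "same_lo (\<alpha> \<cdot> z0) (\<beta> \<cdot> z0)" using same_lo_trans same_lo_sym by meson
  qed (use assms in \<open>auto intro: prank_mul_0\<close>)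
  have *: "same_up (s \<cdot> \<gamma>) (s \<cdot> (\<gamma> \<cdot> z0))" if "\<gamma> \<in> D" "prank \<gamma> \<le> 1" for \<gamma>
  proof -
    have "prank (s \<cdot> \<gamma>) \<le> 1" using prank_right[OF that(1), of s] that(2) by simp
    then have "same_up (s \<cdot> \<gamma> \<cdot> z0) (s \<cdot> \<gamma>)" using assms(3) that(1) by (intro same_up_mul) simp_all
    then show ?thesis using assms(3) that(1) by (simp add: D_assoc same_up_sym)
  qed
  show ?thesis
    by (rule same_up_trans[OF *[OF assms(1,4), unfolded eq] same_up_sym[OF *[OF assms(2,5)]]])
qed

lemma same_lo_right:
  assumes "\<alpha> \<in> D" "\<beta> \<in> D" "s \<in> D" "prank \<alpha> \<le> 1" "prank \<beta> \<le> 1" "same_lo \<alpha> \<beta>"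
  shows "same_lo (\<alpha> \<cdot> s) (\<beta> \<cdot> s)"
  using same_up_left[of "pstar \<alpha>" "pstar \<beta>" "pstar s"] assms
  by (simp add: pstar_pprod[symmetric])

lemma same_mul:
  assumes "\<alpha> \<in> D" "\<beta> \<in> D" "s \<in> D" "prank \<alpha> \<le> 1" "prank \<beta> \<le> 1"
  shows "same_up (\<alpha> \<cdot> s) (\<beta> \<cdot> s) \<longleftrightarrow> same_up \<alpha> \<beta>" "same_lo (s \<cdot> \<alpha>) (s \<cdot> \<beta>) \<longleftrightarrow> same_lo \<alpha> \<beta>"
proof -
  show "same_up (\<alpha> \<cdot> s) (\<beta> \<cdot> s) \<longleftrightarrow> same_up \<alpha> \<beta>"
    using same_up_mul[OF assms(1,4), of s] same_up_mul[OF assms(2,5), of s] same_up_trans same_up_sym by meson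
  show "same_lo (s \<cdot> \<alpha>) (s \<cdot> \<beta>) \<longleftrightarrow> same_lo \<alpha> \<beta>"
    using same_lo_mul[OF assms(1,4), of s] same_lo_mul[OF assms(2,5), of s] same_lo_trans same_lo_sym by meson
qed

subsection \<open>The congruences\<close>

definition is_cong :: "point set set rel \<Rightarrow> bool" where
  "is_cong \<xi> \<longleftrightarrow> equiv D \<xi> \<and> (\<forall>(x, y) \<in> \<xi>. \<forall>s \<in> D. (s \<cdot> x, s \<cdot> y) \<in> \<xi> \<and> (x \<cdot> s, y \<cdot> s) \<in> \<xi>)"

text \<open>A common form for all congruences: \<open>u\<close> and \<open>l\<close> say which
  patterns must agree, and \<open>i\<close> bounds the rank. For \<open>i\<close> up to 1, both
  flags set give \<mu>, only \<open>l\<close> gives \<lambda>, only \<open>u\<close> gives \<rho>;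
  no flag gives the Rees congruences of all ranks.\<close>

definition fam :: "bool \<Rightarrow> bool \<Rightarrow> nat \<Rightarrow> point set set rel" where
  "fam u l i = {(x, y) \<in> D \<times> D. x = y \<or> prank x \<le> i \<and> prank y \<le> i \<and> (u \<longrightarrow> same_up x y) \<and> (l \<longrightarrow> same_lo x y)}"

lemma fam_iff: "(x, y) \<in> fam u l i \<longleftrightarrow> x \<in> D \<and> y \<in> D \<and>
    (x = y \<or> prank x \<le> i \<and> prank y \<le> i \<and> (u \<longrightarrow> same_up x y) \<and> (l \<longrightarrow> same_lo x y))"
  by (auto simp: fam_def)

lemma is_cong_fam:
  assumes "i \<le> 1 \<or> \<not> u \<and> \<not> l"
  shows "is_cong (fam u l i)"
proof -
  have eq: "equiv D (fam u l i)"
  proof (intro equivI refl_onI symI transI)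
    show "(x, z) \<in> fam u l i" if "(x, y) \<in> fam u l i" "(y, z) \<in> fam u l i" for x y z
      using that unfolding fam_iff by (metis same_up_trans same_lo_trans)
  qed (auto simp: fam_iff same_up_sym same_lo_sym)
  have "(s \<cdot> x, s \<cdot> y) \<in> fam u l i \<and> (x \<cdot> s, y \<cdot> s) \<in> fam u l i"
    if xy: "(x, y) \<in> fam u l i" and s: "s \<in> D" for x y s
  proof (cases "x = y")
    case True
    then show ?thesis using xy s by (simp add: fam_iff)
  next
    case False
    then have D: "x \<in> D" "y \<in> D" and r: "prank x \<le> i" "prank y \<le> i" "u \<longrightarrow> same_up x y" "l \<longrightarrow> same_lo x y"
      using xy by (simp_all add: fam_iff)
    have r1: "prank x \<le> 1 \<and> prank y \<le> 1" if "u \<or> l" using r assms that by auto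
    have "prank (s \<cdot> x) \<le> i" "prank (s \<cdot> y) \<le> i" "prank (x \<cdot> s) \<le> i" "prank (y \<cdot> s) \<le> i"
      using r prank_left[OF D(1), of s] prank_right[OF D(1), of s]
        prank_left[OF D(2), of s] prank_right[OF D(2), of s] by linarith+
    then show ?thesis
      using D s r r1 same_up_left[OF D s] same_lo_right[OF D s] same_mul[OF D s]
      by (simp add: fam_iff)
  qed
  then show ?thesis using eq by (auto simp: is_cong_def)
qed

text \<open>The mirrored congruence turns each result on upper patterns into one on lower
  patterns.\<close>

lemma is_cong_star:
  assumes "is_cong \<xi>"
  shows "is_cong {(x, y). (pstar x, pstar y) \<in> \<xi>}"
proof -
  have c: "(s \<cdot> x, s \<cdot> y) \<in> \<xi> \<and> (x \<cdot> s, y \<cdot> s) \<in> \<xi>"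
    if "(x, y) \<in> \<xi>" "s \<in> D" for x y s
    using assms that unfolding is_cong_def by auto
  have eq: "equiv D \<xi>" using assms unfolding is_cong_def by blast
  have "equiv D {(x, y). (pstar x, pstar y) \<in> \<xi>}"
  proof (intro equivI refl_onI symI transI subsetI)
    show "x \<in> D \<times> D" if "x \<in> {(x, y). (pstar x, pstar y) \<in> \<xi>}" for x
      using that equiv_type[OF eq] by auto
    show "(x, x) \<in> {(x, y). (pstar x, pstar y) \<in> \<xi>}" if "x \<in> D" for x
      using that eq by (simp add: equiv_def refl_on_def)
    show "(y, x) \<in> {(x, y). (pstar x, pstar y) \<in> \<xi>}" if "(x, y) \<in> {(x, y). (pstar x, pstar y) \<in> \<xi>}" for x y
      using that eq by (auto simp: equiv_def dest: symD)
    show "(x, z) \<in> {(x, y). (pstar x, pstar y) \<in> \<xi>}"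
      if "(x, y) \<in> {(x, y). (pstar x, pstar y) \<in> \<xi>}" "(y, z) \<in> {(x, y). (pstar x, pstar y) \<in> \<xi>}" for x y z
      using that eq unfolding equiv_def by (auto dest: transD)
  qed
  then show ?thesis
    unfolding is_cong_def using c[of "pstar _" "pstar _" "pstar _"] by (auto simp: pstar_pprod)
qed

text \<open>The kernel of the upper pattern \<open>z\<close>, with the least point \<open>b\<close> of a non-singleton block
  split off, as upper part of a diagram of rank 2.\<close>

definition split_rel :: "point set set \<Rightarrow> nat \<Rightarrow> nat \<Rightarrow> nat \<Rightarrow> bool" where
  "split_rel z b i j \<longleftrightarrow> i = j \<or> i \<noteq> b \<and> j \<noteq> b \<and> linked z (Upper i) (Upper j)"

text \<open>The point split off leads to \<open>a\<close> and the rest of its former block to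
  \<open>c\<close>. A following factor glues the block together again if it links \<open>a\<close>
  and \<open>c\<close> in its upper row, and leaves it split otherwise.\<close>

definition split_map :: "point set set \<Rightarrow> nat \<Rightarrow> nat \<Rightarrow> nat \<Rightarrow> nat \<Rightarrow> nat option" where
  "split_map z a c b i = (if i = b then Some a else if linked z (Upper b) (Upper i) then Some c else None)"

context
  fixes z :: "point set set" and a c b b' :: nat
  assumes z: "z \<in> D" and ac: "a \<in> {1..n}" "c \<in> {1..n}" "a < c"
    and b: "linked z (Upper b) (Upper b')" "b \<noteq> b'"
    and b_least: "\<forall>i j. linked z (Upper i) (Upper j) \<longrightarrow> i \<noteq> j \<longrightarrow> b \<le> i"
begin

lemmas split_least = b_least[rule_format]

lemma tie_ok_split: "tie_ok n (split_rel z b) (split_map z a c b)"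
proof -
  note p = D_part[OF z]
  have t: "linked z x y \<Longrightarrow> linked z y w \<Longrightarrow> linked z x w" for x y w by (rule linked_trans[OF p])
  have s: "linked z x y \<Longrightarrow> linked z y x" for x y using linked_sym by blast
  show ?thesis
    unfolding tie_ok_def
  proof (intro conjI ballI impI allI)
    show "(split_rel z b) i i" for i by (simp add: split_rel_def)
    show "(split_rel z b) j i" if "split_rel z b i j" for i j using that s by (auto simp: split_rel_def)
    show "split_rel z b i k" if "split_rel z b i j" "split_rel z b j k" for i j k
      using that t by (auto simp: split_rel_def)
    show "(split_map z a c b) i = (split_map z a c b) j" if "split_rel z b i j" for i j
    proof (cases "i = j")
      case False
      then have "i \<noteq> b" "j \<noteq> b" "linked z (Upper i) (Upper j)" using that by (auto simp: split_rel_def)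
      moreover from this have "linked z (Upper b) (Upper i) \<longleftrightarrow> linked z (Upper b) (Upper j)" using t s by blast
      ultimately show ?thesis by (simp add: split_map_def)
    qed simp
    show "split_rel z b i j" if "(split_map z a c b) i \<noteq> None" "(split_map z a c b) i = (split_map z a c b) j" for i j
    proof (cases "i = b \<or> j = b")
      case True
      then have "i = j" using that ac(3) by (auto simp: split_map_def split: if_splits)
      then show ?thesis by (simp add: split_rel_def)
    next
      case False
      then have "linked z (Upper b) (Upper i)" "linked z (Upper b) (Upper j)"
        using that by (auto simp: split_map_def split: if_splits)
      then have "linked z (Upper i) (Upper j)" using t[OF s] by blast
      then show ?thesis using False by (simp add: split_rel_def)
    qed
    show "x \<in> {1..n}" if "(split_map z a c b) i = Some x" for i x
      using that ac by (auto simp: split_map_def split: if_splits)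
  qed
qed

text \<open>Minimality of \<open>b\<close> is what keeps this planar: no non-singleton upper block
  starts before \<open>b\<close>, so none covers its new strand. It also puts \<open>b\<close> to
  the left of the rest of its block, in accordance with \<open>a < c\<close>.\<close>

lemma split_D: "tie n (split_rel z b) (split_map z a c b) \<in> D"
proof -
  note p = D_part[OF z]
  have t: "linked z x y \<Longrightarrow> linked z y w \<Longrightarrow> linked z x w" for x y w by (rule linked_trans[OF p])
  have s: "linked z x y \<Longrightarrow> linked z y x" for x y using linked_sym by blast
  have "noncrossing (tie n (split_rel z b) (split_map z a c b))"
  proof (rule noncrossing_tie[OF tie_ok_split])
    fix i j k l
    assume o: "i < j" "j < k" "k < l" and r: "split_rel z b i k" "(split_rel z b) j l"
    then have l: "linked z (Upper i) (Upper k)" "linked z (Upper j) (Upper l)" "i \<noteq> b" "j \<noteq> b"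
      by (auto simp: split_rel_def)
    have "linked z (Upper i) (Upper j)"
      by (rule noncrossingD[OF D_nc[OF z] l(1,2)]) (use o in auto)
    then show "split_rel z b i j" using l by (simp add: split_rel_def)
  next
    fix i j k
    assume o: "i < j" "j < k" and r: "split_rel z b i k" and j: "(split_map z a c b) j \<noteq> None"
    then have l: "linked z (Upper i) (Upper k)" "i \<noteq> b" "i \<noteq> k" by (auto simp: split_rel_def)
    then have "b < i" using split_least[OF l(1,3)] by simp
    then have "j \<noteq> b" using o by simp
    then have bj: "linked z (Upper b) (Upper j)" using j by (auto simp: split_map_def split: if_splits)
    have "linked z (Upper b) (Upper i)"
      by (rule noncrossingD[OF D_nc[OF z] bj l(1)]) (use o \<open>b < i\<close> in auto)
    then have "linked z (Upper i) (Upper j)" using bj t s by blast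
    then show "split_rel z b i j" using \<open>j \<noteq> b\<close> l by (simp add: split_rel_def)
  next
    fix i j x y
    assume o: "i < j" and f: "(split_map z a c b) i = Some x" "(split_map z a c b) j = Some y"
    show "x \<le> y"
    proof (cases "i = b")
      case True
      then have "x = a" using f(1) unfolding split_map_def by simp
      moreover have "y = a \<or> y = c" using f(2) unfolding split_map_def by (auto split: if_splits)
      ultimately show ?thesis using ac(3) by auto
    next
      case False
      then have "linked z (Upper i) (Upper b)" using f(1) s by (auto simp: split_map_def split: if_splits)
      then have "b \<le> i" using split_least False by blast
      then have "j \<noteq> b" using o by simp
      have "x = c" using f(1) False unfolding split_map_def by (auto split: if_splits)
      moreover have "y = c" using f(2) \<open>j \<noteq> b\<close> unfolding split_map_def by (auto split: if_splits)
      ultimately show ?thesis by simp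
    qed
  qed
  moreover have "small_blocks (tie n (split_rel z b) (split_map z a c b))" if "small_blocks z"
  proof (rule small_blocks_tie[OF tie_ok_split])
    fix i j k assume "split_rel z b i j" "split_rel z b i k"
    then show "i = j \<or> i = k \<or> j = k"
      using small_blocksD[OF that, of "Upper i" "Upper j" "Upper k"] by (auto simp: split_rel_def)
  next
    fix i j x assume r: "split_rel z b i j" and f: "(split_map z a c b) i = Some x"
    show "i = j"
    proof (rule ccontr)
      assume "i \<noteq> j"
      then have l: "i \<noteq> b" "j \<noteq> b" "linked z (Upper i) (Upper j)" using r by (auto simp: split_rel_def)
      then have "linked z (Upper i) (Upper b)" using f s by (auto simp: split_map_def split: if_splits)
      then show False using small_blocksD[OF that l(3)] l \<open>i \<noteq> j\<close> by auto
    qed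
  qed
  ultimately show ?thesis using z tie_partitions[OF tie_ok_split] by (simp add: D_def)
qed

lemma linked_split_mul:
  assumes x: "x \<in> D"
  shows "linked (tie n (split_rel z b) (split_map z a c b) \<cdot> x) (Upper i) (Upper j) \<longleftrightarrow>
    (if linked x (Upper a) (Upper c) then linked z (Upper i) (Upper j) else i \<in> {1..n} \<and> j \<in> {1..n} \<and> (split_rel z b) i j)"
proof -
  note p = D_part[OF z] and px = D_part[OF x]
  have t: "linked z x y \<Longrightarrow> linked z y w \<Longrightarrow> linked z x w" for x y w by (rule linked_trans[OF p])
  have s: "linked z x y \<Longrightarrow> linked z y x" for x y using linked_sym by blast
  have sx: "linked x (Upper c) (Upper a) \<longleftrightarrow> linked x (Upper a) (Upper c)" using linked_sym by blast
  have refl: "linked x (Upper a) (Upper a)" "linked x (Upper c) (Upper c)"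
    using ac linked_refl[OF px] by auto
  show ?thesis
  proof (cases "i \<in> {1..n} \<and> j \<in> {1..n}")
    case True
    have r: "linked z (Upper i) (Upper i)" using True linked_refl[OF p] by simp
    have bb: "linked z (Upper b) (Upper b)" using t[OF b(1) s[OF b(1)]] .
    have zij: "linked z (Upper i) (Upper j) \<longleftrightarrow> (split_rel z b) i j \<or> i = b \<and> j \<noteq> b \<and> linked z (Upper b) (Upper j)
        \<or> j = b \<and> i \<noteq> b \<and> linked z (Upper b) (Upper i)"
      using r s unfolding split_rel_def by blast
    have "(\<exists>u v. (split_map z a c b) i = Some u \<and> (split_map z a c b) j = Some v \<and> linked x (Upper u) (Upper v)) \<longleftrightarrow>
        (i = b \<and> j = b) \<or> (i \<noteq> b \<and> j \<noteq> b \<and> linked z (Upper b) (Upper i) \<and> linked z (Upper b) (Upper j)) \<or>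
        linked x (Upper a) (Upper c) \<and>
          (i = b \<and> j \<noteq> b \<and> linked z (Upper b) (Upper j) \<or> j = b \<and> i \<noteq> b \<and> linked z (Upper b) (Upper i))"
      using refl sx by (auto simp: split_map_def)
    moreover have "split_rel z b i j" if "i = b \<and> j = b \<or> i \<noteq> b \<and> j \<noteq> b \<and> linked z (Upper b) (Upper i) \<and> linked z (Upper b) (Upper j)"
      using that t s unfolding split_rel_def by blast
    ultimately have "linked (tie n (split_rel z b) (split_map z a c b) \<cdot> x) (Upper i) (Upper j) \<longleftrightarrow> (split_rel z b) i j \<or>
        linked x (Upper a) (Upper c) \<and>
          (i = b \<and> j \<noteq> b \<and> linked z (Upper b) (Upper j) \<or> j = b \<and> i \<noteq> b \<and> linked z (Upper b) (Upper i))"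
      unfolding linked_tie_pprod(1)[OF tie_ok_split px] using True by blast
    then show ?thesis using zij True by (cases "linked x (Upper a) (Upper c)") simp_all
  next
    case False
    then show ?thesis
      unfolding linked_tie_pprod(1)[OF tie_ok_split px] using linked_UU[OF p, of i j] by auto
  qed
qed

end

section \<open>Pairs forced by a single related pair\<close>

context
  fixes \<xi> assumes cong: "is_cong \<xi>"
begin

lemma cong_refl: "x \<in> D \<Longrightarrow> (x, x) \<in> \<xi>"
  and cong_sym: "(x, y) \<in> \<xi> \<Longrightarrow> (y, x) \<in> \<xi>"
  and cong_trans: "(x, y) \<in> \<xi> \<Longrightarrow> (y, w) \<in> \<xi> \<Longrightarrow> (x, w) \<in> \<xi>"
  and cong_D: "(x, y) \<in> \<xi> \<Longrightarrow> x \<in> D \<and> y \<in> D"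
  and cong_left: "(x, y) \<in> \<xi> \<Longrightarrow> s \<in> D \<Longrightarrow> (s \<cdot> x, s \<cdot> y) \<in> \<xi>"
  and cong_right: "(x, y) \<in> \<xi> \<Longrightarrow> s \<in> D \<Longrightarrow> (x \<cdot> s, y \<cdot> s) \<in> \<xi>"
proof -
  have eq: "equiv D \<xi>" using cong unfolding is_cong_def by blast
  show "x \<in> D \<Longrightarrow> (x, x) \<in> \<xi>" using eq by (simp add: equiv_def refl_on_def)
  show "(x, y) \<in> \<xi> \<Longrightarrow> (y, x) \<in> \<xi>" using eq unfolding equiv_def by (blast dest: symD)
  show "(x, y) \<in> \<xi> \<Longrightarrow> (y, w) \<in> \<xi> \<Longrightarrow> (x, w) \<in> \<xi>" using eq unfolding equiv_def by (blast dest: transD)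
  show "(x, y) \<in> \<xi> \<Longrightarrow> x \<in> D \<and> y \<in> D" using equiv_type[OF eq] by blast
  show "(x, y) \<in> \<xi> \<Longrightarrow> s \<in> D \<Longrightarrow> (s \<cdot> x, s \<cdot> y) \<in> \<xi>" "(x, y) \<in> \<xi> \<Longrightarrow> s \<in> D \<Longrightarrow> (x \<cdot> s, y \<cdot> s) \<in> \<xi>"
    using cong unfolding is_cong_def by blast+
qed

lemma cong_both: "(x, y) \<in> \<xi> \<Longrightarrow> s \<in> D \<Longrightarrow> t \<in> D \<Longrightarrow> (s \<cdot> x \<cdot> t, s \<cdot> y \<cdot> t) \<in> \<xi>"
  by (intro cong_right cong_left)

lemma lower_rank_transfer:
  assumes "(x, y) \<in> \<xi>" "w \<in> D" "prank w \<le> prank x"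
  obtains w' where "w' \<in> D" "(w, w') \<in> \<xi>" "prank w' \<le> prank y"
proof -
  obtain u v where uv: "u \<in> D" "v \<in> D" "w = u \<cdot> x \<cdot> v"
    using J_below[OF _ assms(2,3)] cong_D[OF assms(1)] by blast
  have "(w, u \<cdot> y \<cdot> v) \<in> \<xi>" using cong_both[OF assms(1) uv(1,2)] uv(3) by simp
  moreover have "prank (u \<cdot> y \<cdot> v) \<le> prank y" using prank_mid cong_D[OF assms(1)] by blast
  ultimately show ?thesis using that cong_D by blast
qed

text \<open>The contrapositive of \<open>rank_determines\<close>: some two-sided multiple keeps the
  rank of one member of the pair and lowers that of the other.\<close>

lemma drop_rank:
  assumes xy: "(x, y) \<in> \<xi>" "x \<noteq> y" and r: "prank x = r" "prank y \<le> r" "1 \<le> r"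
  obtains x' y' where "(x', y') \<in> \<xi>" "prank x' = r" "prank y' < r"
proof (cases "prank y = r")
  case True
  have D: "x \<in> D" "y \<in> D" using cong_D[OF xy(1)] by blast+
  have "\<exists>s\<in>D. \<exists>t\<in>D. \<not> (prank (s \<cdot> x \<cdot> t) = prank x \<longleftrightarrow> prank (s \<cdot> y \<cdot> t) = prank x)"
    using rank_determines[OF D] True r xy(2) by auto
  then obtain s t where st: "s \<in> D" "t \<in> D" "\<not> (prank (s \<cdot> x \<cdot> t) = prank x \<longleftrightarrow> prank (s \<cdot> y \<cdot> t) = prank x)"
    by blast
  have c: "(s \<cdot> x \<cdot> t, s \<cdot> y \<cdot> t) \<in> \<xi>" by (rule cong_both[OF xy(1) st(1,2)])
  have "prank (s \<cdot> x \<cdot> t) \<le> r" "prank (s \<cdot> y \<cdot> t) \<le> r"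
    using prank_mid[OF D(1), of s t] prank_mid[OF D(2), of s t] r by simp_all
  then consider "prank (s \<cdot> x \<cdot> t) = r" "prank (s \<cdot> y \<cdot> t) < r" | "prank (s \<cdot> y \<cdot> t) = r" "prank (s \<cdot> x \<cdot> t) < r"
    using st(3) r(1) by linarith
  then show ?thesis using that c cong_sym[OF c] by cases blast+
next
  case False
  then show ?thesis using that xy r by (metis le_neq_implies_less)
qed

text \<open>Let \<open>w\<close> have the least rank \<open>r\<close> among the elements related to
  the partial identity on \<open>I\<close>, and suppose that \<open>r\<close> is positive. For an
  \<open>r\<close>-element subset \<open>X\<close> of \<open>I\<close>, a difference between
  \<open>e X\<close> and \<open>e X \<cdot> w\<close> would, by \<open>drop_rank\<close>, push the
  rank below \<open>r\<close>; so the two are equal. Varying \<open>X\<close> shows that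
  \<open>w\<close> has a transversal at every point of \<open>I\<close>, contrary to
  \<open>r < q\<close>.\<close>

lemma rank_2_collapse:
  assumes xy: "(x, y) \<in> \<xi>" "x \<noteq> y" and q: "prank x = q" "prank y \<le> q" "2 \<le> q"
  shows "\<And>w. w \<in> D \<Longrightarrow> prank w \<le> q \<Longrightarrow> \<exists>w'\<in>D. (w, w') \<in> \<xi> \<and> prank w' = 0"
proof -
  have "1 \<le> q" using q(3) by simp
  obtain x' y' where xy': "(x', y') \<in> \<xi>" "prank x' = q" "prank y' < q"
    by (rule drop_rank[OF xy q(1,2) \<open>1 \<le> q\<close>])
  have "q \<le> n" using prank_le_n q(1) cong_D[OF xy(1)] by blast
  then have qn: "{1..q} \<subseteq> {1..n}" by auto
  define I where "I = {1..q}"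
  have I: "I \<subseteq> {1..n}" "finite I" "card I = q" using qn by (auto simp: I_def)
  obtain y0 where y0: "y0 \<in> D" "(e I, y0) \<in> \<xi>" "prank y0 \<le> prank y'"
    using lower_rank_transfer[OF xy'(1), of "e I"] I xy'(2) by auto
  define r where "r = (LEAST r. \<exists>w. (e I, w) \<in> \<xi> \<and> prank w = r)"
  have ex: "\<exists>r w. (e I, w) \<in> \<xi> \<and> prank w = r" using y0 by blast
  obtain w where w: "(e I, w) \<in> \<xi>" "prank w = r"
    using LeastI_ex[OF ex] unfolding r_def by blast
  have least: "r \<le> prank v" if "(e I, v) \<in> \<xi>" for v
    unfolding r_def using that by (intro Least_le) blast
  have "r < q" using least[OF y0(2)] y0(3) xy'(3) by simp
  have wD: "w \<in> D" using cong_D[OF w(1)] by blast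
  have "r = 0"
  proof (rule ccontr)
    assume "r \<noteq> 0"
    have fixed: "e X \<cdot> w = e X" if X: "X \<subseteq> I" "card X = r" for X
    proof (rule ccontr)
      assume ne: "e X \<cdot> w \<noteq> e X"
      have rX: "X \<subseteq> {1..n}" using X I by blast
      have "e X \<cdot> e I = e X"
        by (rule D_eqI) (use rX X I in \<open>auto simp: linked_mul_pid linked_pid D_part\<close>)
      then have "(e X, e X \<cdot> w) \<in> \<xi>" using cong_left[OF w(1), of "e X"] rX by simp
      moreover have "prank (e X) = r" "prank (e X \<cdot> w) \<le> r" "1 \<le> r"
        using rX X prank_right[OF wD, of "e X"] w(2) \<open>r \<noteq> 0\<close> by simp_all
      ultimately obtain x2 y2 where 2: "(x2, y2) \<in> \<xi>" "prank x2 = r" "prank y2 < r"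
        using ne drop_rank by metis
      obtain w2 where "(w, w2) \<in> \<xi>" "prank w2 \<le> prank y2"
        using lower_rank_transfer[OF 2(1) wD] w(2) 2(2) by auto
      then show False using least[OF cong_trans[OF w(1)]] 2(3) by fastforce
    qed
    have UL: "linked w (Upper i) (Lower j) \<longleftrightarrow> j = i" if i: "i \<in> I" for i j
    proof -
      \<comment> \<open>Any point \<open>i\<close> of \<open>I\<close> belongs to an
        \<open>r\<close>-element subset, to be built from \<open>i\<close> and \<open>r - 1\<close>
        others.\<close>
      have "r - 1 \<le> card (I - {i})" using i I \<open>r < q\<close> by simp
      then obtain X0 where X0: "X0 \<subseteq> I - {i}" "card X0 = r - 1" "finite X0"
        by (rule obtain_subset_with_card_n)
      let ?X = "insert i X0"
      have "i \<notin> X0" using X0(1) by blast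
      then have X: "?X \<subseteq> I" "card ?X = r" using X0 i \<open>r \<noteq> 0\<close> by auto
      have rX: "?X \<subseteq> {1..n}" using X I by blast
      have "linked (e ?X \<cdot> w) (Upper i) (Lower j) \<longleftrightarrow> linked w (Upper i) (Lower j)"
        unfolding linked_pid_mul[OF rX D_part[OF wD]] by simp
      then show ?thesis unfolding fixed[OF X] linked_pid[OF rX] by simp
    qed
    have "indep w I"
      unfolding indep_def
    proof (intro conjI ballI impI)
      show "marked w i" if "i \<in> I" for i using UL[OF that] unfolding marked_def by blast
      show "i = j" if "i \<in> I" "j \<in> I" "linked w (Upper i) (Upper j)" for i j
      proof -
        have "linked w (Upper j) (Lower j)" using UL[OF that(2)] by blast
        then have "linked w (Upper i) (Lower j)" using that(3) linked_trans[OF D_part[OF wD]] by blast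
        then show ?thesis using UL[OF that(1), of j] by simp
      qed
    qed
    then have "card I \<le> prank w" by (rule indep_card[OF D_part[OF wD]])
    then show False using I w(2) \<open>r < q\<close> by simp
  qed
  show "\<exists>w'\<in>D. (v, w') \<in> \<xi> \<and> prank w' = 0" if v: "v \<in> D" "prank v \<le> q" for v
  proof -
    obtain w' where "w' \<in> D" "(v, w') \<in> \<xi>" "prank w' \<le> prank w"
      using lower_rank_transfer[OF w(1) v(1)] v(2) I by auto
    then show ?thesis using w(2) \<open>r = 0\<close> by auto
  qed
qed

text \<open>A pair differing in the link of \<open>a\<close> and \<open>c\<close> is placed behind
  the split diagram of \<open>z\<close>: one member restores \<open>z\<close>, the other leaves it
  with \<open>b\<close> split off. Iterating relates \<open>z\<close> to
  \<open>z0 \<cdot> z\<close>, whose upper points are all singletons.\<close>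

lemma different_up_collapse:
  assumes xy: "(x, y) \<in> \<xi>" and r: "prank x \<le> 1" "prank y \<le> 1" and ne: "\<not> same_up x y"
    and zw: "z \<in> D" "w \<in> D" "prank z = 0" "prank w = 0" "same_lo z w"
  shows "(z, w) \<in> \<xi>"
proof -
  have "\<exists>x y a c. (x, y) \<in> \<xi> \<and> prank x \<le> 1 \<and> prank y \<le> 1 \<and> a < c \<and> linked x (Upper a) (Upper c) \<and> \<not> linked y (Upper a) (Upper c)"
  proof -
    have D: "x \<in> D" "y \<in> D" using cong_D[OF xy] by blast+
    obtain i j where ij: "linked x (Upper i) (Upper j) \<noteq> linked y (Upper i) (Upper j)"
      using ne unfolding same_up_def by blast
    have "i \<noteq> j" using ij linked_refl[OF D_part[OF D(1)]] linked_refl[OF D_part[OF D(2)]] by auto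
    then obtain a c where ac: "a < c" "linked x (Upper a) (Upper c) \<noteq> linked y (Upper a) (Upper c)"
      using ij linked_sym by (metis linorder_neqE_nat)
    show ?thesis
    proof (cases "linked x (Upper a) (Upper c)")
      case True
      then show ?thesis using xy r ac by blast
    next
      case False
      then show ?thesis using cong_sym[OF xy] r ac by blast
    qed
  qed
  then obtain x y a c where xy: "(x, y) \<in> \<xi>" and r: "prank x \<le> 1" "prank y \<le> 1" and "a < c"
    and ac: "linked x (Upper a) (Upper c)" "\<not> linked y (Upper a) (Upper c)" by blast
  have D: "x \<in> D" "y \<in> D" using cong_D[OF xy] by blast+
  have rac: "a \<in> {1..n}" "c \<in> {1..n}" using linked_UU[OF D_part[OF D(1)] ac(1)] by auto
  \<comment> \<open>The induction measure; it decreases because \<open>b\<close> becomes a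
    singleton.\<close>
  define N where "N z = card {i. \<exists>j. i \<noteq> j \<and> linked z (Upper i) (Upper j)}" for z
  have fin: "finite {i. \<exists>j. i \<noteq> j \<and> linked z (Upper i) (Upper j)}" if "z \<in> D" for z
    by (rule finite_subset[of _ "{1..n}"]) (use linked_UU[OF D_part[OF that]] in auto)
  have z0z: "linked (z0 \<cdot> z) (Upper i) (Upper j) \<longleftrightarrow> i \<in> {1..n} \<and> i = j" if "z \<in> D" for z i j
    using linked_pid_mul(1)[of "{}" z i j] D_part[OF that] by auto
  have main: "(z, z0 \<cdot> z) \<in> \<xi>" if "z \<in> D" "prank z = 0" for z
    using that
  proof (induction "N z" arbitrary: z rule: less_induct)
    case less
    note pz = D_part[OF less.prems(1)]
    show ?case
    proof (cases "\<exists>i j. i \<noteq> j \<and> linked z (Upper i) (Upper j)")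
      case False
      have "same_up (z0 \<cdot> z) z"
        unfolding same_up_def z0z[OF less.prems(1)]
      proof (intro allI iffI)
        show "linked z (Upper i) (Upper j)" if "i \<in> {1..n} \<and> i = j" for i j
          using that linked_refl[OF pz] by auto
        show "i \<in> {1..n} \<and> i = j" if "linked z (Upper i) (Upper j)" for i j
          using that False linked_UU[OF pz that] by blast
      qed
      moreover have "same_lo (z0 \<cdot> z) z" using less.prems by (intro same_lo_mul) simp_all
      ultimately have "z0 \<cdot> z = z"
        using less.prems by (intro rank_0_eqI) (simp_all add: prank_mul_0)
      then show ?thesis using cong_refl less.prems(1) by simp
    next
      case True
      define b where "b = (LEAST i. \<exists>j. i \<noteq> j \<and> linked z (Upper i) (Upper j))"
      obtain b' where b: "linked z (Upper b) (Upper b')" "b \<noteq> b'"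
        using LeastI_ex[OF True] unfolding b_def by blast
      have least: "\<forall>i j. linked z (Upper i) (Upper j) \<longrightarrow> i \<noteq> j \<longrightarrow> b \<le> i"
        unfolding b_def by (intro allI impI Least_le) blast
      note sp = less.prems(1) rac \<open>a < c\<close> b least
      let ?t = "tie n (split_rel z b) (split_map z a c b)"
      have tD: "?t \<in> D" by (rule split_D[OF sp])
      have rb: "{1..n} - {b} \<subseteq> {1..n}" by blast
      \<comment> \<open>Splitting off \<open>b\<close> is multiplication by the partial identity
        that misses \<open>b\<close>.\<close>
      define z' where "z' = e ({1..n} - {b}) \<cdot> z"
      have z'D: "z' \<in> D" "prank z' = 0"
        using less.prems rb by (simp_all add: z'_def prank_mul_0)
      have z'U: "linked z' (Upper i) (Upper j) \<longleftrightarrow> i \<in> {1..n} \<and> j \<in> {1..n} \<and> split_rel z b i j" for i j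
        unfolding z'_def linked_pid_mul[OF rb pz] split_rel_def by auto
      have rt: "prank (?t \<cdot> v) \<le> 1" if "v \<in> D" "prank v \<le> 1" for v
        using prank_right[OF that(1), of ?t] that(2) by simp
      have up: "same_up (?t \<cdot> v \<cdot> z) (?t \<cdot> v)" if "v \<in> D" "prank v \<le> 1" for v
        using same_up_mul[OF _ rt[OF that]] tD that by simp
      have lo: "same_lo (?t \<cdot> v \<cdot> z) z" if "v \<in> D" for v
        using less.prems by (intro same_lo_mul) simp_all
      have "?t \<cdot> x \<cdot> z = z"
      proof (rule rank_0_eqI)
        have "same_up (?t \<cdot> x) z"
          unfolding same_up_def linked_split_mul[OF sp D(1)] using ac by simp
        then show "same_up (?t \<cdot> x \<cdot> z) z" using up[OF D(1) r(1)] same_up_trans by blast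
      qed (use tD D less.prems lo[OF D(1)] in \<open>auto intro: prank_mul_0\<close>)
      moreover have "?t \<cdot> y \<cdot> z = z'"
      proof (rule rank_0_eqI)
        have "same_up (?t \<cdot> y) z'"
          unfolding same_up_def linked_split_mul[OF sp D(2)] z'U using ac by simp
        then show "same_up (?t \<cdot> y \<cdot> z) z'" using up[OF D(2) r(2)] same_up_trans by blast
        have "same_lo z' z" unfolding z'_def using less.prems by (intro same_lo_mul) simp_all
        then show "same_lo (?t \<cdot> y \<cdot> z) z'" using lo[OF D(2)] same_lo_trans same_lo_sym by blast
      qed (use tD D less.prems z'D in \<open>auto intro: prank_mul_0\<close>)
      ultimately have zz': "(z, z') \<in> \<xi>" using cong_both[OF xy tD less.prems(1)] by simp
      have "{i. \<exists>j. i \<noteq> j \<and> linked z' (Upper i) (Upper j)} \<subset> {i. \<exists>j. i \<noteq> j \<and> linked z (Upper i) (Upper j)}"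
      proof (rule psubsetI)
        show "{i. \<exists>j. i \<noteq> j \<and> linked z' (Upper i) (Upper j)} \<subseteq> {i. \<exists>j. i \<noteq> j \<and> linked z (Upper i) (Upper j)}"
          unfolding z'U split_rel_def by blast
        have "b \<notin> {i. \<exists>j. i \<noteq> j \<and> linked z' (Upper i) (Upper j)}" unfolding z'U split_rel_def by blast
        moreover have "b \<in> {i. \<exists>j. i \<noteq> j \<and> linked z (Upper i) (Upper j)}" using b by blast
        ultimately show "{i. \<exists>j. i \<noteq> j \<and> linked z' (Upper i) (Upper j)} \<noteq> {i. \<exists>j. i \<noteq> j \<and> linked z (Upper i) (Upper j)}" by blast
      qed
      then have "N z' < N z" unfolding N_def by (rule psubset_card_mono[OF fin[OF less.prems(1)]])
      then have "(z', z0 \<cdot> z') \<in> \<xi>" using less.hyps z'D by blast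
      moreover have "z0 \<cdot> z' = z0 \<cdot> z"
      proof (rule rank_0_eqI)
        show "same_up (z0 \<cdot> z') (z0 \<cdot> z)" unfolding same_up_def z0z[OF z'D(1)] z0z[OF less.prems(1)] by simp
        have "same_lo (z0 \<cdot> z') z'" "same_lo (z0 \<cdot> z) z" "same_lo z' z"
          unfolding z'_def using less.prems z'D rb by (auto intro!: same_lo_mul simp: prank_mul_0)
        then show "same_lo (z0 \<cdot> z') (z0 \<cdot> z)" using same_lo_trans same_lo_sym by blast
      qed (use less.prems z'D in \<open>auto intro: prank_mul_0\<close>)
      ultimately show ?thesis using cong_trans[OF zz'] by simp
    qed
  qed
  \<comment> \<open>After complete splitting only the lower pattern is left, and \<open>z\<close>
    and \<open>w\<close> share it.\<close>
  have eq: "z0 \<cdot> z = z0 \<cdot> w"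
  proof (rule rank_0_eqI)
    show "same_up (z0 \<cdot> z) (z0 \<cdot> w)" unfolding same_up_def z0z[OF zw(1)] z0z[OF zw(2)] by simp
    have "same_lo (z0 \<cdot> z) z" "same_lo (z0 \<cdot> w) w" using zw by (auto intro!: same_lo_mul)
    then show "same_lo (z0 \<cdot> z) (z0 \<cdot> w)" using zw(5) same_lo_trans same_lo_sym by blast
  qed (use zw in \<open>auto intro: prank_mul_0\<close>)
  show ?thesis
    by (rule cong_trans[OF main[OF zw(1,3), unfolded eq] cong_sym[OF main[OF zw(2,4)]]])
qed

end


lemma pid_idem:
  assumes "X \<subseteq> {1..n}"
  shows "e X \<cdot> e X = e X"
  by (rule D_eqI) (use assms in \<open>auto simp: linked_mul_pid linked_pid D_part\<close>)

lemma different_lo_collapse: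
  assumes "is_cong \<xi>" "(x, y) \<in> \<xi>" "prank x \<le> 1" "prank y \<le> 1" "\<not> same_lo x y"
    and "z \<in> D" "w \<in> D" "prank z = 0" "prank w = 0" "same_up z w"
  shows "(z, w) \<in> \<xi>"
proof -
  have D: "x \<in> D" "y \<in> D" using cong_D[OF assms(1,2)] by blast+
  have "(pstar z, pstar w) \<in> {(x, y). (pstar x, pstar y) \<in> \<xi>}"
    by (rule different_up_collapse[OF is_cong_star[OF assms(1)], of "pstar x" "pstar y"])
       (use assms D in simp_all)
  then show ?thesis by simp
qed

text \<open>In the rectangular band, \<open>z \<cdot> w\<close> has the upper pattern of
  \<open>z\<close> and the lower pattern of \<open>w\<close>; passing through it changes one pattern
  at a time.\<close>

lemma rank_0_related:
  assumes c: "is_cong \<xi>" and zw: "z \<in> D" "w \<in> D" "prank z = 0" "prank w = 0"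
    and up: "same_up z w \<or> (\<exists>x y. (x, y) \<in> \<xi> \<and> prank x \<le> 1 \<and> prank y \<le> 1 \<and> \<not> same_up x y)"
    and lo: "same_lo z w \<or> (\<exists>x y. (x, y) \<in> \<xi> \<and> prank x \<le> 1 \<and> prank y \<le> 1 \<and> \<not> same_lo x y)"
  shows "(z, w) \<in> \<xi>"
proof -
  have m: "z \<cdot> w \<in> D" "prank (z \<cdot> w) = 0" using zw by (simp_all add: prank_mul_0)
  have u: "same_up (z \<cdot> w) z" and l: "same_lo (z \<cdot> w) w"
    using zw by (simp_all add: same_up_mul same_lo_mul)
  have "(z, z \<cdot> w) \<in> \<xi>"
  proof (cases "same_lo z w")
    case True
    then have "z = z \<cdot> w"
      using rank_0_eqI[OF zw(1) m(1) zw(3) m(2) same_up_sym[OF u]] same_lo_trans[OF _ same_lo_sym[OF l]] by blast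
    then show ?thesis using cong_refl[OF c zw(1)] by simp
  next
    case False
    then show ?thesis
      using lo different_lo_collapse[OF c _ _ _ _ zw(1) m(1) zw(3) m(2) same_up_sym[OF u]] by blast
  qed
  moreover have "(z \<cdot> w, w) \<in> \<xi>"
  proof (cases "same_up z w")
    case True
    then have "z \<cdot> w = w"
      using rank_0_eqI[OF m(1) zw(2) m(2) zw(4) _ l] same_up_trans[OF u] by blast
    then show ?thesis using cong_refl[OF c zw(2)] by simp
  next
    case False
    then show ?thesis
      using up different_up_collapse[OF c _ _ _ _ m(1) zw(2) m(2) zw(4) l] by blast
  qed
  ultimately show ?thesis by (rule cong_trans[OF c])
qed

text \<open>It is enough to relate the partial identity \<open>E\<close> on one point to
  \<open>z0\<close>: every element of rank at most 1 is a product
  \<open>u \<cdot> E \<cdot> v\<close>, and replacing \<open>E\<close> by \<open>z0\<close> yields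
  its retract.\<close>

lemma retr_related:
  assumes c: "is_cong \<xi>" and xy: "(x, y) \<in> \<xi>" "x \<noteq> y" "prank x = 1" "prank y \<le> 1"
    and z: "z \<in> D" "prank z \<le> 1"
  shows "(z, retr z) \<in> \<xi>"
proof (cases "prank z = 0")
  case True
  then show ?thesis using retr_0[OF z(1)] cong_refl[OF c z(1)] by simp
next
  case False
  obtain x' y' where xy': "(x', y') \<in> \<xi>" "prank x' = 1" "prank y' < 1"
    by (rule drop_rank[OF c xy]) auto
  define E where "E = e {1}"
  have r1: "{1} \<subseteq> {1..n}" using n2 by simp
  have E: "E \<in> D" "prank E = 1" using prank_pid[OF r1] pid_D[OF r1] by (simp_all add: E_def)
  obtain w where w: "w \<in> D" "(E, w) \<in> \<xi>" "prank w \<le> prank y'"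
    using lower_rank_transfer[OF c xy'(1) E(1)] E(2) xy'(2) by auto
  have w0: "prank w = 0" using w(3) xy'(3) by simp
  have EE: "E \<cdot> E = E"
    unfolding E_def by (rule pid_idem[OF r1])
  have eU: "linked (E \<cdot> v) (Upper i) (Upper j) \<longleftrightarrow> linked z0 (Upper i) (Upper j)" if "v \<in> D" for v i j
    unfolding E_def using linked_pid_mul(1)[OF r1 D_part[OF that], of i j] linked_pid(1)[of "{}" i j]
      linked_UU[OF D_part[OF that], of 1 1] linked_refl[OF D_part[OF that], of "Upper 1"] n2 by auto
  have up: "same_up (E \<cdot> v) z0" if "v \<in> D" for v using eU[OF that] by (simp add: same_up_def)
  have lo: "same_lo (v \<cdot> E) z0" if "v \<in> D" for v
  proof -
    have "same_up (E \<cdot> pstar v) z0" using up that by simp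
    then have "same_up (pstar (v \<cdot> E)) (pstar z0)" using pid_star[OF r1] by (simp add: pstar_pprod E_def)
    then show ?thesis by (rule same_star(1)[THEN iffD1])
  qed
  \<comment> \<open>Only the point 1 passes through \<open>E\<close>, so multiplying by it from both
    sides reduces the two patterns to singletons.\<close>
  have "E \<cdot> w \<cdot> E = z0"
    by (rule rank_0_eqI)
       (use E w w0 up[of "w \<cdot> E"] lo[of "E \<cdot> w"] in \<open>simp_all add: D_assoc prank_mul_0\<close>)
  then have Ez: "(E, z0) \<in> \<xi>" using cong_both[OF c w(2) E(1) E(1)] EE by simp
  obtain u v where uv: "u \<in> D" "v \<in> D" "z = u \<cdot> E \<cdot> v"
    using J_below[OF E(1) z(1)] z(2) E(2) by auto
  have Ez0: "E \<cdot> z0 = z0" "z0 \<cdot> E = z0"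
    by (rule rank_0_eqI; use E up[of z0] lo[of z0] same_up_mul[of z0 E] same_lo_mul[of z0 E] in \<open>simp add: prank_mul_0\<close>)+
  have "u \<cdot> z0 \<cdot> v = retr z"
  proof (rule retr_unique[OF z])
    have 1: "prank (u \<cdot> E) \<le> 1" "prank (E \<cdot> v) \<le> 1"
      using prank_right[OF E(1), of u] prank_left[OF E(1), of v] E(2) by simp_all
    have "u \<cdot> z0 \<cdot> v = u \<cdot> E \<cdot> (z0 \<cdot> v)" using uv E Ez0 by (simp add: D_assoc flip: D_assoc[of E z0 v])
    moreover have "same_up (u \<cdot> E \<cdot> (z0 \<cdot> v)) (u \<cdot> E)" "same_up (u \<cdot> E \<cdot> v) (u \<cdot> E)"
      using 1 uv E by (simp_all add: same_up_mul)
    ultimately show "same_up (u \<cdot> z0 \<cdot> v) z" unfolding uv(3) using same_up_trans same_up_sym by metis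
    have "u \<cdot> z0 \<cdot> v = u \<cdot> z0 \<cdot> (E \<cdot> v)" using uv E Ez0 by (simp add: D_assoc flip: D_assoc[of z0 E v])
    moreover have "u \<cdot> E \<cdot> v = u \<cdot> (E \<cdot> v)" using uv E by (simp add: D_assoc)
    moreover have "same_lo (u \<cdot> z0 \<cdot> (E \<cdot> v)) (E \<cdot> v)" "same_lo (u \<cdot> (E \<cdot> v)) (E \<cdot> v)"
      using 1 uv E by (simp_all add: same_lo_mul)
    ultimately show "same_lo (u \<cdot> z0 \<cdot> v) z" unfolding uv(3) using same_lo_trans same_lo_sym by metis
  qed (use uv in \<open>simp_all add: prank_mul_0\<close>)
  then show ?thesis using cong_both[OF c Ez uv(1,2)] uv(3) by simp
qed

text \<open>The witness for upper patterns: it has the upper block \<open>{1, 2}\<close> and differs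
  from \<open>z0\<close> only there; its star is the witness for lower patterns. It exists because
  \<open>n\<close> is at least 2.\<close>

definition cap :: "point set set" where
  "cap = tie n (\<lambda>i j. i = j \<or> i = 1 \<and> j = 2 \<or> i = 2 \<and> j = 1) (\<lambda>_. None)"

lemma tie_ok_cap: "tie_ok n (\<lambda>i j. i = j \<or> i = 1 \<and> j = 2 \<or> i = 2 \<and> j = 1) (\<lambda>_. None)"
  unfolding tie_ok_def by auto

lemma linked_cap:
  "linked cap (Upper i) (Upper j) \<longleftrightarrow> i \<in> {1..n} \<and> j \<in> {1..n} \<and> (i = j \<or> i = 1 \<and> j = 2 \<or> i = 2 \<and> j = 1)"
  "\<not> linked cap (Upper i) (Lower j)"
  "linked cap (Lower i) (Lower j) \<longleftrightarrow> i \<in> {1..n} \<and> i = j"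
  unfolding cap_def linked_tie[OF tie_ok_cap] by auto

lemma cap_D [simp]: "cap \<in> D"
proof -
  have "noncrossing cap" unfolding cap_def by (rule noncrossing_tie[OF tie_ok_cap]) auto
  moreover have "small_blocks cap" unfolding cap_def by (rule small_blocks_tie[OF tie_ok_cap]) auto
  ultimately show ?thesis using tie_partitions[OF tie_ok_cap] by (simp add: D_def cap_def)
qed

lemma prank_cap [simp]: "prank cap = 0"
  using prank_0_iff[OF D_part[OF cap_D]] by (simp add: marked_def linked_cap)

lemma linked_z0_UU: "linked z0 (Upper i) (Upper j) \<longleftrightarrow> i \<in> {1..n} \<and> i = j"
  and linked_z0_LL: "linked z0 (Lower i) (Lower j) \<longleftrightarrow> i \<in> {1..n} \<and> i = j"
  using linked_pid[of "{}"] by simp_all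

lemma cap_up [simp]: "\<not> same_up cap z0" and cap_lo [simp]: "same_lo cap z0"
proof -
  have "linked cap (Upper 1) (Upper 2)" "\<not> linked z0 (Upper 1) (Upper 2)"
    using n2 by (simp_all add: linked_cap linked_z0_UU)
  then show "\<not> same_up cap z0" unfolding same_up_def by blast
  show "same_lo cap z0" by (simp add: same_lo_def linked_cap linked_z0_LL)
qed

lemma pid12: "{1, 2} \<subseteq> {1..n}" "e {1, 2} \<in> D" "prank (e {1, 2}) = 2"
  using n2 prank_pid[of "{1, 2}"] by auto

lemma pid12_up:
  "linked (e {1, 2} \<cdot> cap) (Upper 1) (Upper 2)" "\<not> linked (e {1, 2} \<cdot> z0) (Upper 1) (Upper 2)"
  unfolding linked_pid_mul[OF pid12(1) D_part[OF cap_D]] linked_pid_mul[OF pid12(1) D_part[OF z0_D]]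
    linked_cap linked_z0_UU using n2 by auto

text \<open>As a left factor the rank 0 element \<sigma> cannot tell \<open>cap\<close> from
  \<open>z0\<close>, while \<open>e {1, 2}\<close> passes their difference on to the upper row. So
  the two products with \<open>e {1, 2}\<close> are related although their upper patterns
  differ.\<close>

lemma rank_2_up_pair:
  assumes c: "is_cong \<xi>" and \<sigma>: "(e {1, 2}, \<sigma>) \<in> \<xi>" "prank \<sigma> = 0"
  shows "\<exists>x y. (x, y) \<in> \<xi> \<and> prank x \<le> 1 \<and> prank y \<le> 1 \<and> \<not> same_up x y"
proof -
  have s: "\<sigma> \<in> D" using cong_D[OF c \<sigma>(1)] by blast
  have eq: "\<sigma> \<cdot> cap = \<sigma> \<cdot> z0"
  proof (rule rank_0_eqI)
    show "same_up (\<sigma> \<cdot> cap) (\<sigma> \<cdot> z0)"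
      using same_up_trans[OF same_up_mul[OF s] same_up_sym[OF same_up_mul[OF s]]] \<sigma>(2) by simp
    show "same_lo (\<sigma> \<cdot> cap) (\<sigma> \<cdot> z0)"
      using same_mul(2)[of cap z0 \<sigma>] s by simp
  qed (use s in \<open>simp_all add: prank_mul_0\<close>)
  have "(e {1, 2} \<cdot> cap, e {1, 2} \<cdot> z0) \<in> \<xi>"
    using cong_trans[OF c cong_right[OF c \<sigma>(1) cap_D, unfolded eq] cong_sym[OF c cong_right[OF c \<sigma>(1) z0_D]]] .
  moreover have "\<not> same_up (e {1, 2} \<cdot> cap) (e {1, 2} \<cdot> z0)"
    using pid12_up unfolding same_up_def by blast
  moreover have "prank (e {1, 2} \<cdot> cap) \<le> 1" "prank (e {1, 2} \<cdot> z0) \<le> 1"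
    using prank_mul_0[OF pid12(2)] by simp_all
  ultimately show ?thesis by blast
qed

section \<open>Classification of the congruences\<close>

lemma is_cong_cases:
  assumes c: "is_cong \<xi>"
  shows "(\<exists>q\<le>n. \<xi> = fam False False q) \<or> (\<exists>u l. \<exists>i\<in>{0, 1}. \<xi> = fam u l i)"
proof (cases "\<exists>x y. (x, y) \<in> \<xi> \<and> x \<noteq> y \<and> 2 \<le> prank x")
  case True
  define Q where "Q = {prank x | x y. (x, y) \<in> \<xi> \<and> x \<noteq> y}"
  have "Q \<subseteq> {..n}" unfolding Q_def using prank_le_n cong_D[OF c] by blast
  then have fin: "finite Q" by (rule finite_subset) simp
  define q where "q = Max Q"
  have "Q \<noteq> {}" using True unfolding Q_def by blast
  then have "q \<in> Q" unfolding q_def using fin by (rule Max_in[rotated])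
  then obtain x y where xy: "(x, y) \<in> \<xi>" "x \<noteq> y" "prank x = q" unfolding Q_def by blast
  have max: "prank v \<le> q" if "(v, w) \<in> \<xi>" "v \<noteq> w" for v w
    unfolding q_def using that by (intro Max_ge[OF fin]) (auto simp: Q_def)
  have y: "prank y \<le> q" using max[OF cong_sym[OF c xy(1)]] xy(2) by simp
  have q2: "2 \<le> q" using True max by (meson order_trans)
  have qn: "q \<le> n" using \<open>q \<in> Q\<close> \<open>Q \<subseteq> {..n}\<close> by auto
  note collapse = rank_2_collapse[OF c xy y q2]
  obtain \<sigma> where \<sigma>: "(e {1, 2}, \<sigma>) \<in> \<xi>" "prank \<sigma> = 0"
    using collapse[OF pid12(2)] pid12(3) q2 by auto
  have up: "\<exists>x y. (x, y) \<in> \<xi> \<and> prank x \<le> 1 \<and> prank y \<le> 1 \<and> \<not> same_up x y"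
    by (rule rank_2_up_pair[OF c \<sigma>])
  have sD: "\<sigma> \<in> D" using cong_D[OF c \<sigma>(1)] by blast
  \<comment> \<open>Partial identities are fixed by the involution, so the mirrored congruence
    satisfies the same hypothesis.\<close>
  have "(e {1, 2}, pstar \<sigma>) \<in> {(x, y). (pstar x, pstar y) \<in> \<xi>}"
    using \<sigma>(1) pid_star[OF pid12(1)] by simp
  from rank_2_up_pair[OF is_cong_star[OF c] this] \<sigma>(2) sD
  obtain a b where ab: "(pstar a, pstar b) \<in> \<xi>" "prank a \<le> 1" "prank b \<le> 1" "\<not> same_up a b" by auto
  have abD: "a \<in> D" "b \<in> D" using cong_D[OF c ab(1)] by simp_all
  have lo: "\<exists>x y. (x, y) \<in> \<xi> \<and> prank x \<le> 1 \<and> prank y \<le> 1 \<and> \<not> same_lo x y"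
    by (rule exI[of _ "pstar a"], rule exI[of _ "pstar b"]) (use ab abD in simp)
  have "\<xi> = fam False False q"
  proof (intro subset_antisym subrelI)
    fix v w assume vw: "(v, w) \<in> \<xi>"
    then show "(v, w) \<in> fam False False q"
      using cong_D[OF c vw] max[OF vw] max[OF cong_sym[OF c vw]] by (auto simp: fam_iff)
  next
    fix v w assume "(v, w) \<in> fam False False q"
    then have vw: "v \<in> D" "w \<in> D" and r: "v = w \<or> prank v \<le> q \<and> prank w \<le> q" by (auto simp: fam_iff)
    show "(v, w) \<in> \<xi>"
    proof (cases "v = w")
      case True
      then show ?thesis using cong_refl[OF c] vw by simp
    next
      case False
      then obtain v' w' where v': "v' \<in> D" "(v, v') \<in> \<xi>" "prank v' = 0"
        and w': "w' \<in> D" "(w, w') \<in> \<xi>" "prank w' = 0"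
        using collapse vw r by meson
      have "(v', w') \<in> \<xi>" by (rule rank_0_related[OF c v'(1) w'(1) v'(3) w'(3)]) (use up lo in blast)+
      then show ?thesis using cong_trans[OF c v'(2)] cong_trans[OF c _ cong_sym[OF c w'(2)]] by blast
    qed
  qed
  then show ?thesis using qn by blast
next
  case False
  have r1: "prank v \<le> 1" "prank w \<le> 1" if "(v, w) \<in> \<xi>" "v \<noteq> w" for v w
  proof -
    show "prank v \<le> 1" using False that by fastforce
    show "prank w \<le> 1" using False cong_sym[OF c that(1)] that(2) by fastforce
  qed
  define u where "u \<longleftrightarrow> (\<forall>(v, w) \<in> \<xi>. same_up v w)"
  define l where "l \<longleftrightarrow> (\<forall>(v, w) \<in> \<xi>. same_lo v w)"
  \<comment> \<open>\<open>i\<close> is 1 exactly if some element of rank 1 is related to another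
    element. For the equality relation the three definitions give
    \<open>fam True True 0\<close>.\<close>
  define i :: nat where "i = (if \<exists>v w. (v, w) \<in> \<xi> \<and> v \<noteq> w \<and> prank v = 1 then 1 else 0)"
  have up: "\<exists>x y. (x, y) \<in> \<xi> \<and> prank x \<le> 1 \<and> prank y \<le> 1 \<and> \<not> same_up x y" if nu: "\<not> u"
  proof -
    obtain x y where "(x, y) \<in> \<xi>" "\<not> same_up x y" using nu unfolding u_def by blast
    moreover from this have "x \<noteq> y" by auto
    ultimately show ?thesis using r1 by blast
  qed
  have lo: "\<exists>x y. (x, y) \<in> \<xi> \<and> prank x \<le> 1 \<and> prank y \<le> 1 \<and> \<not> same_lo x y" if nl: "\<not> l"
  proof -
    obtain x y where "(x, y) \<in> \<xi>" "\<not> same_lo x y" using nl unfolding l_def by blast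
    moreover from this have "x \<noteq> y" by auto
    ultimately show ?thesis using r1 by blast
  qed
  have ri: "prank v \<le> i" if "(v, w) \<in> \<xi>" "v \<noteq> w" for v w
  proof (cases "prank v = 1")
    case True
    then have "i = 1" using that unfolding i_def by auto
    then show ?thesis using True by simp
  next
    case False
    then show ?thesis using r1(1)[OF that] by simp
  qed
  have rel: "(v, retr v) \<in> \<xi>" if v: "v \<in> D" "prank v \<le> i" for v
  proof (cases "i = 0")
    case True
    then show ?thesis using v retr_0[OF v(1)] cong_refl[OF c v(1)] by simp
  next
    case False
    then obtain x y where xy: "(x, y) \<in> \<xi>" "x \<noteq> y" "prank x = 1" by (auto simp: i_def split: if_splits)
    have "prank v \<le> 1" using v(2) by (simp add: i_def split: if_splits)
    then show ?thesis using retr_related[OF c xy r1(2)[OF xy(1,2)] v(1)] by blast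
  qed
  have "\<xi> = fam u l i"
  proof (intro subset_antisym subrelI)
    fix v w assume vw: "(v, w) \<in> \<xi>"
    have "u \<longrightarrow> same_up v w" "l \<longrightarrow> same_lo v w" using vw unfolding u_def l_def by blast+
    then show "(v, w) \<in> fam u l i"
      using cong_D[OF c vw] ri[OF vw] ri[OF cong_sym[OF c vw]] by (auto simp: fam_iff)
  next
    fix v w assume "(v, w) \<in> fam u l i"
    then have vw: "v \<in> D" "w \<in> D"
      and r: "v = w \<or> prank v \<le> i \<and> prank w \<le> i \<and> (u \<longrightarrow> same_up v w) \<and> (l \<longrightarrow> same_lo v w)"
      by (simp_all add: fam_iff)
    show "(v, w) \<in> \<xi>"
    proof (cases "v = w")
      case True
      then show ?thesis using cong_refl[OF c] vw by simp
    next
      case False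
      then have r: "prank v \<le> i" "prank w \<le> i" "u \<longrightarrow> same_up v w" "l \<longrightarrow> same_lo v w" using r by auto
      have i1: "prank v \<le> 1" "prank w \<le> 1" using r(1,2) by (simp_all add: i_def split: if_splits)
      have "(retr v, retr w) \<in> \<xi>"
      proof (rule rank_0_related[OF c])
        show "same_up (retr v) (retr w) \<or> (\<exists>x y. (x, y) \<in> \<xi> \<and> prank x \<le> 1 \<and> prank y \<le> 1 \<and> \<not> same_up x y)"
          using up r(3) same_up_retr[OF vw(1) i1(1)] same_up_retr[OF vw(2) i1(2)] same_up_trans same_up_sym by meson
        show "same_lo (retr v) (retr w) \<or> (\<exists>x y. (x, y) \<in> \<xi> \<and> prank x \<le> 1 \<and> prank y \<le> 1 \<and> \<not> same_lo x y)"
          using lo r(4) same_lo_retr[OF vw(1) i1(1)] same_lo_retr[OF vw(2) i1(2)] same_lo_trans same_lo_sym by meson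
      qed (use vw in simp_all)
      then show ?thesis
        using cong_trans[OF c rel[OF vw(1) r(1)]] cong_trans[OF c _ cong_sym[OF c rel[OF vw(2) r(2)]]] by blast
    qed
  qed
  moreover have "i \<in> {0, 1}" by (simp add: i_def)
  ultimately show ?thesis by blast
qed

section \<open>Comparing members of the family\<close>

lemma pid_same: "X \<subseteq> {1..n} \<Longrightarrow> same_up (e X) z0" "X \<subseteq> {1..n} \<Longrightarrow> same_lo (e X) z0"
  by (simp_all add: same_up_def same_lo_def linked_pid linked_z0_UU linked_z0_LL)

text \<open>Three kinds of test pairs recover the parameters of \<open>fam\<close>: partial
  identities against \<open>z0\<close> detect the rank bound, and \<open>cap\<close> and its star
  against \<open>z0\<close> detect the flags.\<close>

lemma pid_in_fam: "q \<le> n \<Longrightarrow> (e {1..q}, z0) \<in> fam u l i \<longleftrightarrow> q \<le> i"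
  by (cases "q = 0") (auto simp: fam_iff pid_same dest: arg_cong[of _ _ prank])

lemma cap_in_fam: "(cap, z0) \<in> fam u l i \<longleftrightarrow> \<not> u" "(pstar cap, z0) \<in> fam u l i \<longleftrightarrow> \<not> l"
proof -
  have ne: "cap \<noteq> z0" "pstar cap \<noteq> z0"
    using cap_up same_star(2)[of cap z0] by auto
  have "same_up (pstar cap) z0" "\<not> same_lo (pstar cap) z0"
    using same_star[of cap z0] by auto
  then show "(cap, z0) \<in> fam u l i \<longleftrightarrow> \<not> u" "(pstar cap, z0) \<in> fam u l i \<longleftrightarrow> \<not> l"
    using ne by (simp_all add: fam_iff)
qed

lemma fam_subset_iff:
  assumes "i \<le> n" "j \<le> n"
  shows "fam u l i \<subseteq> fam u' l' j \<longleftrightarrow> (u' \<longrightarrow> u) \<and> (l' \<longrightarrow> l) \<and> i \<le> j"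
proof
  assume s: "fam u l i \<subseteq> fam u' l' j"
  have "(e {1..i}, z0) \<in> fam u' l' j" using s pid_in_fam[OF assms(1), of u l i] by blast
  then show "(u' \<longrightarrow> u) \<and> (l' \<longrightarrow> l) \<and> i \<le> j"
    using s cap_in_fam[of u l i] cap_in_fam[of u' l' j] pid_in_fam[OF assms(1), of u' l' j] by blast
qed (auto simp: fam_iff subset_iff split_paired_all)

lemma fam_eq_iff:
  assumes "i \<le> n" "j \<le> n"
  shows "fam u l i = fam u' l' j \<longleftrightarrow> u = u' \<and> l = l' \<and> i = j"
  using fam_subset_iff[OF assms, of u l u' l'] fam_subset_iff[OF assms(2,1), of u' l' u l] by auto

lemma fam_star_closed_iff:
  "(\<forall>(x, y) \<in> fam u l i. (pstar x, pstar y) \<in> fam u l i) \<longleftrightarrow> u = l"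
proof
  assume s: "\<forall>(x, y) \<in> fam u l i. (pstar x, pstar y) \<in> fam u l i"
  have "pstar z0 = z0" by simp
  then show "u = l" using s cap_in_fam[of u l i] by (metis (no_types, lifting) case_prodD pstar_pstar)
qed (auto simp: fam_iff)

lemma fam_0: "fam True True 0 = Id_on D"
proof (intro subset_antisym subrelI)
  fix x y assume "(x, y) \<in> fam True True 0"
  then have "x \<in> D" "x = y" using rank_0_eqI[of x y] by (auto simp: fam_iff)
  then show "(x, y) \<in> Id_on D" by blast
qed (auto simp: fam_iff)

lemma fam_n: "fam False False n = D \<times> D"
  using prank_le_n by (auto simp: fam_def)


subsection \<open>The monoids\<close>

definition Kmon :: "point set set monoid" where
  "Kmon = \<lparr>carrier = D, mult = pprod n, one = id_bar n n\<rparr>"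

lemma Kmon_simps [simp]: "carrier Kmon = D" "\<alpha> \<otimes>\<^bsub>Kmon\<^esub> \<beta> = \<alpha> \<cdot> \<beta>"
  by (simp_all add: Kmon_def)

lemma small_blocks_iff:
  assumes "\<alpha> \<in> partitions n"
  shows "small_blocks \<alpha> \<longleftrightarrow> (\<forall>A\<in>\<alpha>. card A \<le> 2)"
proof (intro iffI ballI)
  fix A assume s: "small_blocks \<alpha>" and A: "A \<in> \<alpha>"
  show "card A \<le> 2"
  proof (rule ccontr)
    assume "\<not> card A \<le> 2"
    then have "3 \<le> card A" by simp
    then obtain T where "T \<subseteq> A" "card T = 3" "finite T" by (rule obtain_subset_with_card_n)
    then obtain x y z where "{x, y, z} \<subseteq> A" "x \<noteq> y" "x \<noteq> z" "y \<noteq> z" by (auto simp: card_3_iff)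
    then show False using small_blocksD[OF s, of x y z] A unfolding linked_def by blast
  qed
next
  assume c: "\<forall>A\<in>\<alpha>. card A \<le> 2"
  show "small_blocks \<alpha>"
    unfolding small_blocks_def
  proof (intro allI impI, rule ccontr)
    fix x y z assume l: "linked \<alpha> x y" "linked \<alpha> x z" and ne: "\<not> (x = y \<or> x = z \<or> y = z)"
    obtain A where A: "A \<in> \<alpha>" "x \<in> A" "y \<in> A" using l(1) unfolding linked_def by blast
    have "z \<in> A" using linked_block[OF assms A(1,2)] l(2) by blast
    then have "{x, y, z} \<subseteq> A" using A by blast
    moreover have "finite A"
      using A(1) assms unfolding partitions_def partition_on_def by (auto intro: finite_subset[OF _ finite_points])
    ultimately have "card {x, y, z} \<le> card A" by (intro card_mono)
    then show False using ne c A(1) by (auto simp: card_insert_if split: if_splits)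
  qed
qed

lemma planar_monoid_eq: "\<not> mot \<Longrightarrow> planar_partition_monoid n = Kmon"
  unfolding planar_partition_monoid_def Kmon_def D_def using planar_iff_noncrossing by auto

lemma motzkin_monoid_eq: "mot \<Longrightarrow> motzkin_monoid n = Kmon"
  unfolding motzkin_monoid_def Kmon_def D_def using planar_iff_noncrossing small_blocks_iff by auto

section \<open>Ideals and Green's relations\<close>

abbreviation I where "I q \<equiv> rank_ideal Kmon q"

lemma mem_I: "\<alpha> \<in> I q \<longleftrightarrow> \<alpha> \<in> D \<and> prank \<alpha> \<le> q"
  by (auto simp: rank_ideal_def)

lemma e_D [simp]: "q \<le> n \<Longrightarrow> e {1..q} \<in> D" and prank_e [simp]: "q \<le> n \<Longrightarrow> prank (e {1..q}) = q"
  using pid_D[of "{1..q}"] prank_pid[of "{1..q}"] by auto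

lemma ideal_I: "sg_ideal Kmon (I q)"
  unfolding sg_ideal_def
proof (intro conjI ballI)
  have "z0 \<in> I q" unfolding mem_I by simp
  then show "I q \<noteq> {}" by blast
next
  fix x s assume "x \<in> I q" "s \<in> carrier Kmon"
  then have x: "x \<in> D" "prank x \<le> q" "s \<in> D" by (simp_all add: mem_I)
  show "s \<otimes>\<^bsub>Kmon\<^esub> x \<in> I q" "x \<otimes>\<^bsub>Kmon\<^esub> s \<in> I q"
    using x prank_right[OF x(1), of s] prank_left[OF x(1), of s] by (simp_all add: mem_I)
qed (auto simp: mem_I)

text \<open>By \<open>J_below\<close> an element of largest rank in the ideal generates everything
  of at most that rank.\<close>

lemma ideal_iff: "sg_ideal Kmon J \<longleftrightarrow> (\<exists>q\<le>n. J = I q)"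
proof
  assume J: "sg_ideal Kmon J"
  have JD: "J \<subseteq> D" "J \<noteq> {}" using J by (auto simp: sg_ideal_def)
  have fin: "finite (prank ` J)"
    by (rule finite_subset[of _ "{..n}"]) (use prank_le_n JD in auto)
  define q where "q = Max (prank ` J)"
  have "q \<in> prank ` J" unfolding q_def using fin JD(2) by (intro Max_in) auto
  then obtain a where a: "a \<in> J" "prank a = q" by auto
  have "J = I q"
  proof (intro subset_antisym subsetI)
    fix x assume "x \<in> J"
    then show "x \<in> I q" using JD fin unfolding q_def mem_I by auto
  next
    fix x assume x: "x \<in> I q"
    then obtain u v where "u \<in> D" "v \<in> D" "x = u \<cdot> a \<cdot> v"
      using J_below[of a x] a JD unfolding mem_I by blast
    then show "x \<in> J" using J a(1) unfolding sg_ideal_def by auto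
  qed
  moreover have "q \<le> n" using prank_le_n a JD by blast
  ultimately show "\<exists>q\<le>n. J = I q" by blast
qed (use ideal_I in auto)

lemma min_ideal_eq: "min_ideal Kmon = I 0"
  unfolding min_ideal_def
proof (rule the_equality)
  have sub: "I 0 \<subseteq> J" if "sg_ideal Kmon J" for J
    using that unfolding ideal_iff by (auto simp: mem_I)
  show min0: "sg_ideal Kmon (I 0) \<and> (\<forall>J. sg_ideal Kmon J \<and> J \<subseteq> I 0 \<longrightarrow> J = I 0)"
    using ideal_I sub by blast
  show "M = I 0" if "sg_ideal Kmon M \<and> (\<forall>J. sg_ideal Kmon J \<and> J \<subseteq> M \<longrightarrow> J = M)" for M
    using that ideal_I sub by blast
qed

lemma principal_eq:
  assumes "a \<in> D"
  shows "principal Kmon a = {x \<in> D. prank x \<le> prank a}"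
proof (intro subset_antisym subsetI)
  fix x assume "x \<in> principal Kmon a"
  then obtain s t where "s \<in> D" "t \<in> D" "x = s \<cdot> a \<cdot> t" unfolding principal_def by auto
  then show "x \<in> {x \<in> D. prank x \<le> prank a}" using assms prank_mid by simp
next
  fix x assume "x \<in> {x \<in> D. prank x \<le> prank a}"
  then obtain u v where "u \<in> D" "v \<in> D" "x = u \<cdot> a \<cdot> v" using J_below[OF assms, of x] by blast
  then show "x \<in> principal Kmon a" unfolding principal_def by auto
qed

lemma green_J_iff: "(a, b) \<in> green_J Kmon \<longleftrightarrow> a \<in> D \<and> b \<in> D \<and> prank a = prank b"
proof -
  have le: "prank a \<le> prank b" if "a \<in> D" "b \<in> D" "principal Kmon a = principal Kmon b" for a b
  proof -
    have "a \<in> principal Kmon a" using that(1) principal_eq[OF that(1)] by simp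
    then show ?thesis unfolding that(3) principal_eq[OF that(2)] by simp
  qed
  have eq: "principal Kmon a = principal Kmon b" if "a \<in> D" "b \<in> D" "prank a = prank b"
    unfolding principal_eq[OF that(1)] principal_eq[OF that(2)] that(3) ..
  have "(a, b) \<in> green_J Kmon \<longleftrightarrow> a \<in> D \<and> b \<in> D \<and> principal Kmon a = principal Kmon b"
    by (simp add: green_J_def)
  then show ?thesis using eq le[of a b] le[of b a] by (metis antisym)
qed

lemma J_classes_eq: "J_classes Kmon = (\<lambda>q. {x \<in> D. prank x = q}) ` {..n}"
proof -
  have c: "green_J Kmon `` {a} = {x \<in> D. prank x = prank a}" if "a \<in> D" for a
    using that green_J_iff by auto
  have "J_classes Kmon = (\<lambda>a. {x \<in> D. prank x = prank a}) ` D"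
    unfolding J_classes_def quotient_def using c by auto
  also have "\<dots> = (\<lambda>q. {x \<in> D. prank x = q}) ` prank ` D" by (simp add: image_image)
  also have "prank ` D = {..n}"
  proof (intro subset_antisym subsetI)
    fix q assume "q \<in> {..n}"
    then show "q \<in> prank ` D" using e_D[of q] prank_e[of q] by (metis atMost_iff image_eqI)
  qed (use prank_le_n in auto)
  finally show ?thesis .
qed

text \<open>An element \<open>x\<close> of rank 0 with the lower pattern of \<open>a\<close> equals
  \<open>x \<cdot> a\<close>, so the left multiples of \<open>a\<close> are exactly these
  elements.\<close>

lemma green_L_iff:
  assumes "a \<in> D" "b \<in> D" "prank a = 0" "prank b = 0"
  shows "(a, b) \<in> green_L Kmon \<longleftrightarrow> same_lo a b"
proof -
  have lp: "left_principal Kmon a = {x \<in> D. prank x = 0 \<and> same_lo x a}" if "a \<in> D" "prank a = 0" for a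
  proof (intro subset_antisym subsetI)
    fix x assume "x \<in> left_principal Kmon a"
    then show "x \<in> {x \<in> D. prank x = 0 \<and> same_lo x a}"
      using that unfolding left_principal_def by (auto simp: prank_mul_0 same_lo_mul)
  next
    fix x assume x: "x \<in> {x \<in> D. prank x = 0 \<and> same_lo x a}"
    have "same_lo x (x \<cdot> a)"
      using x same_lo_trans[OF _ same_lo_sym[OF same_lo_mul[of a x]]] that by auto
    then have "x = x \<cdot> a"
      using x that same_up_sym[OF same_up_mul[of x a]] by (intro rank_0_eqI) (auto simp: prank_mul_0)
    then show "x \<in> left_principal Kmon a" using x unfolding left_principal_def by auto
  qed
  have "(a, b) \<in> green_L Kmon \<longleftrightarrow> left_principal Kmon a = left_principal Kmon b"
    using assms(1,2) by (simp add: green_L_def)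
  also have "\<dots> \<longleftrightarrow> same_lo a b"
  proof
    assume eq: "left_principal Kmon a = left_principal Kmon b"
    have "a \<in> left_principal Kmon a" unfolding lp[OF assms(1,3)] using assms by simp
    then show "same_lo a b" unfolding eq lp[OF assms(2,4)] by simp
  next
    assume "same_lo a b"
    then have "same_lo x a \<longleftrightarrow> same_lo x b" for x using same_lo_trans same_lo_sym by blast
    then show "left_principal Kmon a = left_principal Kmon b"
      unfolding lp[OF assms(1,3)] lp[OF assms(2,4)] by simp
  qed
  finally show ?thesis .
qed

lemma green_R_iff:
  assumes "a \<in> D" "b \<in> D" "prank a = 0" "prank b = 0"
  shows "(a, b) \<in> green_R Kmon \<longleftrightarrow> same_up a b"
proof -
  have rp: "right_principal Kmon a = {x \<in> D. prank x = 0 \<and> same_up x a}" if "a \<in> D" "prank a = 0" for a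
  proof (intro subset_antisym subsetI)
    fix x assume "x \<in> right_principal Kmon a"
    then show "x \<in> {x \<in> D. prank x = 0 \<and> same_up x a}"
      using that unfolding right_principal_def by (auto simp: prank_mul_0 same_up_mul)
  next
    fix x assume x: "x \<in> {x \<in> D. prank x = 0 \<and> same_up x a}"
    have "same_up x (a \<cdot> x)"
      using x same_up_trans[OF _ same_up_sym[OF same_up_mul[of a x]]] that by auto
    then have "x = a \<cdot> x"
      using x that same_lo_sym[OF same_lo_mul[of x a]] by (intro rank_0_eqI) (auto simp: prank_mul_0)
    then show "x \<in> right_principal Kmon a" using x unfolding right_principal_def by auto
  qed
  have "(a, b) \<in> green_R Kmon \<longleftrightarrow> right_principal Kmon a = right_principal Kmon b"
    using assms(1,2) by (simp add: green_R_def)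
  also have "\<dots> \<longleftrightarrow> same_up a b"
  proof
    assume eq: "right_principal Kmon a = right_principal Kmon b"
    have "a \<in> right_principal Kmon a" unfolding rp[OF assms(1,3)] using assms by simp
    then show "same_up a b" unfolding eq rp[OF assms(2,4)] by simp
  next
    assume "same_up a b"
    then have "same_up x a \<longleftrightarrow> same_up x b" for x using same_up_trans same_up_sym by blast
    then show "right_principal Kmon a = right_principal Kmon b"
      unfolding rp[OF assms(1,3)] rp[OF assms(2,4)] by simp
  qed
  finally show ?thesis .
qed

subsection \<open>Retractions\<close>

text \<open>For \<open>m\<close> in the minimal ideal, \<open>x \<cdot> m\<close> lies there as well
  and is fixed by \<open>f\<close>; as \<open>f\<close> is a homomorphism fixing \<open>m\<close>,
  it equals \<open>f x \<cdot> m\<close>.\<close>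

lemma retraction_mul:
  assumes f: "is_retraction Kmon (I q) f" and x: "x \<in> I q" and m: "m \<in> D" "prank m = 0"
  shows "f x \<in> D" "prank (f x) = 0" "f x \<cdot> m = x \<cdot> m" "m \<cdot> f x = m \<cdot> x"
proof -
  have hom: "f \<in> hom (Kmon\<lparr>carrier := I q\<rparr>) (Kmon\<lparr>carrier := I 0\<rparr>)" and id: "\<And>m. m \<in> I 0 \<Longrightarrow> f m = m"
    using f unfolding is_retraction_def min_ideal_eq by auto
  have "f x \<in> I 0" using hom x by (auto simp: hom_def)
  then show fx: "f x \<in> D" "prank (f x) = 0" by (simp_all add: mem_I)
  have mul: "f (y \<cdot> z) = f y \<cdot> f z" if "y \<in> I q" "z \<in> I q" for y z
    using hom that by (auto simp: hom_def)
  have m0: "m \<in> I 0" "m \<in> I q" "x \<cdot> m \<in> I 0" "m \<cdot> x \<in> I 0"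
    using m x by (simp_all add: mem_I prank_mul_0)
  show "f x \<cdot> m = x \<cdot> m" using mul[OF x m0(2)] id[OF m0(1)] id[OF m0(3)] by simp
  show "m \<cdot> f x = m \<cdot> x" using mul[OF m0(2) x] id[OF m0(1)] id[OF m0(4)] by simp
qed

lemma retr_retraction:
  assumes "q \<le> 1"
  shows "is_retraction Kmon (I q) retr"
  unfolding is_retraction_def min_ideal_eq hom_def
proof (intro conjI CollectI ballI)
  show "retr \<in> carrier (Kmon\<lparr>carrier := I q\<rparr>) \<rightarrow> carrier (Kmon\<lparr>carrier := I 0\<rparr>)"
    by (auto simp: mem_I)
  show "retr x = x" if "x \<in> I 0" for x using that retr_0 by (simp add: mem_I)
  fix x y assume "x \<in> carrier (Kmon\<lparr>carrier := I q\<rparr>)" "y \<in> carrier (Kmon\<lparr>carrier := I q\<rparr>)"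
  then have xy: "x \<in> D" "y \<in> D" "prank x \<le> 1" "prank y \<le> 1" using assms by (auto simp: mem_I)
  have r: "prank (x \<cdot> y) \<le> 1" using prank_left[OF xy(1), of y] xy(3) by simp
  have "retr x \<cdot> retr y = retr (x \<cdot> y)"
  proof (rule retr_unique)
    show "same_up (retr x \<cdot> retr y) (x \<cdot> y)"
      using same_up_trans[OF same_up_mul[of "retr x" "retr y"] same_up_trans[OF same_up_retr[OF xy(1,3)] same_up_sym[OF same_up_mul[OF xy(1,3)]]]] xy
      by simp
    show "same_lo (retr x \<cdot> retr y) (x \<cdot> y)"
      using same_lo_trans[OF same_lo_mul[of "retr y" "retr x"] same_lo_trans[OF same_lo_retr[OF xy(2,4)] same_lo_sym[OF same_lo_mul[OF xy(2,4)]]]] xy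
      by simp
  qed (use xy r in \<open>simp_all add: prank_mul_0\<close>)
  then show "retr (x \<otimes>\<^bsub>Kmon\<lparr>carrier := I q\<rparr>\<^esub> y) = retr x \<otimes>\<^bsub>Kmon\<lparr>carrier := I 0\<rparr>\<^esub> retr y" by simp
qed

text \<open>Multiplying the chosen retraction by \<open>z0\<close> on either side reveals both of
  its patterns, so the choice is forced on the ideal.\<close>

lemma the_retraction_eq:
  assumes "q \<le> 1" "x \<in> I q"
  shows "the_retraction Kmon (I q) x = retr x"
proof -
  have f: "is_retraction Kmon (I q) (the_retraction Kmon (I q))"
    unfolding the_retraction_def by (rule someI[where P = "is_retraction Kmon (I q)", OF retr_retraction[OF assms(1)]])
  note m = retraction_mul[OF f assms(2) z0_D prank_z0]
  have x: "x \<in> D" "prank x \<le> 1" using assms by (simp_all add: mem_I)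
  show ?thesis
  proof (rule retr_unique[OF x m(1,2)])
    show "same_up (the_retraction Kmon (I q) x) x"
      using same_up_trans[OF same_up_sym[OF same_up_mul[OF m(1)]], of z0 x] same_up_mul[OF x, of z0] m(2,3) by simp
    show "same_lo (the_retraction Kmon (I q) x) x"
      using same_lo_trans[OF same_lo_sym[OF same_lo_mul[OF m(1)]], of z0 x] same_lo_mul[OF x, of z0] m(2,4) by simp
  qed
qed

text \<open>Above rank 1, the image \<open>g\<close> of \<open>e {1, 2}\<close> would have rank 0,
  so all its right multiples would have one upper pattern; but \<open>g \<cdot> cap\<close> and
  \<open>g \<cdot> z0\<close> equal the corresponding multiples of \<open>e {1, 2}\<close>, which
  differ.\<close>

lemma retractable_iff: "retractable Kmon (I q) \<longleftrightarrow> q \<le> 1"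
proof
  assume "retractable Kmon (I q)"
  then obtain f where f: "is_retraction Kmon (I q) f" unfolding retractable_def by blast
  show "q \<le> 1"
  proof (rule ccontr)
    assume "\<not> q \<le> 1"
    then have E: "e {1, 2} \<in> I q" using pid12 by (simp add: mem_I del: One_nat_def)
    define g where "g = f (e {1, 2})"
    have g: "g \<in> D" "prank g = 0" "g \<cdot> cap = e {1, 2} \<cdot> cap" "g \<cdot> z0 = e {1, 2} \<cdot> z0"
      unfolding g_def using retraction_mul[OF f E z0_D prank_z0] retraction_mul(3)[OF f E cap_D prank_cap]
      by simp_all
    have "linked (g \<cdot> m) (Upper 1) (Upper 2) \<longleftrightarrow> linked g (Upper 1) (Upper 2)" for m
      using same_up_mul[OF g(1), of m] g(2) unfolding same_up_def by simp
    then show False using pid12_up unfolding g(3,4)[symmetric] by blast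
  qed
next
  assume "q \<le> 1"
  then show "retractable Kmon (I q)" unfolding retractable_def using ideal_I retr_retraction by blast
qed

subsection \<open>Retractable IN-pairs\<close>

lemma e_idem: "q \<le> n \<Longrightarrow> e {1..q} \<cdot> e {1..q} = e {1..q}"
  by (rule pid_idem) auto

text \<open>The idempotent \<open>E\<close> must be the identity of any subgroup that contains it.
  So a member \<open>x\<close> satisfies \<open>E \<cdot> x \<cdot> E = x\<close>, and having an
  inverse it has rank \<open>q\<close>; rigidity then gives \<open>x = E\<close>.\<close>

lemma maximal_subgroup_e:
  assumes q: "q \<le> n"
  defines "E \<equiv> e {1..q}"
  shows "maximal_subgroup Kmon {E} E"
proof -
  have X: "{1..q} \<subseteq> {1..n}" using q by auto
  have ED: "E \<in> D" "prank E = q" and EE: "E \<cdot> E = E" using q e_idem unfolding E_def by (simp_all del: One_nat_def)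
  have "group (Kmon\<lparr>carrier := {E}, one := E\<rparr>)"
    by (rule groupI) (auto simp: EE)
  then have "sg_subgroup Kmon {E} E" unfolding sg_subgroup_def using ED by simp
  moreover have "G' = {E}" if G': "sg_subgroup Kmon G' e'" and sub: "{E} \<subseteq> G'" for G' e'
  proof -
    let ?G = "Kmon\<lparr>carrier := G', one := e'\<rparr>"
    interpret G: group ?G using G' unfolding sg_subgroup_def by blast
    have GD: "G' \<subseteq> D" using G' unfolding sg_subgroup_def by simp
    have Ee: "E = e'" using G.l_cancel_one[of E E] sub EE by simp
    have "x = E" if x: "x \<in> G'" for x
    proof -
      have xD: "x \<in> D" using x GD by blast
      have xE: "E \<cdot> x = x" "x \<cdot> E = x" using G.l_one[of x] G.r_one[of x] x Ee by simp_all
      obtain y where y: "y \<in> G'" "x \<cdot> y = E" using G.r_inv_ex[of x] x Ee by auto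
      have "q \<le> prank x" using prank_left[OF xD, of y] y(2) ED(2) by simp
      moreover have "prank x \<le> q" using prank_left[OF ED(1), of x] xE(1) ED(2) by simp
      ultimately have r: "prank x = q" by simp
      have c: "E \<cdot> x \<cdot> E = x" "E \<cdot> E \<cdot> E = E" using xE EE by simp_all
      have conf: "confined x {1..q} {1..q}" "confined E {1..q} {1..q}"
        using confined_cut[OF xD X X] confined_cut[OF ED(1) X X] c unfolding E_def by simp_all
      show ?thesis by (rule rigid[OF xD conf(1) ED(1) conf(2)]) (use r ED in simp_all)
    qed
    then show ?thesis using sub by blast
  qed
  ultimately show ?thesis unfolding maximal_subgroup_def by blast
qed

text \<open>The \<open>J\<close>-classes are the rank levels, so the minimal one outside
  \<open>I r\<close> has rank \<open>r + 1\<close>, and the given idempotent lies in it only if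
  \<open>q = r + 1\<close>.\<close>

lemma IN_pair_iff:
  assumes q: "q \<le> n"
  shows "IN_pair Kmon J {id_bar n q} \<longleftrightarrow> 1 \<le> q \<and> J = I (q - 1)"
proof -
  define E where "E = e {1..q}"
  have E: "id_bar n q = E" using id_bar_eq[OF q] by (simp add: E_def)
  have ED: "E \<in> D" "prank E = q" using q unfolding E_def by (simp_all del: One_nat_def)
  have le: "J_class_le Kmon {x \<in> D. prank x = a} {x \<in> D. prank x = b} \<longleftrightarrow> a \<le> b" if "a \<le> n" "b \<le> n" for a b
  proof
    assume "J_class_le Kmon {x \<in> D. prank x = a} {x \<in> D. prank x = b}"
    then show "a \<le> b" unfolding J_class_le_def using principal_eq by fastforce
  next
    assume "a \<le> b"
    then have "e {1..a} \<in> principal Kmon (e {1..b})" using that principal_eq[of "e {1..b}"] by (simp del: One_nat_def)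
    then show "J_class_le Kmon {x \<in> D. prank x = a} {x \<in> D. prank x = b}"
      unfolding J_class_le_def using that e_D prank_e by blast
  qed
  have outside: "{x \<in> D. prank x = a} \<subseteq> carrier Kmon - I r \<longleftrightarrow> r < a" if "a \<le> n" for a r
  proof
    assume "{x \<in> D. prank x = a} \<subseteq> carrier Kmon - I r"
    moreover have "e {1..a} \<in> {x \<in> D. prank x = a}" using that by (simp del: One_nat_def)
    ultimately have "e {1..a} \<notin> I r" by blast
    then show "r < a" using that by (simp add: mem_I del: One_nat_def)
  qed (auto simp: mem_I)
  have inj: "a = b" if "{x \<in> D. prank x = a} = {x \<in> D. prank x = b}" "a \<le> n" for a b
  proof -
    have "e {1..a} \<in> {x \<in> D. prank x = b}"
      unfolding that(1)[symmetric] using e_D[OF that(2)] prank_e[OF that(2)] by blast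
    then have "prank (e {1..a}) = b" by blast
    then show ?thesis using prank_e[OF that(2)] by (rule trans[OF sym, rotated])
  qed
  show ?thesis
    unfolding E
  proof
    assume "IN_pair Kmon J {E}"
    note IN = this[unfolded IN_pair_def]
    have J: "sg_ideal Kmon J" by (rule IN[THEN conjunct1])
    obtain C G e' where C: "C \<in> J_classes Kmon" "C \<subseteq> carrier Kmon - J"
      and minC: "\<forall>J'\<in>J_classes Kmon. J' \<subseteq> carrier Kmon - J \<and> J_class_le Kmon J' C \<longrightarrow> J' = C"
      and G: "G \<subseteq> C" "{E} \<lhd> Kmon\<lparr>carrier := G, one := e'\<rparr>"
      using IN[THEN conjunct2] by (elim exE conjE) (rule that; assumption)
    note min = minC[rule_format, OF _ conjI]
    obtain r where r: "r \<le> n" "J = I r" using J ideal_iff by blast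
    obtain j where j: "j \<le> n" "C = {x \<in> D. prank x = j}" using C(1) unfolding J_classes_eq by auto
    have "r < j" using C(2) outside[OF j(1)] unfolding j(2) r(2) by blast
    have "{x \<in> D. prank x = r + 1} = C"
    proof (rule min)
      show "{x \<in> D. prank x = r + 1} \<in> J_classes Kmon" using \<open>r < j\<close> j(1) unfolding J_classes_eq by auto
      show "{x \<in> D. prank x = r + 1} \<subseteq> carrier Kmon - J" unfolding r(2) by (auto simp: mem_I)
      show "J_class_le Kmon {x \<in> D. prank x = r + 1} C"
        unfolding j(2) using le[of "r + 1" j] \<open>r < j\<close> j(1) by simp
    qed
    then have "r + 1 = j" using inj[of "r + 1" j] j \<open>r < j\<close> by simp
    have "{E} \<subseteq> carrier (Kmon\<lparr>carrier := G, one := e'\<rparr>)"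
      by (rule subgroup.subset[OF normal_imp_subgroup[OF G(2)]])
    then have "E \<in> C" using G(1) by auto
    then have "q = j" using ED(2) j(2) by simp
    then show "1 \<le> q \<and> J = I (q - 1)" using \<open>r + 1 = j\<close> r(2) by auto
  next
    assume a: "1 \<le> q \<and> J = I (q - 1)"
    let ?C = "{x \<in> D. prank x = q}"
    show "IN_pair Kmon J {E}"
      unfolding IN_pair_def
    proof (rule conjI, goal_cases)
      case 2
      show ?case
      proof (rule exI[of _ ?C], rule exI[of _ "{E}"], rule exI[of _ E], intro conjI)
      show "?C \<in> J_classes Kmon" using q unfolding J_classes_eq by auto
      show "\<forall>x\<in>?C. regular_element Kmon x" using D_regular unfolding regular_element_def by simp
      show "?C \<subseteq> carrier Kmon - J" using a outside[OF q] by simp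
      show "\<forall>J'\<in>J_classes Kmon. J' \<subseteq> carrier Kmon - J \<and> J_class_le Kmon J' ?C \<longrightarrow> J' = ?C"
      proof (intro ballI impI)
        fix J' assume J': "J' \<in> J_classes Kmon" and c: "J' \<subseteq> carrier Kmon - J \<and> J_class_le Kmon J' ?C"
        obtain j where j: "j \<le> n" "J' = {x \<in> D. prank x = j}" using J' unfolding J_classes_eq by auto
        have "q - 1 < j" using c outside[OF j(1)] a unfolding j(2) by blast
        moreover have "j \<le> q" using c le[OF j(1) q] unfolding j(2) by blast
        ultimately have "j = q" by linarith
        then show "J' = ?C" using j(2) by simp
      qed
      show max: "maximal_subgroup Kmon {E} E" unfolding E_def by (rule maximal_subgroup_e[OF q])
      show "{E} \<subseteq> ?C" using ED by simp
      have "group (Kmon\<lparr>carrier := {E}, one := E\<rparr>)"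
        using max unfolding maximal_subgroup_def sg_subgroup_def by blast
      from group.one_is_normal[OF this] show "{E} \<lhd> Kmon\<lparr>carrier := {E}, one := E\<rparr>" by simp
      qed
    qed (use a ideal_I in simp)
  qed
qed

lemma retractable_IN_pair_iff:
  assumes q: "q \<le> n"
  shows "retractable_IN_pair Kmon J {id_bar n q} \<longleftrightarrow> q \<in> {1, 2} \<and> J = I (q - 1)"
proof -
  have "card (x <#\<^bsub>Kmon\<^esub> {id_bar n q}) = 1" "card ({id_bar n q} #>\<^bsub>Kmon\<^esub> x) = 1" for x
    by (simp_all add: l_coset_def r_coset_def)
  then show ?thesis
    unfolding retractable_IN_pair_def IN_pair_iff[OF q] using retractable_iff[of "q - 1"] by auto
qed

lemma retractable_IN_pairs:
  "{(J, N). retractable_IN_pair Kmon J N \<and> (\<exists>q\<le>n. N = {id_bar n q})} =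
    {(I 0, {id_bar n 1}), (I 1, {id_bar n 2})}"
proof (intro subset_antisym subrelI)
  fix J N assume "(J, N) \<in> {(J, N). retractable_IN_pair Kmon J N \<and> (\<exists>q\<le>n. N = {id_bar n q})}"
  then obtain q where q: "q \<le> n" "N = {id_bar n q}" "retractable_IN_pair Kmon J {id_bar n q}" by auto
  then have "q \<in> {1, 2} \<and> J = I (q - 1)" using retractable_IN_pair_iff by blast
  then show "(J, N) \<in> {(I 0, {id_bar n 1}), (I 1, {id_bar n 2})}" using q(2) by auto
next
  fix J N assume "(J, N) \<in> {(I 0, {id_bar n 1}), (I 1, {id_bar n 2})}"
  then have "J = I 0 \<and> N = {id_bar n 1} \<or> J = I 1 \<and> N = {id_bar n 2}" by blast
  moreover have "retractable_IN_pair Kmon (I 0) {id_bar n 1}" "retractable_IN_pair Kmon (I 1) {id_bar n 2}"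
    using retractable_IN_pair_iff[of 1 "I 0"] retractable_IN_pair_iff[of 2 "I 1"] n2 by auto
  ultimately show "(J, N) \<in> {(J, N). retractable_IN_pair Kmon J N \<and> (\<exists>q\<le>n. N = {id_bar n q})}"
    using n2 by (auto intro: exI[of _ 1] exI[of _ 2])
qed

subsection \<open>The lattice of congruences\<close>

text \<open>The flags of \<open>fam\<close> for each corner of the diamond: \<lambda> compares
  retracts by \<open>L\<close>, thus by lower patterns, and \<rho> by \<open>R\<close>, thus by
  upper patterns. Fewer requirements mean a larger congruence.\<close>

fun needs_up :: "diamond \<Rightarrow> bool" where
  "needs_up Mu = True" | "needs_up Lambda = False" | "needs_up Rho = True" | "needs_up Rees = False"

fun needs_lo :: "diamond \<Rightarrow> bool" where
  "needs_lo Mu = True" | "needs_lo Lambda = True" | "needs_lo Rho = False" | "needs_lo Rees = False"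

lemma xi_Rees: "xi n Kmon Rees q = fam False False q"
  by (auto simp: rees_cong_def mem_I fam_def)

lemma xi_eq:
  assumes "i \<in> {0, 1}"
  shows "xi n Kmon d i = fam (needs_up d) (needs_lo d) i"
proof -
  define E where "E = id_bar n (i + 1)"
  have ED: "E \<in> D" using assms n2 id_bar_eq[of "i + 1"] e_D[of "i + 1"] unfolding E_def by auto
  have i1: "i \<le> 1" using assms by auto
  \<comment> \<open>With a one-element group the two coordinates of a pair in \<open>nu\<close> are
    the same product, so this part disappears in the diagonal.\<close>
  have nu: "nu Kmon {E} \<subseteq> Id_on D" unfolding nu_def using ED by auto
  have r: "the_retraction Kmon (I i) x = retr x" if "x \<in> I i" for x by (rule the_retraction_eq[OF i1 that])
  have up: "same_up (retr x) (retr y) \<longleftrightarrow> same_up x y" if "x \<in> I i" "y \<in> I i" for x y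
    using same_up_retr[of x] same_up_retr[of y] that i1 same_up_trans same_up_sym unfolding mem_I by (meson order_trans)
  have lo: "same_lo (retr x) (retr y) \<longleftrightarrow> same_lo x y" if "x \<in> I i" "y \<in> I i" for x y
    using same_lo_retr[of x] same_lo_retr[of y] that i1 same_lo_trans same_lo_sym unfolding mem_I by (meson order_trans)
  have L: "(the_retraction Kmon (I i) x, the_retraction Kmon (I i) y) \<in> green_L Kmon \<longleftrightarrow> same_lo x y"
    if "x \<in> I i" "y \<in> I i" for x y
    using that r lo green_L_iff[of "retr x" "retr y"] by (simp add: mem_I)
  have R: "(the_retraction Kmon (I i) x, the_retraction Kmon (I i) y) \<in> green_R Kmon \<longleftrightarrow> same_up x y"
    if "x \<in> I i" "y \<in> I i" for x y
    using that r up green_R_iff[of "retr x" "retr y"] by (simp add: mem_I)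
  have fam: "fam u l i = Id_on D \<union> {(x, y) \<in> I i \<times> I i. (u \<longrightarrow> same_up x y) \<and> (l \<longrightarrow> same_lo x y)}" for u l
    by (auto simp: fam_def mem_I)
  have absorb: "Id_on D \<union> nu Kmon {E} \<union> A = Id_on D \<union> A" for A using nu by blast
  show ?thesis
  proof (cases d)
    case Mu
    have "{(x, y) \<in> I i \<times> I i. (the_retraction Kmon (I i) x, the_retraction Kmon (I i) y) \<in> green_H Kmon} =
        {(x, y) \<in> I i \<times> I i. same_up x y \<and> same_lo x y}"
      using L R unfolding green_H_def by auto
    then show ?thesis unfolding Mu xi.simps mu_cong_def Kmon_simps E_def[symmetric] absorb fam by simp
  next
    case Lambda
    have "{(x, y) \<in> I i \<times> I i. (the_retraction Kmon (I i) x, the_retraction Kmon (I i) y) \<in> green_L Kmon} =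
        {(x, y) \<in> I i \<times> I i. same_lo x y}"
      using L by auto
    then show ?thesis unfolding Lambda xi.simps lambda_cong_def Kmon_simps E_def[symmetric] absorb fam by simp
  next
    case Rho
    have "{(x, y) \<in> I i \<times> I i. (the_retraction Kmon (I i) x, the_retraction Kmon (I i) y) \<in> green_R Kmon} =
        {(x, y) \<in> I i \<times> I i. same_up x y}"
      using R by auto
    then show ?thesis unfolding Rho xi.simps rho_cong_def Kmon_simps E_def[symmetric] absorb fam by simp
  next
    case Rees
    then show ?thesis using xi_Rees by simp
  qed
qed

lemma diamond_le_iff: "diamond_le x y \<longleftrightarrow> (needs_up y \<longrightarrow> needs_up x) \<and> (needs_lo y \<longrightarrow> needs_lo x)"
  unfolding diamond_le_def by (cases x; cases y) simp_all

lemma sg_congruence_iff: "sg_congruence Kmon \<xi> \<longleftrightarrow>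
    (\<exists>q\<le>n. \<xi> = fam False False q) \<or> (\<exists>u l. \<exists>i\<in>{0, 1}. \<xi> = fam u l i)"
proof -
  have "sg_congruence Kmon \<xi> \<longleftrightarrow> is_cong \<xi>" unfolding sg_congruence_def is_cong_def by simp
  then show ?thesis using is_cong_cases[of \<xi>] is_cong_fam by auto
qed

lemma star_congruence_iff: "star_congruence Kmon pstar \<xi> \<longleftrightarrow>
    (\<exists>q\<le>n. \<xi> = fam False False q) \<or> (\<exists>i\<in>{0, 1}. \<xi> = fam True True i)"
proof
  assume st: "star_congruence Kmon pstar \<xi>"
  have c: "sg_congruence Kmon \<xi>" and s: "\<forall>(x, y) \<in> \<xi>. (pstar x, pstar y) \<in> \<xi>"
    by (rule st[unfolded star_congruence_def, THEN conjunct1])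
       (rule st[unfolded star_congruence_def, THEN conjunct2])
  from c consider q where "q \<le> n" "\<xi> = fam False False q" | u l i where "i \<in> {0, 1}" "\<xi> = fam u l i"
    unfolding sg_congruence_iff by metis
  then show "(\<exists>q\<le>n. \<xi> = fam False False q) \<or> (\<exists>i\<in>{0, 1}. \<xi> = fam True True i)"
  proof cases
    case (1 q)
    then show ?thesis by metis
  next
    case (2 u l i)
    have "u = l" using s unfolding 2(2) fam_star_closed_iff .
    moreover have "i \<le> n" using 2(1) n2 by auto
    ultimately show ?thesis using 2 by (cases u) metis+
  qed
next
  assume r: "(\<exists>q\<le>n. \<xi> = fam False False q) \<or> (\<exists>i\<in>{0, 1}. \<xi> = fam True True i)"
  then obtain u i where \<xi>: "\<xi> = fam u u i" by metis
  have "sg_congruence Kmon \<xi>" unfolding sg_congruence_iff using r by metis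
  moreover have "\<forall>(x, y) \<in> \<xi>. (pstar x, pstar y) \<in> \<xi>" unfolding \<xi> fam_star_closed_iff ..
  ultimately show "star_congruence Kmon pstar \<xi>" unfolding star_congruence_def by (rule conjI)
qed


text \<open>Once all relations are written as members of \<open>fam\<close>, distinctness and
  inclusion reduce to comparing two flags and a number.\<close>

lemma congruence_lattice:
  "({I. sg_ideal Kmon I} = {rank_ideal Kmon q | q. q \<le> n})
   \<and> ({(I, N). retractable_IN_pair Kmon I N \<and> (\<exists>q \<le> n. N = {id_bar n q})} =
       {(rank_ideal Kmon 0, {id_bar n 1}), (rank_ideal Kmon 1, {id_bar n 2})})
   \<and> (distinct (map (xi n Kmon Rees) [0..<n + 1] @
        [xi n Kmon Lambda 0, xi n Kmon Rho 0, xi n Kmon Mu 0, xi n Kmon Lambda 1, xi n Kmon Rho 1, xi n Kmon Mu 1])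
      \<and> {\<xi>. sg_congruence Kmon \<xi>} =
        {xi n Kmon Rees q | q. q \<le> n} \<union>
        {xi n Kmon Lambda 0, xi n Kmon Rho 0, xi n Kmon Mu 0, xi n Kmon Lambda 1, xi n Kmon Rho 1, xi n Kmon Mu 1})
   \<and> ({\<xi>. star_congruence Kmon pstar \<xi>} =
       {\<xi>. sg_congruence Kmon \<xi>} - {xi n Kmon Lambda 0, xi n Kmon Lambda 1, xi n Kmon Rho 0, xi n Kmon Rho 1})
   \<and> ((\<forall>\<xi> \<zeta>. \<forall>i \<in> {0, 1}. \<forall>j \<in> {0, 1}.
         xi n Kmon \<xi> i \<subseteq> xi n Kmon \<zeta> j \<longleftrightarrow> diamond_le \<xi> \<zeta> \<and> i \<le> j)
      \<and> xi n Kmon Mu 0 = Id_on (carrier Kmon)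
      \<and> (\<forall>q. 1 \<le> q \<and> q < n \<longrightarrow> xi n Kmon Rees q \<subset> xi n Kmon Rees (q + 1))
      \<and> xi n Kmon Rees n = carrier Kmon \<times> carrier Kmon)
   \<and> ({\<xi>. star_congruence Kmon pstar \<xi>} =
        {xi n Kmon Mu 0, xi n Kmon Mu 1, xi n Kmon Rees 0} \<union> {xi n Kmon Rees q | q. 1 \<le> q \<and> q \<le> n}
      \<and> xi n Kmon Mu 0 \<subset> xi n Kmon Mu 1 \<and> xi n Kmon Mu 0 \<subset> xi n Kmon Rees 0
      \<and> xi n Kmon Mu 1 \<subset> xi n Kmon Rees 1 \<and> xi n Kmon Rees 0 \<subset> xi n Kmon Rees 1
      \<and> \<not> xi n Kmon Mu 1 \<subseteq> xi n Kmon Rees 0 \<and> \<not> xi n Kmon Rees 0 \<subseteq> xi n Kmon Mu 1)"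
proof -
  have x: "xi n Kmon Mu 0 = fam True True 0" "xi n Kmon Mu 1 = fam True True 1"
    "xi n Kmon Lambda 0 = fam False True 0" "xi n Kmon Lambda 1 = fam False True 1"
    "xi n Kmon Rho 0 = fam True False 0" "xi n Kmon Rho 1 = fam True False 1"
    "xi n Kmon Rees = fam False False"
    using xi_eq[of 0] xi_eq[of 1] by (simp_all add: xi_Rees fun_eq_iff del: xi.simps)
  have n01: "0 \<le> n" "1 \<le> n" using n2 by simp_all
  have psub: "fam u l i \<subset> fam u' l' j \<longleftrightarrow> (u' \<longrightarrow> u) \<and> (l' \<longrightarrow> l) \<and> i \<le> j \<and> \<not> (u = u' \<and> l = l' \<and> i = j)"
    if "i \<le> n" "j \<le> n" for u l i u' l' j
    unfolding psubset_eq fam_subset_iff[OF that] fam_eq_iff[OF that] by blast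
  have 1: "{I. sg_ideal Kmon I} = {rank_ideal Kmon q | q. q \<le> n}"
    using ideal_iff by blast
  have 3: "distinct (map (fam False False) [0..<n + 1] @
      [fam False True 0, fam True False 0, fam True True 0, fam False True 1, fam True False 1, fam True True 1])"
  proof -
    have "inj_on (fam False False) {0..<n + 1}"
      by (rule inj_onI) (simp add: fam_eq_iff)
    moreover have "fam u l i \<noteq> fam False False q" if "q < n + 1" "i \<le> 1" "u \<or> l" for q u l i
      using that n2 fam_eq_iff[of i q] by auto
    ultimately show ?thesis
      using fam_eq_iff[OF n01(1) n01(1)] fam_eq_iff[OF n01(1) n01(2)] fam_eq_iff[OF n01(2) n01(1)] fam_eq_iff[OF n01(2) n01(2)]
      by (auto simp: distinct_map simp del: upt_Suc)
  qed
  have 4: "{\<xi>. sg_congruence Kmon \<xi>} = {fam False False q | q. q \<le> n} \<union>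
      {fam False True 0, fam True False 0, fam True True 0, fam False True 1, fam True False 1, fam True True 1}"
  proof (intro subset_antisym subsetI)
    fix \<xi> assume "\<xi> \<in> {\<xi>. sg_congruence Kmon \<xi>}"
    then consider q where "q \<le> n" "\<xi> = fam False False q" | u l i where "i \<in> {0, 1}" "\<xi> = fam u l i"
      unfolding mem_Collect_eq sg_congruence_iff by metis
    then show "\<xi> \<in> {fam False False q | q. q \<le> n} \<union>
      {fam False True 0, fam True False 0, fam True True 0, fam False True 1, fam True False 1, fam True True 1}"
    proof cases
      case (2 u l i)
      then have "i \<le> n" using n2 by auto
      then show ?thesis using 2 by (cases u; cases l) auto
    qed blast
  next
    fix \<xi> assume "\<xi> \<in> {fam False False q | q. q \<le> n} \<union>
      {fam False True 0, fam True False 0, fam True True 0, fam False True 1, fam True False 1, fam True True 1}"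
    then have "(\<exists>q\<le>n. \<xi> = fam False False q) \<or> (\<exists>u l. \<exists>i\<in>{0, 1}. \<xi> = fam u l i)" by blast
    then show "\<xi> \<in> {\<xi>. sg_congruence Kmon \<xi>}" by (simp only: sg_congruence_iff mem_Collect_eq)
  qed
  have 5: "{\<xi>. star_congruence Kmon pstar \<xi>} =
      {fam True True 0, fam True True 1, fam False False 0} \<union> {fam False False q | q. 1 \<le> q \<and> q \<le> n}"
  proof (intro subset_antisym subsetI)
    fix \<xi> assume "\<xi> \<in> {\<xi>. star_congruence Kmon pstar \<xi>}"
    then consider q where "q \<le> n" "\<xi> = fam False False q" | i where "i \<in> {0, 1}" "\<xi> = fam True True i"
      unfolding mem_Collect_eq star_congruence_iff by metis
    then show "\<xi> \<in> {fam True True 0, fam True True 1, fam False False 0} \<union> {fam False False q | q. 1 \<le> q \<and> q \<le> n}"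
    proof cases
      case (1 q)
      then show ?thesis by (cases "q = 0") (auto simp: Suc_le_eq)
    qed blast
  next
    fix \<xi> assume "\<xi> \<in> {fam True True 0, fam True True 1, fam False False 0} \<union> {fam False False q | q. 1 \<le> q \<and> q \<le> n}"
    then have "(\<exists>q\<le>n. \<xi> = fam False False q) \<or> (\<exists>i\<in>{0, 1}. \<xi> = fam True True i)" by blast
    then show "\<xi> \<in> {\<xi>. star_congruence Kmon pstar \<xi>}" by (simp only: star_congruence_iff mem_Collect_eq)
  qed
  \<comment> \<open>The four relations to be removed are those with different flags; none of them
    may coincide with a relation that is kept.\<close>
  have ne: "fam u u q \<noteq> fam u' l' i" if "q \<le> n" "i \<le> 1" "u' \<noteq> l'" for u q u' l' i
    using fam_eq_iff[of q i u u u' l'] that n2 by auto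
  have 6: "{\<xi>. star_congruence Kmon pstar \<xi>} =
      {\<xi>. sg_congruence Kmon \<xi>} - {fam False True 0, fam False True 1, fam True False 0, fam True False 1}"
  proof -
    define S where "S = {fam False False q | q. q \<le> n}"
    define B where "B = {fam False True 0, fam False True 1, fam True False 0, fam True False 1}"
    define T where "T = {fam True True 0, fam True True 1}"
    have "S \<inter> B = {}" by (auto simp: S_def B_def not_sym[OF ne])
    moreover have "T \<inter> B = {}" using n01 by (auto simp: T_def B_def ne)
    moreover have "{fam False True 0, fam True False 0, fam True True 0, fam False True 1, fam True False 1, fam True True 1} = B \<union> T"
      unfolding B_def T_def by blast
    then have "{\<xi>. sg_congruence Kmon \<xi>} = S \<union> (B \<union> T)" unfolding 4 S_def by simp
    moreover have "{\<xi>. star_congruence Kmon pstar \<xi>} = S \<union> T"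
      unfolding star_congruence_iff S_def T_def by blast
    ultimately show ?thesis unfolding B_def[symmetric] by blast
  qed
  have 7: "\<forall>\<xi> \<zeta>. \<forall>i\<in>{0, 1}. \<forall>j\<in>{0, 1}. xi n Kmon \<xi> i \<subseteq> xi n Kmon \<zeta> j \<longleftrightarrow> diamond_le \<xi> \<zeta> \<and> i \<le> j"
  proof (intro allI ballI)
    fix \<xi> \<zeta> and i j :: nat assume ij: "i \<in> {0, 1}" "j \<in> {0, 1}"
    then have "i \<le> n" "j \<le> n" using n2 by auto
    then show "xi n Kmon \<xi> i \<subseteq> xi n Kmon \<zeta> j \<longleftrightarrow> diamond_le \<xi> \<zeta> \<and> i \<le> j"
      unfolding xi_eq[OF ij(1)] xi_eq[OF ij(2)] diamond_le_iff by (simp add: fam_subset_iff)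
  qed
  have 8: "\<forall>q. 1 \<le> q \<and> q < n \<longrightarrow> fam False False q \<subset> fam False False (q + 1)"
    by (simp add: psub)
  have 9: "fam True True 0 \<subset> fam True True 1" "fam True True 0 \<subset> fam False False 0"
    "fam True True 1 \<subset> fam False False 1" "fam False False 0 \<subset> fam False False 1"
    "\<not> fam True True 1 \<subseteq> fam False False 0" "\<not> fam False False 0 \<subseteq> fam True True 1"
    using n01 by (simp_all add: psub fam_subset_iff)
  show ?thesis
    using 1 retractable_IN_pairs 3 4 6 7 fam_0 8 fam_n 5 9
    unfolding x Kmon_simps by (intro conjI) assumption+
qed

end

theorem theorem7p3:
  fixes n :: nat and K :: "point set set monoid"
  assumes "n \<ge> 2"
    and "K = planar_partition_monoid n \<or> K = motzkin_monoid n"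
  shows
    "({I. sg_ideal K I} = {rank_ideal K q | q. q \<le> n})
   \<and> ({(I, N). retractable_IN_pair K I N \<and> (\<exists>q \<le> n. N = {id_bar n q})} =
       {(rank_ideal K 0, {id_bar n 1}), (rank_ideal K 1, {id_bar n 2})})
   \<and> (distinct (map (xi n K Rees) [0..<n + 1] @
        [xi n K Lambda 0, xi n K Rho 0, xi n K Mu 0, xi n K Lambda 1, xi n K Rho 1, xi n K Mu 1])
      \<and> {\<xi>. sg_congruence K \<xi>} =
        {xi n K Rees q | q. q \<le> n} \<union>
        {xi n K Lambda 0, xi n K Rho 0, xi n K Mu 0, xi n K Lambda 1, xi n K Rho 1, xi n K Mu 1})
   \<and> ({\<xi>. star_congruence K pstar \<xi>} =
       {\<xi>. sg_congruence K \<xi>} - {xi n K Lambda 0, xi n K Lambda 1, xi n K Rho 0, xi n K Rho 1})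
   \<and> ((\<forall>\<xi> \<zeta>. \<forall>i \<in> {0, 1}. \<forall>j \<in> {0, 1}.
         xi n K \<xi> i \<subseteq> xi n K \<zeta> j \<longleftrightarrow> diamond_le \<xi> \<zeta> \<and> i \<le> j)
      \<and> xi n K Mu 0 = Id_on (carrier K)
      \<and> (\<forall>q. 1 \<le> q \<and> q < n \<longrightarrow> xi n K Rees q \<subset> xi n K Rees (q + 1))
      \<and> xi n K Rees n = carrier K \<times> carrier K)
   \<and> ({\<xi>. star_congruence K pstar \<xi>} =
        {xi n K Mu 0, xi n K Mu 1, xi n K Rees 0} \<union> {xi n K Rees q | q. 1 \<le> q \<and> q \<le> n}
      \<and> xi n K Mu 0 \<subset> xi n K Mu 1 \<and> xi n K Mu 0 \<subset> xi n K Rees 0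
      \<and> xi n K Mu 1 \<subset> xi n K Rees 1 \<and> xi n K Rees 0 \<subset> xi n K Rees 1
      \<and> \<not> xi n K Mu 1 \<subseteq> xi n K Rees 0 \<and> \<not> xi n K Rees 0 \<subseteq> xi n K Mu 1)"
proof -
  have *: ?thesis if "K = planar_diagrams.Kmon n mot" for mot
  proof -
    interpret planar_diagrams n mot by unfold_locales (rule assms(1))
    show ?thesis unfolding that by (rule congruence_lattice)
  qed
  interpret P: planar_diagrams n False by unfold_locales (rule assms(1))
  interpret M: planar_diagrams n True by unfold_locales (rule assms(1))
  from assms(2) show ?thesis
  proof
    assume "K = planar_partition_monoid n"
    then show ?thesis by (intro *[of False]) (simp add: P.planar_monoid_eq)
  next
    assume "K = motzkin_monoid n"
    then show ?thesis by (intro *[of True]) (simp add: M.motzkin_monoid_eq)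
  qed
qed

end
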